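(* Let $\mathcal{H}$ be an $n$-dimensional CCPSR manifold, $n\geq 2$, with regular boundary behaviour, and let $(x,s_1,\ldots,s_{n-1},w)^{\mathrm{T}}=\left(\begin{smallmatrix}x\\ s\\ w\end{smallmatrix}\right)$ denote linear coordinates on $\mathbb{R}^{n+1}$. Then every limit geometry of $\mathcal{H}$ is, up to equivalence, given by the CCPSR manifold in standard form $\overline{\mathcal{H}}\subset\{\overline{h}=1\}$ corresponding to the cubic polynomial $$\overline{h}=x^3-x(\langle s,s\rangle+w^2)-\frac{1}{\sqrt{3}}\langle s,s\rangle w-\frac{2}{3\sqrt{3}}w^3.$$ The CCPSR manifold $\overline{\mathcal{H}}$ is isomorphic to the Lie group $\mathbb{R}_{>0}\ltimes\mathbb{R}^{n-1}$ with group multiplication $$(\lambda_1,v_1)\cdot(\lambda_2,v_2)=(\lambda_1\lambda_2,\;v_1+\lambda_1^{3/2}v_2),\qquad (\lambda_1,v_1),(\lambda_2,v_2)\in\mathbb{R}_{>0}\ltimes\mathbb{R}^{n-1},$$ where $(\lambda,v)\in\mathbb{R}_{>0}\ltimes\mathbb{R}^{n-1}$ acts (as a right action) on the coordinates by the linear map $\left(\begin{smallmatrix}x\\ s\\ w\end{smallmatrix}\right)\mapsto\left(\begin{smallmatrix}x'\\ s'\\ w'\end{smallmatrix}\right)$ with $$x'=\lambda\left(2\cdot3^{-3/2}w+2\cdot3^{-1}x\right)+\lambda^{-2}\left(-2\cdot3^{-3/2}w+3^{-1}x+\langle v,v\rangle\left(2^{1/2}\cdot3^{-3/2}w+2^{1/2}\cdot3^{-1}x\right)-2^{5/4}\cdot3^{-1}\langle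 s,v\rangle\right),$$ $$s'=\lambda^{-1/2}\left(s+\left(-2^{1/4}\cdot3^{-1/2}w-2^{1/4}x\right)v\right),$$ $$w'=\lambda\left(3^{-1}w+3^{-1/2}x\right)+\lambda^{-2}\left(2\cdot3^{-1}w-3^{-1/2}x+\langle v,v\rangle\left(-2^{1/2}\cdot3^{-1}w-2^{1/2}\cdot3^{-1/2}x\right)+2^{5/4}\cdot3^{-1/2}\langle s,v\rangle\right).$$ For $n=2$, that is for CCPSR surfaces, $\overline{\mathcal{H}}\cong\mathbb{R}_{>0}\ltimes\mathbb{R}\cong H$, where $H$ is the hyperbolic plane.
   Context: Let $h:\mathbb{R}^{n+1}\to\mathbb{R}$ be a cubic homogeneous polynomial. A point $p\in\{h>0\}$ is a hyperbolic point of $h$ if the negative Hessian $-\partial^2h_p$ has Lorentz signature ($n$ positive, one negative eigenvalue); $h$ is hyperbolic if it has a hyperbolic point. A projective special real (PSR) manifold of dimension $n$ is a smooth hypersurface $\mathcal{H}\subset\mathbb{R}^{n+1}$ contained in $\{h=1\}$ for a hyperbolic cubic homogeneous polynomial $h$ and consisting only of hyperbolic points of $h$. It carries the Riemannian metric $g_{\mathcal{H}}=-\frac13\partial^2h|_{T\mathcal{H}\times T\mathcal{H}}$ (centro-affine fundamental form). A CCPSR manifold is a PSR manifold that is connected and closed as a subset of $\mathbb{R}^{n+1}$. Standard form: with linear coordinates $(x,y)=(x,y_1,\dots,y_n)$ on $\mathbb{R}^{n+1}$, a CCPSR manifold $\mathcal{H}\subset\{h=1\}$ and $h$ are in standard form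 if $h=x^3-x\langle y,y\rangle+P_3(y)$ with $P_3:\mathbb{R}^n\to\mathbb{R}$ a cubic homogeneous polynomial and $\mathcal{H}$ is the connected component of $\{h=1\}$ containing $(x,y)=(1,0)$. Here $\langle\cdot,\cdot\rangle$ is the standard Euclidean scalar product. Two PSR manifolds of the same dimension are equivalent if they are related by a linear isomorphism of the ambient space (in particular the defining polynomials are related by it). Limit geometry: for $p\in\mathcal{H}$, $v\in T_p\mathcal{H}\setminus\{0\}$, let $R>0$ be the smallest positive zero of $t\mapsto h(p+tv)$ and let $\gamma:[0,R)\to\mathcal{H}$, $\gamma(t)=h(p+tv)^{-1/3}(p+tv)$, a curve leaving every compact subset of $\mathcal{H}$. For $t\in[0,R)$ choose $A(t)\in\mathrm{GL}(n+1)$, depending smoothly on $t$, with $A(t)\left(\begin{smallmatrix}1\\0\end{smallmatrix}\right)=\gamma(t)$ and such that $h|_t:=A(t)^*h=h\circ A(t)$ has the form $x^3-x\langle y,y\rangle+P_3(y)|_t$ for some cubic homogeneous polynomial $P_3(y)|_t$ on $\mathbb{R}^n$. If $\overline{h}=\lim_{t\to R}h|_t$ exists, it is called a limit polynomial, and the connected component $\overline{\mathcal{H}}$ of $\{\overline{h}=1\}$ containing $(1,0)$ is called a limit geometry of $\mathcal{H}$. A CCPSR manifold $\mathcal{H}\subset\{h=1\}$ is singular at infinity if there is $p\in\partial(\mathbb{R}_{>0}\cdot\mathcal{H})\setminus\{0\}$ with $\mathrm{d}h_p=0$. It has regular boundary behaviour if it is not singular at infinity and, for all $p\in\partial(\mathbb{R}_{>0}\cdot\mathcal{H})\setminus\{0\}$,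 the restriction of $-\partial^2h_p$ to $T_p(\partial(\mathbb{R}_{>0}\cdot\mathcal{H})\setminus\{0\})$ is positive semi-definite with one-dimensional kernel. "$\overline{\mathcal{H}}$ is isomorphic to the Lie group $\mathbb{R}_{>0}\ltimes\mathbb{R}^{n-1}$" means as a homogeneous space: the group acts simply transitively on $\overline{\mathcal{H}}$ by the restrictions of the displayed linear maps, which preserve $\overline{h}$. "$\cong H$" means that $(\overline{\mathcal{H}},g_{\overline{\mathcal{H}}})$ is isometric to the hyperbolic plane, up to constant rescaling of the metric. *)

theory Defs
  imports "HOL-Analysis.Analysis" "HOL-Algebra.Group"
begin

(* C^k and smooth maps.  The derivative is taken within S, so that a half-open interval
   {0..<R} is covered as well; S is only ever an open set or a nondegenerate interval, where
   the derivative within S is unique. *)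

primrec Ck_on :: "nat \<Rightarrow> 'a::real_normed_vector set \<Rightarrow> ('a \<Rightarrow> 'b::real_normed_vector) \<Rightarrow> bool" where
  "Ck_on 0 S f \<longleftrightarrow> continuous_on S f"
| "Ck_on (Suc k) S f \<longleftrightarrow>
     f differentiable_on S \<and> (\<forall>v. Ck_on k S (\<lambda>x. frechet_derivative f (at x within S) v))"

definition smooth_on :: "'a::real_normed_vector set \<Rightarrow> ('a \<Rightarrow> 'b::real_normed_vector) \<Rightarrow> bool" where
  "smooth_on S f \<longleftrightarrow> (\<forall>k. Ck_on k S f)"

definition smooth_hypersurface :: "'a::euclidean_space set \<Rightarrow> bool" where
  "smooth_hypersurface M \<longleftrightarrow>
     (\<forall>p\<in>M. \<exists>U (f :: 'a \<Rightarrow> real). open U \<and> p \<in> U \<and> smooth_on U f \<and>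
        (\<forall>q\<in>U. frechet_derivative f (at q) \<noteq> (\<lambda>_. 0)) \<and> M \<inter> U = {q \<in> U. f q = 0})"

definition tangent_space :: "'a::real_normed_vector set \<Rightarrow> 'a \<Rightarrow> 'a set" where
  "tangent_space M p =
     {v. \<exists>e>0. \<exists>c :: real \<Rightarrow> 'a. smooth_on {-e<..<e} c \<and> c ` {-e<..<e} \<subseteq> M \<and> c 0 = p \<and>
           (c has_vector_derivative v) (at 0)}"

definition cubic_form :: "('a::euclidean_space \<Rightarrow> real) \<Rightarrow> bool" where
  "cubic_form h \<longleftrightarrow>
     (\<exists>c. \<forall>x. h x = (\<Sum>i\<in>Basis. \<Sum>j\<in>Basis. \<Sum>k\<in>Basis. c i j k * (x \<bullet> i) * (x \<bullet> j) * (x \<bullet> k)))"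

definition hessian :: "('a::real_normed_vector \<Rightarrow> real) \<Rightarrow> 'a \<Rightarrow> 'a \<Rightarrow> 'a \<Rightarrow> real" where
  "hessian h p u v = frechet_derivative (\<lambda>q. frechet_derivative h (at q) u) (at p) v"

(* For a symmetric bilinear form B, the dimension of the span of the eigenvectors with positive
   (negative) eigenvalue is the number of positive (negative) eigenvalues of the matrix of B in
   the standard basis, counted with multiplicity. *)

definition lorentz_signature :: "('a::euclidean_space \<Rightarrow> 'a \<Rightarrow> real) \<Rightarrow> bool" where
  "lorentz_signature B \<longleftrightarrow>
     dim {v. \<exists>\<mu>>0. \<forall>u. B v u = \<mu> * (v \<bullet> u)} + 1 = DIM('a) \<and>
     dim {v. \<exists>\<mu><0. \<forall>u. B v u = \<mu> * (v \<bullet> u)} = 1"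

definition hyperbolic_point :: "('a::euclidean_space \<Rightarrow> real) \<Rightarrow> 'a \<Rightarrow> bool" where
  "hyperbolic_point h p \<longleftrightarrow> h p > 0 \<and> lorentz_signature (\<lambda>u v. - hessian h p u v)"

definition hyperbolic_cubic :: "('a::euclidean_space \<Rightarrow> real) \<Rightarrow> bool" where
  "hyperbolic_cubic h \<longleftrightarrow> cubic_form h \<and> (\<exists>p. hyperbolic_point h p)"

definition psr_manifold :: "('a::euclidean_space \<Rightarrow> real) \<Rightarrow> 'a set \<Rightarrow> bool" where
  "psr_manifold h H \<longleftrightarrow>
     hyperbolic_cubic h \<and> H \<noteq> {} \<and> smooth_hypersurface H \<and>
     (\<forall>p\<in>H. h p = 1 \<and> hyperbolic_point h p)"

definition ccpsr_manifold :: "('a::euclidean_space \<Rightarrow> real) \<Rightarrow> 'a set \<Rightarrow> bool" where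
  "ccpsr_manifold h H \<longleftrightarrow> psr_manifold h H \<and> connected H \<and> closed H"

(* To be evaluated on tangent vectors of the hypersurface at p. *)

definition psr_metric :: "('a::euclidean_space \<Rightarrow> real) \<Rightarrow> 'a \<Rightarrow> 'a \<Rightarrow> 'a \<Rightarrow> real" where
  "psr_metric h p u v = - (1/3) * hessian h p u v"

definition psr_equivalent ::
  "('a::euclidean_space \<Rightarrow> real) \<Rightarrow> 'a set \<Rightarrow> ('a \<Rightarrow> real) \<Rightarrow> 'a set \<Rightarrow> bool" where
  "psr_equivalent h1 H1 h2 H2 \<longleftrightarrow>
     psr_manifold h1 H1 \<and> psr_manifold h2 H2 \<and>
     (\<exists>A. linear A \<and> bij A \<and> A ` H1 = H2 \<and> h2 \<circ> A = h1)"

definition pos_cone :: "'a::real_vector set \<Rightarrow> 'a set" where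
  "pos_cone H = {r *\<^sub>R p | r p. r > 0 \<and> p \<in> H}"

definition singular_at_infinity :: "('a::euclidean_space \<Rightarrow> real) \<Rightarrow> 'a set \<Rightarrow> bool" where
  "singular_at_infinity h H \<longleftrightarrow>
     (\<exists>p \<in> frontier (pos_cone H) - {0}. frechet_derivative h (at p) = (\<lambda>_. 0))"

definition regular_boundary_behaviour :: "('a::euclidean_space \<Rightarrow> real) \<Rightarrow> 'a set \<Rightarrow> bool" where
  "regular_boundary_behaviour h H \<longleftrightarrow>
     \<not> singular_at_infinity h H \<and>
     (\<forall>p \<in> frontier (pos_cone H) - {0}.
        let T = tangent_space (frontier (pos_cone H) - {0}) p in
        (\<forall>v\<in>T. - hessian h p v v \<ge> 0) \<and>
        dim {v \<in> T. \<forall>u\<in>T. - hessian h p v u = 0} = 1)"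

definition standard_form :: "(real \<times> 'b::euclidean_space \<Rightarrow> real) \<Rightarrow> bool" where
  "standard_form h \<longleftrightarrow>
     (\<exists>P3. cubic_form P3 \<and> (\<forall>x y. h (x, y) = x ^ 3 - x * (y \<bullet> y) + P3 y))"

definition base_component :: "(real \<times> 'b::euclidean_space \<Rightarrow> real) \<Rightarrow> (real \<times> 'b) set" where
  "base_component h = connected_component_set {z. h z = 1} (1, 0)"

definition ccpsr_in_standard_form ::
  "(real \<times> 'b::euclidean_space \<Rightarrow> real) \<Rightarrow> (real \<times> 'b) set \<Rightarrow> bool" where
  "ccpsr_in_standard_form h H \<longleftrightarrow>
     ccpsr_manifold h H \<and> standard_form h \<and> H = base_component h"

(* Smoothness of t |-> A t in GL(n+1) is smoothness of all A t z.  All h o A t lie in the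
   finite-dimensional space of cubic forms, on which convergence of the coefficients is the same
   as pointwise convergence. *)

definition limit_geometry ::
  "(real \<times> 'b::euclidean_space \<Rightarrow> real) \<Rightarrow> (real \<times> 'b) set \<Rightarrow>
   (real \<times> 'b \<Rightarrow> real) \<Rightarrow> (real \<times> 'b) set \<Rightarrow> bool" where
  "limit_geometry h H h' H' \<longleftrightarrow>
     (\<exists>p v R. \<exists>A :: real \<Rightarrow> real \<times> 'b \<Rightarrow> real \<times> 'b.
        p \<in> H \<and> v \<in> tangent_space H p - {0} \<and>
        0 < R \<and> h (p + R *\<^sub>R v) = 0 \<and> (\<forall>t\<in>{0<..<R}. h (p + t *\<^sub>R v) \<noteq> 0) \<and>
        (\<forall>t\<in>{0..<R}. linear (A t) \<and> bij (A t) \<and>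
           A t (1, 0) = (h (p + t *\<^sub>R v) powr (-1/3)) *\<^sub>R (p + t *\<^sub>R v) \<and>
           standard_form (h \<circ> A t)) \<and>
        (\<forall>z. smooth_on {0..<R} (\<lambda>t. A t z)) \<and>
        (\<forall>z. ((\<lambda>t. (h \<circ> A t) z) \<longlongrightarrow> h' z) (at_left R)) \<and>
        H' = base_component h')"

(* A Lie group whose underlying manifold is an open subset of a Euclidean space. *)

definition open_lie_group :: "('a::euclidean_space) monoid \<Rightarrow> bool" where
  "open_lie_group G \<longleftrightarrow>
     group G \<and> open (carrier G) \<and>
     smooth_on (carrier G \<times> carrier G) (\<lambda>(a, b). mult G a b) \<and>
     smooth_on (carrier G) (m_inv G)"

definition simply_transitive_right_action ::
  "'g monoid \<Rightarrow> ('g \<Rightarrow> 'a \<Rightarrow> 'a) \<Rightarrow> 'a set \<Rightarrow> bool" where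
  "simply_transitive_right_action G \<phi> M \<longleftrightarrow>
     (\<forall>g\<in>carrier G. \<forall>p\<in>M. \<phi> g p \<in> M) \<and>
     (\<forall>p\<in>M. \<phi> (one G) p = p) \<and>
     (\<forall>a\<in>carrier G. \<forall>b\<in>carrier G. \<forall>p\<in>M. \<phi> (mult G a b) p = \<phi> b (\<phi> a p)) \<and>
     (\<forall>p\<in>M. \<forall>q\<in>M. \<exists>!g. g \<in> carrier G \<and> \<phi> g p = q)"

(* Riemannian isometry from an open subset U of a Euclidean space, with metric gU, onto an
   embedded submanifold M with metric gM: a diffeomorphism F (the inverse is smooth in the sense
   of being the restriction of a smooth map on an open neighbourhood of M) with F^* gM = gU. *)

definition isometric_onto ::
  "'a::euclidean_space set \<Rightarrow> ('a \<Rightarrow> 'a \<Rightarrow> 'a \<Rightarrow> real) \<Rightarrow>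
   'b::euclidean_space set \<Rightarrow> ('b \<Rightarrow> 'b \<Rightarrow> 'b \<Rightarrow> real) \<Rightarrow> bool" where
  "isometric_onto U gU M gM \<longleftrightarrow>
     (\<exists>(F :: 'a \<Rightarrow> 'b) W (K :: 'b \<Rightarrow> 'a).
        smooth_on U F \<and> F ` U = M \<and>
        open W \<and> M \<subseteq> W \<and> smooth_on W K \<and> (\<forall>z\<in>U. K (F z) = z) \<and>
        (\<forall>z\<in>U. \<forall>u v. gM (F z) (frechet_derivative F (at z) u) (frechet_derivative F (at z) v)
                       = gU z u v))"

(* The hyperbolic plane as the upper half plane with metric (da^2 + db^2) / b^2. *)

definition half_plane :: "(real \<times> real) set" where
  "half_plane = {z. snd z > 0}"

definition half_plane_metric :: "real \<times> real \<Rightarrow> real \<times> real \<Rightarrow> real \<times> real \<Rightarrow> real" where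
  "half_plane_metric z u v = (u \<bullet> v) / (snd z)\<^sup>2"

(* R^(n+1) with coordinates (x, s, w) is the type real * (real^'m) * real, where
   CARD('m) = n - 1, so that n >= 2 is arbitrary; y = (s, w) ranges over R^n. *)

definition hbar :: "real \<times> (real^'m) \<times> real \<Rightarrow> real" where
  "hbar = (\<lambda>(x, s, w).
     x ^ 3 - x * (s \<bullet> s + w\<^sup>2) - 1 / sqrt 3 * (s \<bullet> s) * w - 2 / (3 * sqrt 3) * w ^ 3)"

definition Hbar :: "(real \<times> (real^'m) \<times> real) set" where
  "Hbar = base_component hbar"

definition semidirect_group :: "(real \<times> (real^'m)) monoid" where
  "semidirect_group =
     \<lparr> carrier = {0<..} \<times> UNIV,
       mult = (\<lambda>(l1, v1) (l2, v2). (l1 * l2, v1 + (l1 powr (3/2)) *\<^sub>R v2)),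
       one = (1, 0) \<rparr>"

definition displayed_map ::
  "real \<times> (real^'m) \<Rightarrow> real \<times> (real^'m) \<times> real \<Rightarrow> real \<times> (real^'m) \<times> real" where
  "displayed_map = (\<lambda>(l, v) (x, s, w).
     ( l * (2 * 3 powr (-3/2) * w + 2 * 3 powr (-1) * x)
       + l powr (-2) * (- 2 * 3 powr (-3/2) * w + 3 powr (-1) * x
           + (v \<bullet> v) * (2 powr (1/2) * 3 powr (-3/2) * w + 2 powr (1/2) * 3 powr (-1) * x)
           - 2 powr (5/4) * 3 powr (-1) * (s \<bullet> v)),
       (l powr (-1/2)) *\<^sub>R
         (s + (- (2 powr (1/4)) * 3 powr (-1/2) * w - 2 powr (1/4) * x) *\<^sub>R v),
       l * (3 powr (-1) * w + 3 powr (-1/2) * x)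
       + l powr (-2) * (2 * 3 powr (-1) * w - 3 powr (-1/2) * x
           + (v \<bullet> v) * (- (2 powr (1/2)) * 3 powr (-1) * w - 2 powr (1/2) * 3 powr (-1/2) * x)
           + 2 powr (5/4) * 3 powr (-1/2) * (s \<bullet> v)) ))"

end

theory Submission
  imports Defs
begin

text \<open>Two facts carry the theorem: in suitable linear coordinates the model cubic is so simple that
  its symmetries and its metric can be read off, and regular boundary behaviour fixes the leading
  terms of \<open>h\<close> at a boundary point so tightly that magnifying this point turns \<open>h\<close> into
  the model.

  In the coordinates \<open>ell = x + w / sqrt 3\<close>, \<open>emm = x - 2 w / sqrt 3\<close> and
  \<open>s\<close> the cubic \<open>hbar\<close> is \<open>ell (ell emm - |s|\<^sup>2)\<close>. The level set
  \<open>hbar = 1\<close> avoids \<open>ell = 0\<close>, and for \<open>ell > 0\<close> it is a graph over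
  \<open>(ell, s)\<close> (\<open>Hbar_eq\<close>). The displayed maps multiply \<open>ell\<close> by
  \<open>\<lambda>\<close> and shear \<open>s\<close> by a multiple of \<open>ell v\<close>
  (\<open>displayed_map_lsm\<close>), so they act simply transitively on pairs
  \<open>(ell, s)\<close>. On the tangent spaces the metric is a sum of squares
  (\<open>hbar_polar_hyperplane\<close>), which gives hyperbolicity and, for surfaces, the metric of the
  upper half plane.

  For the limits, let \<open>q = p + R v\<close> be the point at which the ray leaves the cone over
  \<open>H\<close>, and let \<open>T\<close> be the polarization of \<open>h\<close>. The hypersurface \<open>H\<close> is
  open and closed in \<open>{h = 1}\<close>, hence the boundary of the cone agrees near \<open>q\<close> with
  the zero set of \<open>h\<close>, and its tangent space at \<open>q\<close> is the full kernel of
  \<open>dh q\<close> (\<open>tangent_space_frontier\<close>). Regular boundary behaviour therefore says that the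
  negative Hessian at \<open>q\<close> is positive definite on a complement of \<open>q\<close> in this kernel; it
  also forces \<open>v\<close> to be transversal (\<open>regular_end_point\<close>). In a basis consisting of
  \<open>q\<close>, an orthonormal frame of the complement, and \<open>- v\<close>, with coordinates
  \<open>a\<close>, \<open>s\<close>, \<open>b\<close>, the cubic becomes
  \<open>c a\<^sup>2 b - a |s|\<^sup>2\<close> plus further terms. Under rescaling of \<open>a\<close>, \<open>s\<close>,
  \<open>b\<close> with weights \<open>-2\<close>, \<open>1\<close>, \<open>4\<close> the two displayed terms are invariant and
  the others tend to zero, so that \<open>hbar\<close> remains (\<open>blow_up_tendsto\<close>). The rescaled
  base point follows the curve along which the limit is taken. Since the standard form fixes the
  coordinates around the base point up to the orthogonal group, which is compact, every choice of frames has the same limit up to an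
  orthogonal map (\<open>standard_form_limit\<close>).\<close>

section \<open>Maps of class \<open>C\<^sup>k\<close> on open sets\<close>

lemma Ck_on_cong:
  assumes "\<And>x. x \<in> S \<Longrightarrow> f x = g x"
  shows "Ck_on k S f \<longleftrightarrow> Ck_on k S g"
  using assms
proof (induction k arbitrary: f g)
  case 0
  then show ?case by (auto intro: continuous_on_cong)
next
  case (Suc k)
  have der: "(f has_derivative D) (at x within S) \<longleftrightarrow> (g has_derivative D) (at x within S)"
    if "x \<in> S" for x D
    using has_derivative_transform[of x S f g D] has_derivative_transform[of x S g f D]
      that Suc.prems by auto
  have "frechet_derivative f (at x within S) = frechet_derivative g (at x within S)"
    if "x \<in> S" for x
    unfolding frechet_derivative_def der[OF that] ..
  then have "Ck_on k S (\<lambda>x. frechet_derivative f (at x within S) v)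
      \<longleftrightarrow> Ck_on k S (\<lambda>x. frechet_derivative g (at x within S) v)" for v
    by (intro Suc.IH) simp
  moreover have "f differentiable_on S \<longleftrightarrow> g differentiable_on S"
    unfolding differentiable_on_def differentiable_def using der by blast
  ultimately show ?case by simp
qed

text \<open>On an open set the derivative within the set is the ordinary one, so any expression for the
  derivative may be used to climb from order \<open>k\<close> to order \<open>Suc k\<close>. The closure
  properties below all use this: the derivative of a composite is built by the same operations
  from \<open>f\<close> and its directional derivatives, which are regular of order \<open>k\<close>.\<close>
lemma Ck_on_Suc_iff:
  assumes "open S" and "\<And>x. x \<in> S \<Longrightarrow> (f has_derivative f' x) (at x)"
  shows "Ck_on (Suc k) S f \<longleftrightarrow> (\<forall>v. Ck_on k S (\<lambda>x. f' x v))"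
proof -
  have "frechet_derivative f (at x within S) = f' x" if "x \<in> S" for x
    using frechet_derivative_at[OF assms(2)[OF that]] at_within_open[OF that assms(1)] by simp
  then have "Ck_on k S (\<lambda>x. frechet_derivative f (at x within S) v) \<longleftrightarrow> Ck_on k S (\<lambda>x. f' x v)" for v
    by (intro Ck_on_cong) simp
  moreover have "f differentiable_on S"
    using assms unfolding differentiable_on_def differentiable_def
    by (metis has_derivative_at_withinI)
  ultimately show ?thesis by simp
qed

lemma Ck_on_SucI:
  assumes "open S" and "\<And>x. x \<in> S \<Longrightarrow> (f has_derivative f' x) (at x)" and "\<And>v. Ck_on k S (\<lambda>x. f' x v)"
  shows "Ck_on (Suc k) S f"
  using Ck_on_Suc_iff[OF assms(1,2)] assms(3) by blast

lemma Ck_on_Suc_derivative: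
  assumes "open S" "Ck_on (Suc k) S f"
  obtains f' where "\<And>x. x \<in> S \<Longrightarrow> (f has_derivative f' x) (at x)" "\<And>v. Ck_on k S (\<lambda>x. f' x v)"
proof
  show "(f has_derivative frechet_derivative f (at x within S)) (at x)" if "x \<in> S" for x
    using assms that at_within_open[OF that assms(1)] unfolding Ck_on.simps differentiable_on_def
    by (metis frechet_derivative_works)
  show "Ck_on k S (\<lambda>x. frechet_derivative f (at x within S) v)" for v
    using assms by simp
qed

lemma Ck_on_SucD: "Ck_on (Suc k) S f \<Longrightarrow> Ck_on k S f"
proof (induction k arbitrary: f)
  case 0
  then show ?case by (auto intro: differentiable_imp_continuous_on)
next
  case (Suc k)
  then show ?case by (metis Ck_on.simps(2))
qed

lemma Ck_on_const: "open S \<Longrightarrow> Ck_on k S (\<lambda>_. c)"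
proof (induction k arbitrary: c)
  case (Suc k)
  show ?case
    by (rule Ck_on_SucI[OF Suc.prems has_derivative_const Suc.IH[OF Suc.prems]])
qed simp

lemma Ck_on_bounded_linear:
  assumes "open S" "bounded_linear L" "Ck_on k S f"
  shows "Ck_on k S (\<lambda>x. L (f x))"
  using assms(3)
proof (induction k arbitrary: f)
  case 0
  then show ?case using assms(2) by (auto intro: bounded_linear.continuous_on)
next
  case (Suc k)
  obtain f' where f': "\<And>x. x \<in> S \<Longrightarrow> (f has_derivative f' x) (at x)" "\<And>v. Ck_on k S (\<lambda>x. f' x v)"
    using Ck_on_Suc_derivative[OF assms(1) Suc.prems] by blast
  show ?case
    by (rule Ck_on_SucI[OF assms(1) bounded_linear.has_derivative[OF assms(2) f'(1)] Suc.IH[OF f'(2)]])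
qed

lemma Ck_on_ident: 
  assumes "open S" shows "Ck_on k S (\<lambda>x. x)"
proof (cases k)
  case (Suc j)
  have "Ck_on (Suc j) S (\<lambda>x. x)"
    by (rule Ck_on_SucI[OF assms has_derivative_ident Ck_on_const[OF assms]])
  then show ?thesis using Suc by simp
qed simp

lemma Ck_on_linear:
  assumes "open S" "bounded_linear L"
  shows "Ck_on k S L"
  using Ck_on_bounded_linear[OF assms Ck_on_ident[OF assms(1)]] .

lemma Ck_on_add:
  assumes "open S" "Ck_on k S f" "Ck_on k S g"
  shows "Ck_on k S (\<lambda>x. f x + g x)"
  using assms(2,3)
proof (induction k arbitrary: f g)
  case 0
  then show ?case by (auto intro: continuous_intros)
next
  case (Suc k)
  obtain f' where f': "\<And>x. x \<in> S \<Longrightarrow> (f has_derivative f' x) (at x)" "\<And>v. Ck_on k S (\<lambda>x. f' x v)"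
    using Ck_on_Suc_derivative[OF assms(1) Suc.prems(1)] by blast
  obtain g' where g': "\<And>x. x \<in> S \<Longrightarrow> (g has_derivative g' x) (at x)" "\<And>v. Ck_on k S (\<lambda>x. g' x v)"
    using Ck_on_Suc_derivative[OF assms(1) Suc.prems(2)] by blast
  show ?case
    by (rule Ck_on_SucI[OF assms(1) has_derivative_add[OF f'(1) g'(1)] Suc.IH[OF f'(2) g'(2)]])
qed

lemma Ck_on_bounded_bilinear:
  assumes "open S" "bounded_bilinear P" "Ck_on k S f" "Ck_on k S g"
  shows "Ck_on k S (\<lambda>x. P (f x) (g x))"
  using assms(3,4)
proof (induction k arbitrary: f g)
  case 0
  then show ?case using assms(2) by (auto intro: bounded_bilinear.continuous_on)
next
  case (Suc k)
  obtain f' where f': "\<And>x. x \<in> S \<Longrightarrow> (f has_derivative f' x) (at x)" "\<And>v. Ck_on k S (\<lambda>x. f' x v)"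
    using Ck_on_Suc_derivative[OF assms(1) Suc.prems(1)] by blast
  obtain g' where g': "\<And>x. x \<in> S \<Longrightarrow> (g has_derivative g' x) (at x)" "\<And>v. Ck_on k S (\<lambda>x. g' x v)"
    using Ck_on_Suc_derivative[OF assms(1) Suc.prems(2)] by blast
  have "Ck_on k S (\<lambda>x. P (f x) (g' x v) + P (f' x v) (g x))" for v
    using Suc.IH f'(2) g'(2) Suc.prems[THEN Ck_on_SucD] by (intro Ck_on_add[OF assms(1)]) auto
  then show ?case
    by (intro Ck_on_SucI[OF assms(1) bounded_bilinear.FDERIV[OF assms(2) f'(1) g'(1)]])
qed

text \<open>The exponent has to vary in the induction, because differentiation lowers it by one. Real powers
  are also the way in which reciprocals of positive functions are treated.\<close>
lemma Ck_on_powr: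
  fixes f :: "'a::real_normed_vector \<Rightarrow> real"
  assumes "open S" "Ck_on k S f" "\<And>x. x \<in> S \<Longrightarrow> f x > 0"
  shows "Ck_on k S (\<lambda>x. f x powr a)"
  using assms(2)
proof (induction k arbitrary: a)
  case 0
  have "f x \<noteq> 0" if "x \<in> S" for x using assms(3)[OF that] by simp
  then show ?case using 0 by (auto intro!: continuous_on_powr continuous_on_const)
next
  case (Suc k)
  obtain f' where f': "\<And>x. x \<in> S \<Longrightarrow> (f has_derivative f' x) (at x)" "\<And>v. Ck_on k S (\<lambda>x. f' x v)"
    using Ck_on_Suc_derivative[OF assms(1) Suc.prems] by blast
  have der: "((\<lambda>x. f x powr a) has_derivative (\<lambda>v. f x powr (a - 1) * (a * f' x v))) (at x)"
    if x: "x \<in> S" for x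
  proof -
    have "((\<lambda>y. y powr a) has_derivative (\<lambda>v. v * (a * f x powr (a - 1)))) (at (f x))"
      using has_real_derivative_powr[OF assms(3)[OF x], of a]
      unfolding has_field_derivative_def by (simp add: mult.commute[of _ "a * _"])
    from has_derivative_compose[OF f'(1)[OF x] this] show ?thesis
      by (simp add: mult_ac)
  qed
  have "Ck_on k S (\<lambda>x. f x powr (a - 1) * (a * f' x v))" for v
    by (intro Ck_on_bounded_bilinear[OF assms(1) bounded_bilinear_mult] Ck_on_const[OF assms(1)]
        Suc.IH f'(2) Ck_on_SucD[OF Suc.prems])
  then show ?case
    by (intro Ck_on_SucI[OF assms(1) der])
qed

lemma smooth_on_cong:
  assumes "\<And>x. x \<in> S \<Longrightarrow> f x = g x"
  shows "smooth_on S f \<longleftrightarrow> smooth_on S g"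
  unfolding smooth_on_def using Ck_on_cong[of S f g] assms by blast

context
  fixes S :: "'a::real_normed_vector set"
  assumes S: "open S"
begin

lemma smooth_on_const: "smooth_on S (\<lambda>_. c)"
  by (simp add: smooth_on_def Ck_on_const[OF S])

lemma smooth_on_linear: "bounded_linear L \<Longrightarrow> smooth_on S L"
  by (simp add: smooth_on_def Ck_on_linear[OF S])

lemma smooth_on_ident: "smooth_on S (\<lambda>x. x)"
  by (simp add: smooth_on_def Ck_on_ident[OF S])

lemma smooth_on_bounded_linear: "bounded_linear L \<Longrightarrow> smooth_on S f \<Longrightarrow> smooth_on S (\<lambda>x. L (f x))"
  by (simp add: smooth_on_def Ck_on_bounded_linear[OF S])

lemma smooth_on_add: "smooth_on S f \<Longrightarrow> smooth_on S g \<Longrightarrow> smooth_on S (\<lambda>x. f x + g x)"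
  by (simp add: smooth_on_def Ck_on_add[OF S])

lemma smooth_on_uminus: "smooth_on S f \<Longrightarrow> smooth_on S (\<lambda>x. - f x)"
  using smooth_on_bounded_linear[OF bounded_linear_minus[OF bounded_linear_ident]] .

lemma smooth_on_diff: "smooth_on S f \<Longrightarrow> smooth_on S g \<Longrightarrow> smooth_on S (\<lambda>x. f x - g x)"
  using smooth_on_add[OF _ smooth_on_uminus] by force

lemma smooth_on_bilinear:
  "bounded_bilinear P \<Longrightarrow> smooth_on S f \<Longrightarrow> smooth_on S g \<Longrightarrow> smooth_on S (\<lambda>x. P (f x) (g x))"
  by (simp add: smooth_on_def Ck_on_bounded_bilinear[OF S])

lemmas smooth_on_scaleR = smooth_on_bilinear[OF bounded_bilinear_scaleR]
lemmas smooth_on_mult = smooth_on_bilinear[OF bounded_bilinear_mult]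
lemmas smooth_on_inner = smooth_on_bilinear[OF bounded_bilinear_inner]

lemma smooth_on_sum: "(\<And>i. i \<in> I \<Longrightarrow> smooth_on S (f i)) \<Longrightarrow> smooth_on S (\<lambda>x. \<Sum>i\<in>I. f i x)"
proof (induction I rule: infinite_finite_induct)
  case (insert i I)
  then show ?case by (simp add: smooth_on_add)
qed (simp_all add: smooth_on_const)

lemma smooth_on_powr:
  fixes f :: "'a \<Rightarrow> real"
  shows "smooth_on S f \<Longrightarrow> (\<And>x. x \<in> S \<Longrightarrow> f x > 0) \<Longrightarrow> smooth_on S (\<lambda>x. f x powr a)"
  by (simp add: smooth_on_def Ck_on_powr[OF S])

lemma smooth_on_Pair: 
  assumes "smooth_on S f" "smooth_on S g"
  shows "smooth_on S (\<lambda>x. (f x, g x))"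
proof -
  have "bounded_linear (\<lambda>y. (y, 0))" "bounded_linear (\<lambda>y. (0, y))"
    by (intro bounded_linear_Pair bounded_linear_ident bounded_linear_zero)+
  from this[THEN smooth_on_bounded_linear] assms
  have "smooth_on S (\<lambda>x. (f x, 0) + (0, g x))" by (intro smooth_on_add)
  then show ?thesis by simp
qed

end

lemma smooth_on_has_derivative:
  assumes "open S" "smooth_on S f" "x \<in> S"
  shows "(f has_derivative frechet_derivative f (at x)) (at x)"
proof -
  have "Ck_on (Suc 0) S f" using assms(2) by (simp only: smooth_on_def)
  then obtain f' where "\<And>x. x \<in> S \<Longrightarrow> (f has_derivative f' x) (at x)" "\<And>v. Ck_on 0 S (\<lambda>x. f' x v)"
    using Ck_on_Suc_derivative[OF assms(1)] by blast
  from this(1)[OF assms(3)] show ?thesis using frechet_derivative_at by metis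
qed

section \<open>Cubic forms and their polarizations\<close>

text \<open>A cubic form is handled through its polarization: a symmetric trilinear form \<open>T\<close>
  with cubic \<open>T x x x\<close>. The first derivative is then \<open>3 T p p u\<close> and the Hessian
  \<open>6 T p u v\<close>, so that all conditions on derivatives become algebraic.\<close>
locale sym_trilinear =
  fixes T :: "'a::euclidean_space \<Rightarrow> 'a \<Rightarrow> 'a \<Rightarrow> real"
  assumes linear_1: "linear (\<lambda>x. T x y z)"
    and swap_12: "T x y z = T y x z"
    and swap_23: "T x y z = T x z y"
begin

lemma linear_2: "linear (\<lambda>y. T x y z)"
  using linear_1[of x z] by (simp add: swap_12)

lemma linear_3: "linear (\<lambda>z. T x y z)"
  using linear_2[of x y] by (simp add: swap_23)

lemmas add = linear_add[OF linear_1] linear_add[OF linear_2] linear_add[OF linear_3]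
lemmas diff = linear_diff[OF linear_1] linear_diff[OF linear_2] linear_diff[OF linear_3]
lemmas scale = linear_cmul[OF linear_1] linear_cmul[OF linear_2] linear_cmul[OF linear_3]
lemmas zero = linear_0[OF linear_1] linear_0[OF linear_2] linear_0[OF linear_3]
lemmas neg = linear_neg[OF linear_1] linear_neg[OF linear_2] linear_neg[OF linear_3]
lemmas swap_13 = trans[OF swap_12 trans[OF swap_23 swap_12]]

lemma bounded_bilinear_12: "bounded_bilinear (\<lambda>x y. T x y z)"
  using linear_1 linear_2 by (simp add: bilinear_conv_bounded_bilinear[symmetric] bilinear_def)

lemma expand_1: "T x y z = (\<Sum>i\<in>Basis. (x \<bullet> i) * T i y z)"
proof -
  have "T x y z = T (\<Sum>i\<in>Basis. (x \<bullet> i) *\<^sub>R i) y z"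
    by (simp add: euclidean_representation)
  then show ?thesis
    by (simp add: linear_sum[OF linear_1] scale)
qed

lemma expand: "T x y z = (\<Sum>i\<in>Basis. \<Sum>j\<in>Basis. \<Sum>k\<in>Basis. T i j k * (x \<bullet> i) * (y \<bullet> j) * (z \<bullet> k))"
proof -
  have "T i y z = (\<Sum>j\<in>Basis. \<Sum>k\<in>Basis. T i j k * (y \<bullet> j) * (z \<bullet> k))" for i
  proof -
    have "T i y z = (\<Sum>j\<in>Basis. (y \<bullet> j) * T i j z)" 
      using expand_1[of y i z] by (simp add: swap_12)
    moreover have "T i j z = (\<Sum>k\<in>Basis. (z \<bullet> k) * T i j k)" for j
      using expand_1[of z j i] by (simp add: swap_13)
    ultimately show ?thesis by (simp add: sum_distrib_left mult_ac)
  qed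
  then show ?thesis using expand_1[of x y z] by (simp add: sum_distrib_left mult_ac)
qed

lemma has_derivative_23: "((\<lambda>x. T x x u) has_derivative (\<lambda>v. 2 * T p u v)) (at p)"
proof -
  have "((\<lambda>x. T x x u) has_derivative (\<lambda>v. T p v u + T v p u)) (at p)"
    by (rule bounded_bilinear.FDERIV[OF bounded_bilinear_12]) (rule has_derivative_ident)+
  moreover have "T p v u + T v p u = 2 * T p u v" for v
    using swap_12[of v p u] swap_23[of p v u] by simp
  ultimately show ?thesis by simp
qed

lemma cube_add: "T (x + u) (x + u) (x + u) = T x x x + 3 * T x x u + 3 * T x u u + T u u u"
proof -
  have "T x u x = T x x u" "T u x x = T x x u" "T u x u = T x u u" "T u u x = T x u u"
    by (metis swap_12 swap_23)+
  then show ?thesis by (simp add: add)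
qed

lemma cube_scale: "T (c *\<^sub>R x) (c *\<^sub>R x) (c *\<^sub>R x) = c ^ 3 * T x x x"
  by (simp add: scale power3_eq_cube)

lemma cube_expand: "T x x x = (\<Sum>i\<in>Basis. (x \<bullet> i) * T x x i)"
proof -
  have "T x x i = T i x x" for i by (rule swap_13)
  then show ?thesis unfolding expand_1[of x x x] by simp
qed

lemma continuous_on_cube: "continuous_on S (\<lambda>x. T x x x)"
proof -
  have "continuous_on S (\<lambda>x. T x x u)" for u
    by (intro bounded_bilinear.continuous_on[OF bounded_bilinear_12] continuous_on_id)
  then have "continuous_on S (\<lambda>x. \<Sum>i\<in>Basis. (x \<bullet> i) * T x x i)"
    by (intro continuous_intros)
  then show ?thesis unfolding cube_expand[symmetric] .
qed

lemma has_derivative_cube: "((\<lambda>x. T x x x) has_derivative (\<lambda>u. 3 * T p p u)) (at p)"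
proof -
  have "((\<lambda>x. (x \<bullet> i) * T x x i) has_derivative (\<lambda>v. (p \<bullet> i) * (2 * T p i v) + (v \<bullet> i) * T p p i)) (at p)" for i
    by (intro has_derivative_mult has_derivative_23 has_derivative_inner_left has_derivative_ident)
  then have "((\<lambda>x. \<Sum>i\<in>Basis. (x \<bullet> i) * T x x i) has_derivative
     (\<lambda>v. \<Sum>i\<in>Basis. (p \<bullet> i) * (2 * T p i v) + (v \<bullet> i) * T p p i)) (at p)"
    by (intro has_derivative_sum)
  moreover have "(\<Sum>i\<in>Basis. (p \<bullet> i) * (2 * T p i v) + (v \<bullet> i) * T p p i) = 3 * T p p v" for v
  proof -
    have "(\<Sum>i\<in>Basis. (p \<bullet> i) * (2 * T p i v)) = 2 * T p p v"
    proof -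
      have "T p i v = T i p v" for i by (rule swap_12)
      then show ?thesis unfolding expand_1[of p p v] sum_distrib_left by (simp add: mult_ac)
    qed
    moreover have "(\<Sum>i\<in>Basis. (v \<bullet> i) * T p p i) = T p p v"
    proof -
      have "T p p i = T i p p" for i by (rule swap_13)
      then show ?thesis unfolding swap_13[of p p v] expand_1[of v p p] by simp
    qed
    ultimately show ?thesis by (simp add: sum.distrib)
  qed
  ultimately show ?thesis unfolding cube_expand[symmetric] by simp
qed

lemma frechet_derivative_cube: "frechet_derivative (\<lambda>x. T x x x) (at p) = (\<lambda>u. 3 * T p p u)"
  using frechet_derivative_at[OF has_derivative_cube] ..

lemma hessian_cube: "hessian (\<lambda>x. T x x x) p u v = 6 * T p u v"
proof -
  have "((\<lambda>x. 3 * T x x u) has_derivative (\<lambda>v. 3 * (2 * T p u v))) (at p)"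
    by (intro has_derivative_mult_right has_derivative_23)
  from frechet_derivative_at[OF this, symmetric] show ?thesis
    unfolding hessian_def frechet_derivative_cube by simp
qed

lemma smooth_on_square: 
  assumes "open S" "smooth_on S c"
  shows "smooth_on S (\<lambda>t. T (c t) (c t) u)"
  using smooth_on_bilinear[OF assms(1) bounded_bilinear_12 assms(2) assms(2)] .

lemma smooth_on_cube: 
  assumes "open S"
  shows "smooth_on S (\<lambda>x. T x x x)"
proof -
  have "smooth_on S (\<lambda>x. \<Sum>i\<in>Basis. (x \<bullet> i) * T x x i)"
    using assms by (intro smooth_on_sum smooth_on_mult smooth_on_square smooth_on_inner smooth_on_const smooth_on_ident)
  then show ?thesis unfolding cube_expand[symmetric] .
qed

lemma cubic_form_cube: "cubic_form (\<lambda>x. T x x x)"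
  unfolding cubic_form_def by (rule exI[of _ T]) (use expand in blast)

text \<open>The polarization is a combination of values of the cubic, so pointwise convergence of cubics
  implies pointwise convergence of their polarizations.\<close>
lemma polarization:
  "6 * T x y z = T (x+y+z) (x+y+z) (x+y+z) - T (x+y) (x+y) (x+y) - T (y+z) (y+z) (y+z)
     - T (x+z) (x+z) (x+z) + T x x x + T y y y + T z z z"
proof -
  have "T x z y = T x y z" "T y x z = T x y z" "T y z x = T x y z" "T z x y = T x y z" "T z y x = T x y z"
    by (metis swap_12 swap_23)+
  then show ?thesis by (simp add: add)
qed

lemma compose_linear:
  fixes A :: "'b::euclidean_space \<Rightarrow> 'a"
  assumes "linear A"
  shows "sym_trilinear (\<lambda>x y z. T (A x) (A y) (A z))"
proof (rule sym_trilinear.intro)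
  show "linear (\<lambda>x. T (A x) (A y) (A z))" for y z
    using linear_compose[OF assms linear_1] by (simp add: o_def)
qed (rule swap_12 swap_23)+

end

text \<open>The coefficients of a cubic form need not be symmetric; averaging over the six orders of the
  arguments makes them so without changing the cubic.\<close>
lemma cubic_form_polarize:
  assumes "cubic_form h"
  obtains T where "sym_trilinear T" "h = (\<lambda>x. T x x x)"
proof -
  obtain c where c: "\<And>x. h x = (\<Sum>i\<in>Basis. \<Sum>j\<in>Basis. \<Sum>k\<in>Basis. c i j k * (x \<bullet> i) * (x \<bullet> j) * (x \<bullet> k))"
    using assms unfolding cubic_form_def by blast
  define F where "F x y z = (\<Sum>i\<in>Basis. \<Sum>j\<in>Basis. \<Sum>k\<in>Basis. c i j k * (x \<bullet> i) * (y \<bullet> j) * (z \<bullet> k))" for x y z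
  have lin: "linear (\<lambda>x. F x y z)" "linear (\<lambda>y. F x y z)" "linear (\<lambda>z. F x y z)" for x y z
    unfolding F_def by (auto intro!: linearI simp: inner_add_left algebra_simps sum.distrib sum_distrib_left)
  define T where "T x y z = (1/6) * (F x y z + F x z y + F y x z + F y z x + F z x y + F z y x)" for x y z
  have "linear (\<lambda>x. T x y z)" for y z
    unfolding T_def
    by (rule linearI) (simp_all add: linear_add[OF lin(1)] linear_add[OF lin(2)] linear_add[OF lin(3)]
        linear_cmul[OF lin(1)] linear_cmul[OF lin(2)] linear_cmul[OF lin(3)] algebra_simps)
  then have "sym_trilinear T" by (intro sym_trilinear.intro) (auto simp: T_def)
  moreover have "h = (\<lambda>x. T x x x)" using c by (auto simp: T_def F_def)
  ultimately show ?thesis by (rule that)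
qed

text \<open>On a finite-dimensional space the value of a trilinear form is a polynomial in its
  coefficients and in the coordinates of its arguments, so pointwise limits may be taken in the form
  and in the arguments at the same time.\<close>

lemma tendsto_sym_trilinear:
  assumes "\<And>k. sym_trilinear (T k)" "sym_trilinear T'"
    and "\<And>x y z. ((\<lambda>k. T k x y z) \<longlongrightarrow> T' x y z) F"
    and "(X \<longlongrightarrow> x) F" "(Y \<longlongrightarrow> y) F" "(Z \<longlongrightarrow> z) F"
  shows "((\<lambda>k. T k (X k) (Y k) (Z k)) \<longlongrightarrow> T' x y z) F"
  unfolding sym_trilinear.expand[OF assms(1), of _ "X _"] sym_trilinear.expand[OF assms(2), of x]
  by (intro tendsto_sum tendsto_mult assms(3) tendsto_inner assms(4-6) tendsto_const)

section \<open>Diagonalization and Lorentzian signature\<close>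

text \<open>First variation: along \<open>b + t w\<close> the inequality says that a quadratic polynomial in
  \<open>t\<close> without constant term is nonnegative, so its linear coefficient
  \<open>2 G b w\<close> vanishes.\<close>
lemma minimizer_conjugate:
  fixes G :: "'a::euclidean_space \<Rightarrow> 'a \<Rightarrow> real"
  assumes "bilinear G" and sym: "\<And>u v. G u v = G v u"
    and min: "\<And>t. G b b * (norm (b + t *\<^sub>R w))\<^sup>2 \<le> G (b + t *\<^sub>R w) (b + t *\<^sub>R w)"
    and "norm b = 1" "b \<bullet> w = 0"
  shows "G b w = 0"
proof -
  have *: "0 \<le> 2 * t * G b w + t\<^sup>2 * (G w w - G b b * (w \<bullet> w))" for t
  proof -
    have "(norm (b + t *\<^sub>R w))\<^sup>2 = 1 + t\<^sup>2 * (w \<bullet> w)"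
      using assms(4,5) unfolding power2_norm_eq_inner norm_eq_1
      by (simp add: inner_add_left inner_add_right inner_commute power2_eq_square)
    moreover have "G (b + t *\<^sub>R w) (b + t *\<^sub>R w) = G b b + 2 * t * G b w + t\<^sup>2 * G w w"
      using sym[of w b] by (simp add: bilinear_ladd[OF assms(1)] bilinear_radd[OF assms(1)]
          bilinear_lmul[OF assms(1)] bilinear_rmul[OF assms(1)] power2_eq_square algebra_simps)
    ultimately show ?thesis using min[of t] by (simp add: algebra_simps)
  qed
  define K where "K = \<bar>G w w - G b b * (w \<bullet> w)\<bar> + 1"
  have K: "K > 0" "G w w - G b b * (w \<bullet> w) \<le> K" unfolding K_def by auto
  have "0 \<le> 2 * (- G b w / K) * G b w + (- G b w / K)\<^sup>2 * K"
    using *[of "- G b w / K"] mult_left_mono[OF K(2), of "(- G b w / K)\<^sup>2"] by simp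
  also have "\<dots> = - (G b w)\<^sup>2 / K" using K(1) by (simp add: field_simps power2_eq_square)
  finally show ?thesis using K(1) by (simp add: divide_le_0_iff)
qed

text \<open>A minimizer \<open>b\<close> of \<open>G\<close> on the unit sphere of \<open>S\<close> is \<open>G\<close>-orthogonal to
  everything in \<open>S\<close> that is orthogonal to \<open>b\<close>; splitting it off and repeating on the orthogonal
  complement diagonalizes \<open>G\<close>.\<close>

lemma simultaneous_diagonalization:
  fixes G :: "'a::euclidean_space \<Rightarrow> 'a \<Rightarrow> real"
  assumes G: "bilinear G" and sym: "\<And>u v. G u v = G v u" and "subspace S"
  shows "\<exists>B\<subseteq>S. pairwise orthogonal B \<and> (\<forall>b\<in>B. norm b = 1) \<and> span B = S
    \<and> (\<forall>b\<in>B. \<forall>c\<in>B. b \<noteq> c \<longrightarrow> G b c = 0)"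
  using assms(3)
proof (induction "dim S" arbitrary: S rule: less_induct)
  case less
  show ?case
  proof (cases "S \<subseteq> {0}")
    case True
    then have "S = {0}" using subspace_0[OF less.prems] by auto
    then show ?thesis by (intro exI[of _ "{}"]) simp
  next
    case False
    then obtain x where x: "x \<in> S" "x \<noteq> 0" by auto
    have "x /\<^sub>R norm x \<in> S \<inter> sphere 0 1" using x less.prems by (simp add: subspace_scale)
    then have ne: "S \<inter> sphere 0 1 \<noteq> {}" by blast
    have comp: "compact (S \<inter> sphere 0 1)"
      using closed_subspace[OF less.prems] by (simp add: closed_Int_compact)
    have cont: "continuous_on (S \<inter> sphere 0 1) (\<lambda>v. G v v)"
      using G by (intro bounded_bilinear.continuous_on[of G] continuous_on_id)
        (simp add: bilinear_conv_bounded_bilinear)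
    obtain b where b: "b \<in> S" "norm b = 1" and bmin: "\<And>v. v \<in> S \<Longrightarrow> norm v = 1 \<Longrightarrow> G b b \<le> G v v"
      using continuous_attains_inf[OF comp ne cont] by auto
    have bmin': "G b b * (norm v)\<^sup>2 \<le> G v v" if "v \<in> S" for v
    proof (cases "v = 0")
      case False
      have "G b b \<le> G (v /\<^sub>R norm v) (v /\<^sub>R norm v)"
        using False that less.prems by (intro bmin) (auto simp: subspace_scale)
      also have "\<dots> = G v v / (norm v)\<^sup>2"
        by (simp add: bilinear_lmul[OF G] bilinear_rmul[OF G] power2_eq_square field_simps)
      finally show ?thesis using False by (simp add: field_simps)
    qed (simp add: bilinear_lzero[OF G])
    define S' where "S' = {w \<in> S. b \<bullet> w = 0}"
    have conj: "G b w = 0" if "w \<in> S'" for w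
    proof (rule minimizer_conjugate[OF G sym])
      show "G b b * (norm (b + t *\<^sub>R w))\<^sup>2 \<le> G (b + t *\<^sub>R w) (b + t *\<^sub>R w)" for t
        using that b(1) less.prems by (intro bmin') (simp add: S'_def subspace_add subspace_scale)
    qed (use that b(2) in \<open>simp_all add: S'_def\<close>)
    have S': "subspace S'"
      using less.prems by (auto simp: S'_def subspace_def inner_add_right)
    have "S' \<subset> S" using b by (force simp: S'_def norm_eq_1)
    then have "dim S' < dim S"
      using S' less.prems by (metis dim_psubset span_eq_iff)
    then obtain B where B: "B \<subseteq> S'" "pairwise orthogonal B" "\<forall>b\<in>B. norm b = 1" "span B = S'"
      "\<forall>b\<in>B. \<forall>c\<in>B. b \<noteq> c \<longrightarrow> G b c = 0"
      using less.hyps S' by meson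
    have "w \<in> span (insert b B)" if "w \<in> S" for w
    proof -
      have "w - (b \<bullet> w) *\<^sub>R b \<in> S'"
        using that b less.prems
        by (simp add: S'_def subspace_diff subspace_scale inner_diff_right norm_eq_1)
      then show ?thesis unfolding span_insert B(4) by blast
    qed
    moreover have "span (insert b B) \<subseteq> S"
      using b(1) B(1) less.prems by (intro span_minimal) (auto simp: S'_def)
    ultimately have "span (insert b B) = S" by blast
    moreover have "pairwise orthogonal (insert b B)"
      using B(1,2) by (auto simp: pairwise_insert orthogonal_def S'_def inner_commute)
    moreover have "\<forall>c\<in>insert b B. \<forall>d\<in>insert b B. c \<noteq> d \<longrightarrow> G c d = 0"
    proof -
      have "G b c = 0" "G c b = 0" if "c \<in> B" for c
        using conj[of c] sym[of c b] that B(1) by auto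
      then show ?thesis using B(5) by auto
    qed
    moreover have "insert b B \<subseteq> S" "\<forall>c\<in>insert b B. norm c = 1"
      using b B(1,3) by (auto simp: S'_def)
    ultimately show ?thesis by blast
  qed
qed

text \<open>The signature is defined by eigenvectors, while on the cubics it is visible as definiteness on a
  hyperplane, here the kernel of \<open>\<phi>\<close>. In a diagonalizing orthonormal basis the number of
  positive and negative eigenvalues can be counted, and the hyperplane leaves room for only one
  that is not positive.\<close>
lemma lorentz_signatureI:
  fixes G :: "'a::euclidean_space \<Rightarrow> 'a \<Rightarrow> real"
  assumes G: "bilinear G" and sym: "\<And>u v. G u v = G v u" and \<phi>: "linear (\<phi> :: 'a \<Rightarrow> real)"
    and pos: "\<And>w. \<phi> w = 0 \<Longrightarrow> w \<noteq> 0 \<Longrightarrow> G w w > 0" and e: "G e e < 0"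
  shows "lorentz_signature G"
proof -
  obtain B where B: "pairwise orthogonal B" "\<And>b. b \<in> B \<Longrightarrow> norm b = 1" "span B = UNIV"
      "\<And>b c. b \<in> B \<Longrightarrow> c \<in> B \<Longrightarrow> b \<noteq> c \<Longrightarrow> G b c = 0"
    using simultaneous_diagonalization[OF G sym subspace_UNIV] by metis
  have indep: "independent B" using B(1,2) by (intro pairwise_orthogonal_independent) force+
  then have fin: "finite B" by (rule independent_imp_finite)
  have card: "card B = DIM('a)"
    using dim_eq_card_independent[OF indep] B(3) by (metis dim_UNIV dim_span)
  have expand: "(\<Sum>b\<in>B. (v \<bullet> b) *\<^sub>R b) = v" for v
    using orthonormal_basis_expand[OF B(1,2) _ fin] B(3) by simp
  have G_expand: "G v u = (\<Sum>b\<in>B. (u \<bullet> b) * G v b)" for u v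
  proof -
    have lin: "linear (G v)" using G by (simp add: bilinear_def)
    have "G v u = G v (\<Sum>b\<in>B. (u \<bullet> b) *\<^sub>R b)" by (simp only: expand)
    then show ?thesis unfolding linear_sum[OF lin] by (simp add: linear_cmul[OF lin])
  qed
  have eigen: "G b u = G b b * (b \<bullet> u)" if "b \<in> B" for b u
  proof -
    have "G b u = (\<Sum>c\<in>B. (u \<bullet> c) * G b c)" by (rule G_expand)
    also have "\<dots> = (\<Sum>c\<in>B. if c = b then (u \<bullet> b) * G b b else 0)"
      using B(4)[OF that] by (intro sum.cong) auto
    also have "\<dots> = G b b * (b \<bullet> u)" using fin that by (simp add: inner_commute)
    finally show ?thesis .
  qed
  have dim: "dim {v. \<exists>\<mu>. P \<mu> \<and> (\<forall>u. G v u = \<mu> * (v \<bullet> u))} = card {b \<in> B. P (G b b)}" for P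
  proof -
    have "v \<in> span {b \<in> B. P (G b b)}" if "P \<mu>" "\<forall>u. G v u = \<mu> * (v \<bullet> u)" for v \<mu>
    proof -
      have "(v \<bullet> b) *\<^sub>R b \<in> span {b \<in> B. P (G b b)}" if "b \<in> B" for b
      proof (cases "v \<bullet> b = 0")
        case False
        have "\<mu> * (v \<bullet> b) = G b b * (v \<bullet> b)"
          using \<open>\<forall>u. G v u = \<mu> * (v \<bullet> u)\<close> eigen[OF that, of v] sym[of v b] by (simp add: inner_commute)
        then have "\<mu> = G b b" using False by simp
        then show ?thesis using that \<open>P \<mu>\<close> by (intro span_scale span_base) simp
      qed (simp add: span_zero)
      then have "(\<Sum>b\<in>B. (v \<bullet> b) *\<^sub>R b) \<in> span {b \<in> B. P (G b b)}" by (rule span_sum)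
      then show ?thesis using expand by simp
    qed
    then have E: "{v. \<exists>\<mu>. P \<mu> \<and> (\<forall>u. G v u = \<mu> * (v \<bullet> u))} \<subseteq> span {b \<in> B. P (G b b)}" (is "?E \<subseteq> _")
      by blast
    have "{b \<in> B. P (G b b)} \<subseteq> ?E" using eigen by blast
    from dim_subset[OF E] dim_subset[OF this] have "dim ?E = dim {b \<in> B. P (G b b)}"
      unfolding dim_span by (rule order_antisym)
    moreover have "independent {b \<in> B. P (G b b)}" by (rule independent_mono[OF indep]) blast
    then have "dim {b \<in> B. P (G b b)} = card {b \<in> B. P (G b b)}" by (rule dim_eq_card_independent)
    ultimately show ?thesis by simp
  qed
  have "\<exists>n\<in>B. G n n < 0"
  proof (rule ccontr)
    assume "\<not> ?thesis"
    then have "0 \<le> G b b * (b \<bullet> e)\<^sup>2" if "b \<in> B" for b using that by (simp add: not_less)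
    then have "0 \<le> (e \<bullet> b) * G e b" if "b \<in> B" for b
      using that eigen[OF that, of e] sym[of e b]
      by (simp add: inner_commute power2_eq_square mult_ac)
    then have "0 \<le> G e e" unfolding G_expand[of e e] by (rule sum_nonneg)
    then show False using e by simp
  qed
  then obtain n where n: "n \<in> B" "G n n < 0" by blast
  \<comment> \<open>two directions on which \<open>G\<close> is not positive would span a plane meeting the hyperplane \<open>\<phi> = 0\<close>\<close>
  have others: "G b b > 0" if "b \<in> B" "b \<noteq> n" for b
  proof (rule ccontr)
    assume "\<not> G b b > 0"
    define x where "x = \<phi> n *\<^sub>R b - \<phi> b *\<^sub>R n"
    have orth: "b \<bullet> n = 0" "b \<bullet> b = 1" "n \<bullet> n = 1" "G b n = 0" "G n b = 0"
      using that n B(1,2,4) sym by (auto simp: pairwise_def orthogonal_def norm_eq_1)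
    have "\<phi> x = 0" unfolding x_def using \<phi> by (simp add: linear_diff linear_cmul)
    have "x \<bullet> b = \<phi> n" "x \<bullet> n = - \<phi> b"
      unfolding x_def using orth by (auto simp: inner_diff_left inner_diff_right inner_commute)
    moreover have "\<phi> n \<noteq> 0" using pos[of n] n B(2)[of n] by force
    ultimately have "x \<noteq> 0" by auto
    have "G x x = (\<phi> n)\<^sup>2 * G b b + (\<phi> b)\<^sup>2 * G n n"
      unfolding x_def using orth
      by (simp add: bilinear_lsub[OF G] bilinear_rsub[OF G] bilinear_lmul[OF G] bilinear_rmul[OF G]
          power2_eq_square)
    also have "\<dots> \<le> 0"
      using \<open>\<not> G b b > 0\<close> n(2) by (intro add_nonpos_nonpos mult_nonneg_nonpos) auto
    finally show False using pos[OF \<open>\<phi> x = 0\<close> \<open>x \<noteq> 0\<close>] by simp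
  qed
  have "{b \<in> B. G b b < 0} = {n}" "{b \<in> B. G b b > 0} = B - {n}"
    using n others by (auto, force+)
  then have "card {b \<in> B. G b b < 0} = 1" "card {b \<in> B. G b b > 0} + 1 = DIM('a)"
    using fin n(1) card card_Suc_Diff1[OF fin n(1)] by auto
  then show ?thesis
    unfolding lorentz_signature_def using dim[of "\<lambda>\<mu>. \<mu> > 0"] dim[of "\<lambda>\<mu>. \<mu> < 0"] by simp
qed

lemma orthonormal_frame:
  fixes G :: "'a::euclidean_space \<Rightarrow> 'a \<Rightarrow> real"
  assumes G: "bilinear G" and sym: "\<And>u v. G u v = G v u" and S: "subspace S" "dim S = CARD('m)"
    and pos: "\<And>w. w \<in> S \<Longrightarrow> w \<noteq> 0 \<Longrightarrow> G w w > 0"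
  obtains L :: "real^'m \<Rightarrow> 'a" where "linear L" "range L \<subseteq> S" "\<And>a b. G (L a) (L b) = a \<bullet> b"
proof -
  obtain B where B: "B \<subseteq> S" "pairwise orthogonal B" "\<And>b. b \<in> B \<Longrightarrow> norm b = 1" "span B = S"
      "\<And>b c. b \<in> B \<Longrightarrow> c \<in> B \<Longrightarrow> b \<noteq> c \<Longrightarrow> G b c = 0"
    using simultaneous_diagonalization[OF G sym S(1)] by metis
  have indep: "independent B" using B(2,3) by (intro pairwise_orthogonal_independent) force+
  have "card B = CARD('m)" using dim_eq_card_independent[OF indep] B(4) S(2) by (metis dim_span)
  then obtain f :: "'m \<Rightarrow> 'a" where f: "bij_betw f UNIV B"
    using finite_same_card_bij[of "UNIV::'m set" B] independent_imp_finite[OF indep] by auto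
  have fB: "f i \<in> B" for i using f by (auto simp: bij_betw_def)
  have finj: "f i = f j \<longleftrightarrow> i = j" for i j using f by (auto simp: bij_betw_def inj_eq)
  have fpos: "G (f i) (f i) > 0" for i
  proof (rule pos)
    show "f i \<in> S" using fB B(1) by blast
    show "f i \<noteq> 0" using B(3)[OF fB[of i]] by auto
  qed
  define g where "g i = (1 / sqrt (G (f i) (f i))) *\<^sub>R f i" for i
  have gg: "G (g i) (g j) = (if i = j then 1 else 0)" for i j
    using fpos[of i] B(5)[OF fB fB, of i j] finj[of i j]
    by (auto simp: g_def bilinear_lmul[OF G] bilinear_rmul[OF G])
  define L where "L a = (\<Sum>i\<in>UNIV. (a $ i) *\<^sub>R g i)" for a :: "real^'m"
  show ?thesis
  proof
    show "linear L"
      unfolding L_def by (rule linearI) (simp_all add: scaleR_left_distrib sum.distrib scaleR_sum_right)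
    show "range L \<subseteq> S"
      using fB B(1) S(1) unfolding L_def g_def by (auto intro!: subspace_sum subspace_scale)
    show "G (L a) (L b) = a \<bullet> b" for a b
    proof -
      have l: "linear (\<lambda>x. G x y)" and r: "linear (G y)" for y using G by (simp_all add: bilinear_def)
      have "G (L a) (L b) = (\<Sum>j\<in>UNIV. \<Sum>i\<in>UNIV. b $ j * (a $ i * G (g i) (g j)))"
        unfolding L_def linear_sum[OF l] linear_sum[OF r]
        by (simp add: linear_cmul[OF l] linear_cmul[OF r] sum_distrib_left)
      then show ?thesis by (simp add: gg inner_vec_def if_distrib sum.delta mult.commute cong: if_cong)
    qed
  qed
qed

text \<open>An orthogonal map carries the eigenvectors of the pulled back form to those of \<open>G\<close>,
  with the same eigenvalues. For a map that is merely linear, the definition of the signature by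
  eigenvectors would require Sylvester's law of inertia.\<close>

lemma lorentz_signature_orthogonal:
  fixes C :: "'a::euclidean_space \<Rightarrow> 'a"
  assumes C: "orthogonal_transformation C" and G: "lorentz_signature G"
  shows "lorentz_signature (\<lambda>u v. G (C u) (C v))"
proof -
  have lin: "linear C" and inner: "C v \<bullet> C u = v \<bullet> u" for u v
    using C by (auto simp: orthogonal_transformation_def)
  have surj: "surj C" and inj: "inj C"
    using orthogonal_transformation_surj[OF C] orthogonal_transformation_inj[OF C] .
  have "dim {v. \<exists>\<mu>. P \<mu> \<and> (\<forall>u. G (C v) (C u) = \<mu> * (v \<bullet> u))}
      = dim {v. \<exists>\<mu>. P \<mu> \<and> (\<forall>u. G v u = \<mu> * (v \<bullet> u))}" (is "dim ?E = dim ?F") for P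
  proof -
    have E: "v \<in> ?E \<longleftrightarrow> C v \<in> ?F" for v
    proof -
      have "(\<forall>u. G (C v) u = \<mu> * (C v \<bullet> u)) \<longleftrightarrow> (\<forall>u. G (C v) (C u) = \<mu> * (v \<bullet> u))" for \<mu>
        using surj inner by (metis surjD)
      then show ?thesis by simp
    qed
    have "?F = C ` ?E"
    proof (rule Set.set_eqI)
      fix x
      obtain y where x: "x = C y" using surj by (metis surjD)
      show "x \<in> ?F \<longleftrightarrow> x \<in> C ` ?E"
        unfolding x inj_image_mem_iff[OF inj] by (rule E[symmetric])
    qed
    then show ?thesis using dim_image_eq[OF lin inj_on_subset[OF inj]] by simp
  qed
  from this[of "\<lambda>\<mu>. \<mu> > 0"] this[of "\<lambda>\<mu>. \<mu> < 0"] show ?thesis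
    using G unfolding lorentz_signature_def by simp
qed

lemma Ck_on_compose_linear:
  fixes A :: "'c::real_normed_vector \<Rightarrow> 'a::real_normed_vector"
  assumes A: "bounded_linear A" and S: "open S" and "Ck_on k S f"
  shows "Ck_on k (A -` S) (\<lambda>x. f (A x))"
  using assms(3)
proof (induction k arbitrary: f)
  case 0
  have "continuous_on (A -` S) A" using A by (rule linear_continuous_on)
  then show ?case using 0 by (auto intro: continuous_on_compose2)
next
  case (Suc k)
  have op: "open (A -` S)" using S linear_continuous_on[OF A] by (intro open_vimage) 
  obtain f' where f': "\<And>x. x \<in> S \<Longrightarrow> (f has_derivative f' x) (at x)" "\<And>v. Ck_on k S (\<lambda>x. f' x v)"
    using Ck_on_Suc_derivative[OF S Suc.prems] by blast
  have "((\<lambda>x. f (A x)) has_derivative (\<lambda>v. f' (A x) (A v))) (at x)" if "x \<in> A -` S" for x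
    using has_derivative_compose[OF bounded_linear_imp_has_derivative[OF A] f'(1)] that by simp
  from Ck_on_SucI[OF op this Suc.IH[OF f'(2)]] show ?case by simp
qed

lemma psr_manifold_orthogonal_vimage:
  fixes C :: "'a::euclidean_space \<Rightarrow> 'a"
  assumes C: "orthogonal_transformation C" and psr: "psr_manifold g K"
  shows "psr_manifold (g \<circ> C) (C -` K)"
proof -
  have lin: "linear C" and surj: "surj C"
    using C orthogonal_transformation_surj[OF C] by (simp_all add: orthogonal_transformation_def)
  then have bl: "bounded_linear C" by (simp add: linear_conv_bounded_linear)
  have cubic: "cubic_form g" using psr by (simp add: psr_manifold_def hyperbolic_cubic_def)
  then obtain T where T: "sym_trilinear T" "g = (\<lambda>x. T x x x)" by (rule cubic_form_polarize)
  have TC: "sym_trilinear (\<lambda>x y z. T (C x) (C y) (C z))"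
    by (rule sym_trilinear.compose_linear[OF T(1) lin])
  have gC: "g \<circ> C = (\<lambda>x. T (C x) (C x) (C x))" by (auto simp: T(2))
  have hess: "hessian (g \<circ> C) p u v = hessian g (C p) (C u) (C v)" for p u v
    unfolding gC sym_trilinear.hessian_cube[OF TC] unfolding T(2) sym_trilinear.hessian_cube[OF T(1)] ..
  have hyp: "hyperbolic_point (g \<circ> C) p" if "hyperbolic_point g (C p)" for p
    using that lorentz_signature_orthogonal[OF C] unfolding hyperbolic_point_def hess by auto
  have ne: "K \<noteq> {}" and pts: "\<And>p. p \<in> K \<Longrightarrow> g p = 1 \<and> hyperbolic_point g p"
    and hyper: "smooth_hypersurface K" using psr by (auto simp: psr_manifold_def)
  obtain p where "C p \<in> K" using ne surj by (metis ex_in_conv surjD)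
  then have "hyperbolic_cubic (g \<circ> C)" "C -` K \<noteq> {}"
    using hyp pts sym_trilinear.cubic_form_cube[OF TC] by (auto simp: hyperbolic_cubic_def gC)
  moreover have "smooth_hypersurface (C -` K)"
    unfolding smooth_hypersurface_def
  proof
    fix p assume "p \<in> C -` K"
    then obtain U f where Uf: "open U \<and> C p \<in> U \<and> smooth_on U f \<and>
        (\<forall>q\<in>U. frechet_derivative f (at q) \<noteq> (\<lambda>_. 0 :: real)) \<and> K \<inter> U = {q \<in> U. f q = 0}"
      using hyper unfolding smooth_hypersurface_def by fast
    then have U: "open U" "C p \<in> U" "smooth_on U f"
      "\<And>q. q \<in> U \<Longrightarrow> frechet_derivative f (at q) \<noteq> (\<lambda>_. 0)" "K \<inter> U = {q \<in> U. f q = 0}"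
      by blast+
    have "open (C -` U)" using U(1) linear_continuous_on[OF bl] by (intro open_vimage)
    moreover have "smooth_on (C -` U) (\<lambda>x. f (C x))"
      using U(3) Ck_on_compose_linear[OF bl U(1)] by (auto simp: smooth_on_def)
    moreover have "frechet_derivative (\<lambda>x. f (C x)) (at q) \<noteq> (\<lambda>_. 0)" if q: "q \<in> C -` U" for q
    proof -
      have f': "(f has_derivative frechet_derivative f (at (C q))) (at (C q))"
        using smooth_on_has_derivative[OF U(1,3)] q by simp
      have "frechet_derivative (\<lambda>x. f (C x)) (at q) = (\<lambda>v. frechet_derivative f (at (C q)) (C v))"
        using frechet_derivative_at[OF has_derivative_compose[OF bounded_linear_imp_has_derivative[OF bl] f']] ..
      moreover obtain w where "frechet_derivative f (at (C q)) w \<noteq> 0" using U(4) q by blast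
      ultimately show ?thesis using surj by (metis surjD)
    qed
    moreover have "C -` K \<inter> C -` U = {q \<in> C -` U. f (C q) = 0}" using U(5) by blast
    ultimately show "\<exists>U f. open U \<and> p \<in> U \<and> smooth_on U f \<and>
        (\<forall>q\<in>U. frechet_derivative f (at q) \<noteq> (\<lambda>_. 0 :: real)) \<and> C -` K \<inter> U = {q \<in> U. f q = 0}"
      using U(2) by (intro exI[of _ "C -` U"] exI[of _ "\<lambda>x. f (C x)"]) auto
  qed
  ultimately show ?thesis using hyp pts by (auto simp: psr_manifold_def)
qed

section \<open>The model cubic\<close>

text \<open>The linear coordinates \<open>ell\<close> and \<open>emm\<close> split the cubic: on the plane
  \<open>s = 0\<close> it has the double root \<open>ell = 0\<close> and the simple root
  \<open>emm = 0\<close>, and altogether it is \<open>ell (ell emm - |svec|\<^sup>2)\<close>.\<close>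
definition ell :: "real \<times> (real^'m) \<times> real \<Rightarrow> real" where
  "ell = (\<lambda>(x, s, w). x + w / sqrt 3)"

definition emm :: "real \<times> (real^'m) \<times> real \<Rightarrow> real" where
  "emm = (\<lambda>(x, s, w). x - 2 * w / sqrt 3)"

definition svec :: "real \<times> (real^'m) \<times> real \<Rightarrow> real^'m" where
  "svec = (\<lambda>(x, s, w). s)"

definition from_lsm :: "real \<Rightarrow> real^'m \<Rightarrow> real \<Rightarrow> real \<times> (real^'m) \<times> real" where
  "from_lsm l s m = ((2 * l + m) / 3, s, (l - m) / sqrt 3)"

lemma lsm_from_lsm [simp]:
  "ell (from_lsm l s m) = l" "svec (from_lsm l s m) = s" "emm (from_lsm l s m) = m"
  by (simp_all add: ell_def emm_def svec_def from_lsm_def field_simps)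

lemma lsm_eqI: "ell z = ell z' \<Longrightarrow> svec z = svec z' \<Longrightarrow> emm z = emm z' \<Longrightarrow> z = z'"
proof (cases z; cases z')
  fix x s w x' s' w'
  assume z: "z = (x, s, w)" "z' = (x', s', w')" and "ell z = ell z'" "svec z = svec z'" "emm z = emm z'"
  then have *: "x + w / sqrt 3 = x' + w' / sqrt 3" "x - 2 * (w / sqrt 3) = x' - 2 * (w' / sqrt 3)" "s = s'"
    by (simp_all add: ell_def emm_def svec_def)
  from *(1,2) have "w / sqrt 3 = w' / sqrt 3" by linarith
  then show "z = z'" using * z by simp
qed

lemma linear_lsm: "linear ell" "linear svec" "linear emm"
  unfolding ell_def emm_def svec_def
  by (auto intro!: linearI simp: field_simps)

lemmas lsm_linear_simps =
  linear_lsm[THEN linear_add] linear_lsm[THEN linear_diff] linear_lsm[THEN linear_cmul]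
  linear_lsm[THEN linear_0] linear_lsm[THEN linear_neg]

lemma bounded_linear_lsm: "bounded_linear ell" "bounded_linear svec" "bounded_linear emm"
  using linear_lsm by (simp_all add: linear_conv_bounded_linear)

lemmas continuous_on_lsm [continuous_intros] = bounded_linear_lsm[THEN bounded_linear.continuous_on]

lemma lsm_base [simp]: "ell (1, 0) = 1" "svec (1, 0) = 0" "emm (1, 0) = 1"
  by (simp_all add: ell_def emm_def svec_def zero_prod_def)

lemma hbar_lsm: "hbar z = ell z * (ell z * emm z - svec z \<bullet> svec z)"
proof (cases z)
  case (fields x s w)
  define r where "r = 1 / sqrt (3::real)"
  have r: "r * r = 1 / 3" by (simp add: r_def)
  have "hbar z = x ^ 3 - x * (s \<bullet> s + w\<^sup>2) - r * (s \<bullet> s) * w - 2 * r * (1/3) * w ^ 3"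
    by (simp add: hbar_def fields r_def)
  also have "\<dots> = (x + r * w) * ((x + r * w) * (x - 2 * r * w) - s \<bullet> s)"
    unfolding r[symmetric] using r by algebra
  also have "\<dots> = ell z * (ell z * emm z - svec z \<bullet> svec z)"
    by (simp add: ell_def emm_def svec_def fields r_def)
  finally show ?thesis .
qed

text \<open>The polarization of \<open>ell\<^sup>2 emm - ell |svec|\<^sup>2\<close>.\<close>
definition hbar_polar ::
  "real \<times> (real^'m) \<times> real \<Rightarrow> real \<times> (real^'m) \<times> real \<Rightarrow> real \<times> (real^'m) \<times> real \<Rightarrow> real" where
  "hbar_polar u v w = (1/3) *
     (ell u * ell v * emm w + ell u * emm v * ell w + emm u * ell v * ell w
      - ell u * (svec v \<bullet> svec w) - ell v * (svec u \<bullet> svec w) - ell w * (svec u \<bullet> svec v))"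

lemma hbar_polar: "sym_trilinear hbar_polar"
proof (rule sym_trilinear.intro)
  show "linear (\<lambda>u. hbar_polar u v w)" for v w :: "real \<times> (real^'m) \<times> real"
    unfolding hbar_polar_def
    by (rule linearI) (simp_all add: lsm_linear_simps inner_add_left algebra_simps)
qed (simp_all add: hbar_polar_def inner_commute algebra_simps)

lemma hbar_cube: "hbar = (\<lambda>z. hbar_polar z z z)"
  by (auto simp: hbar_lsm hbar_polar_def algebra_simps)

text \<open>On \<open>{hbar = 1}\<close> the coordinate \<open>ell\<close> has no zero, and where it is positive
  the equation can be solved for \<open>emm\<close>; so \<open>Hbar\<close> is a graph over
  \<open>{ell > 0}\<close>.\<close>

lemma hbar_eq_1_iff:
  assumes "ell z > 0"
  shows "hbar z = 1 \<longleftrightarrow> emm z = (1 / ell z + svec z \<bullet> svec z) / ell z"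
  using assms by (auto simp: hbar_lsm field_simps)

lemma Hbar_eq: "Hbar = {z :: real \<times> (real^'m) \<times> real. ell z > 0 \<and> hbar z = 1}"
proof (rule subset_antisym)
  let ?S = "{z :: real \<times> (real^'m) \<times> real. ell z > 0 \<and> hbar z = 1}"
  let ?f = "\<lambda>(l, s). from_lsm l s ((1 / l + s \<bullet> s) / l) :: real \<times> (real^'m) \<times> real"
  have base: "(1, 0) \<in> ?S" by (simp add: hbar_lsm)
  have "continuous_on ({0<..} \<times> UNIV) ?f"
    unfolding from_lsm_def case_prod_unfold by (intro continuous_intros) auto
  then have "connected (?f ` ({0<..} \<times> UNIV))"
  proof (rule connected_continuous_image)
    show "connected ({0<..} \<times> UNIV :: (real \<times> (real^'m)) set)"
      by (intro connected_Times connected_UNIV) (simp add: is_interval_connected)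
  qed
  moreover have "?f ` ({0<..} \<times> UNIV) = ?S"
  proof (rule subset_antisym)
    show "?f ` ({0<..} \<times> UNIV) \<subseteq> ?S" by (auto simp: hbar_eq_1_iff)
    show "?S \<subseteq> ?f ` ({0<..} \<times> UNIV)"
    proof
      fix z :: "real \<times> (real^'m) \<times> real" assume z: "z \<in> ?S"
      then have "z = ?f (ell z, svec z)" by (intro lsm_eqI) (auto simp: hbar_eq_1_iff)
      then show "z \<in> ?f ` ({0<..} \<times> UNIV)" using z by (intro image_eqI) auto
    qed
  qed
  ultimately have "connected ?S" by simp
  then show "?S \<subseteq> Hbar"
    unfolding Hbar_def base_component_def using base
    by (intro connected_component_maximal) auto
  let ?C = "Hbar :: (real \<times> (real^'m) \<times> real) set"
  have C: "connected ?C" "?C \<subseteq> {z. hbar z = 1}" "(1, 0) \<in> ?C"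
    unfolding Hbar_def base_component_def using base connected_component_subset
    by (auto simp: connected_component_refl_eq)
  have "connected (ell ` ?C)" by (intro connected_continuous_image C continuous_intros)
  then have int: "is_interval (ell ` ?C)" by (simp add: is_interval_connected_1)
  show "?C \<subseteq> ?S"
  proof
    fix z assume z: "z \<in> ?C"
    have "ell z > 0"
    proof (rule ccontr)
      assume "\<not> ell z > 0"
      then have "0 \<in> ell ` ?C"
        using mem_is_interval_1_I[OF int imageI[OF z] imageI[OF C(3)], of 0] by simp
      then obtain y where "y \<in> ?C" "ell y = 0" by auto
      then show False using C(2) by (auto simp: hbar_lsm)
    qed
    then show "z \<in> ?S" using z C(2) by auto
  qed
qed

text \<open>On the tangent space of the level set the equation \<open>hbar_polar p p v = 0\<close> eliminates
  \<open>emm v\<close>, and what is left is a sum of squares. This gives both the hyperbolicity of all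
  points and the explicit form of the metric.\<close>
lemma hbar_polar_hyperplane:
  assumes "ell p > 0" "hbar p = 1" "hbar_polar p p v = 0"
  shows "- 3 * hbar_polar p v v
    = 3 * (ell v)\<^sup>2 / (ell p)\<^sup>2 + ell p * (norm (svec v - (ell v / ell p) *\<^sub>R svec p))\<^sup>2"
proof -
  define l m s a b t where d: "l = ell p" "m = emm p" "s = svec p" "a = ell v" "b = emm v" "t = svec v"
  have l: "l > 0" using assms by (simp add: d)
  have m: "m = (1 / l + s \<bullet> s) / l" using assms hbar_eq_1_iff[of p] by (simp add: d)
  have "l * (2 * m * a + l * b - 2 * (s \<bullet> t)) = a * (s \<bullet> s)"
    using assms(3) by (simp add: hbar_polar_def d algebra_simps)
  then have b: "b = (a * (s \<bullet> s) / l - 2 * m * a + 2 * (s \<bullet> t)) / l"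
    using l by (simp add: field_simps)
  have norm: "(norm (t - (a / l) *\<^sub>R s))\<^sup>2 = t \<bullet> t - 2 * (a / l) * (s \<bullet> t) + (a / l)\<^sup>2 * (s \<bullet> s)"
    unfolding power2_norm_eq_inner
    by (simp add: inner_diff_left inner_diff_right inner_commute power2_eq_square algebra_simps)
  have "- 3 * hbar_polar p v v = - (2 * l * a * b + m * a\<^sup>2 - l * (t \<bullet> t) - 2 * a * (s \<bullet> t))"
    by (simp add: hbar_polar_def d power2_eq_square algebra_simps)
  also have "\<dots> = 3 * a\<^sup>2 / l\<^sup>2 + l * (t \<bullet> t - 2 * (a / l) * (s \<bullet> t) + (a / l)\<^sup>2 * (s \<bullet> s))"
    unfolding b m using l by (simp add: field_simps power2_eq_square)
  finally show ?thesis unfolding norm[symmetric] by (simp add: d)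
qed

text \<open>The negative Hessian is positive on the tangent space and, by Euler's identity, negative on the
  position vector.\<close>
lemma hyperbolic_point_hbar:
  assumes "ell p > 0" "hbar p = 1"
  shows "hyperbolic_point hbar p"
proof -
  have hess: "- hessian hbar p u v = - 6 * hbar_polar p u v" for u v
    unfolding hbar_cube sym_trilinear.hessian_cube[OF hbar_polar] by simp
  note T = sym_trilinear.linear_2[OF hbar_polar] sym_trilinear.linear_3[OF hbar_polar]
  have "lorentz_signature (\<lambda>u v. - 6 * hbar_polar p u v)"
  proof (rule lorentz_signatureI[where \<phi> = "hbar_polar p p" and e = p])
    show "bilinear (\<lambda>u v. - 6 * hbar_polar p u v)"
      unfolding bilinear_def
      by (intro conjI allI linearI)
        (simp_all only: linear_add[OF T(1)] linear_add[OF T(2)] linear_cmul[OF T(1)]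
          linear_cmul[OF T(2)] real_scaleR_def algebra_simps)
    show "- 6 * hbar_polar p u v = - 6 * hbar_polar p v u" for u v
      using sym_trilinear.swap_23[OF hbar_polar, of p u v] by simp
    show "linear (hbar_polar p p)" by (rule T(2))
    show "- 6 * hbar_polar p p p < 0" using assms(2) by (simp add: hbar_cube)
    fix w assume w: "hbar_polar p p w = 0" "w \<noteq> 0"
    note eq = hbar_polar_hyperplane[OF assms w(1)]
    show "- 6 * hbar_polar p w w > 0"
    proof (rule ccontr)
      assume "\<not> - 6 * hbar_polar p w w > 0"
      then have "3 * (ell w)\<^sup>2 / (ell p)\<^sup>2 + ell p * (norm (svec w - (ell w / ell p) *\<^sub>R svec p))\<^sup>2 \<le> 0"
        using eq by linarith
      moreover have "0 \<le> 3 * (ell w)\<^sup>2 / (ell p)\<^sup>2"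
        "0 \<le> ell p * (norm (svec w - (ell w / ell p) *\<^sub>R svec p))\<^sup>2" using assms(1) by auto
      ultimately have "3 * (ell w)\<^sup>2 / (ell p)\<^sup>2 = 0"
        "ell p * (norm (svec w - (ell w / ell p) *\<^sub>R svec p))\<^sup>2 = 0" by linarith+
      then have "ell w = 0" "svec w = 0" using assms(1) by auto
      moreover from this have "emm w = 0" using w(1) assms(1) by (simp add: hbar_polar_def)
      ultimately have "w = 0" by (intro lsm_eqI) (simp_all add: lsm_linear_simps)
      then show False using w(2) by simp
    qed
  qed
  then show ?thesis using assms(2) unfolding hyperbolic_point_def hess by simp
qed

lemma ccpsr_hbar: "ccpsr_in_standard_form hbar (Hbar :: (real \<times> (real^'m) \<times> real) set)"
proof -
  let ?h = "hbar :: real \<times> (real^'m) \<times> real \<Rightarrow> real"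
  let ?H = "Hbar :: (real \<times> (real^'m) \<times> real) set"
  have cubic: "cubic_form ?h"
    unfolding hbar_cube by (rule sym_trilinear.cubic_form_cube[OF hbar_polar])
  have base: "(1, 0) \<in> ?H" by (simp add: Hbar_eq hbar_lsm)
  have cont: "continuous_on UNIV ?h"
    unfolding hbar_cube by (rule sym_trilinear.continuous_on_cube[OF hbar_polar])
  have H': "?H = {z. ell z \<ge> 0} \<inter> {z. hbar z = 1}"
  proof -
    have "ell z \<noteq> 0" if "hbar z = 1" for z :: "real \<times> (real^'m) \<times> real"
      using that by (auto simp: hbar_lsm)
    then show ?thesis unfolding Hbar_eq by (force simp: less_le)
  qed
  have "closed ?H"
    unfolding H' by (intro closed_Int closed_Collect_le closed_Collect_eq continuous_intros cont)
  moreover have "connected ?H" by (simp add: Hbar_def base_component_def)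
  moreover have "smooth_hypersurface ?H"
    unfolding smooth_hypersurface_def
  proof
    fix p assume "p \<in> ?H"
    let ?U = "{z :: real \<times> (real^'m) \<times> real. ell z > 0}"
    have op: "open ?U" by (intro open_Collect_less continuous_intros)
    moreover have "smooth_on ?U (\<lambda>z. ?h z - 1)"
      unfolding hbar_cube
      by (intro smooth_on_diff smooth_on_const sym_trilinear.smooth_on_cube[OF hbar_polar] op)
    moreover have "frechet_derivative (\<lambda>z. ?h z - 1) (at q) \<noteq> (\<lambda>_. 0)" if "q \<in> ?U" for q
    proof
      have "((\<lambda>z. ?h z - 1) has_derivative (\<lambda>u. 3 * hbar_polar q q u)) (at q)"
        unfolding hbar_cube
        using has_derivative_diff[OF sym_trilinear.has_derivative_cube[OF hbar_polar] has_derivative_const]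
        by simp
      from frechet_derivative_at[OF this, symmetric]
      have fd: "frechet_derivative (\<lambda>z. ?h z - 1) (at q) (from_lsm 0 0 1) = (ell q)\<^sup>2"
        by (simp add: hbar_polar_def power2_eq_square)
      assume "frechet_derivative (\<lambda>z. ?h z - 1) (at q) = (\<lambda>_. 0)"
      then show False using fd that by simp
    qed
    moreover have "?H \<inter> ?U = {q \<in> ?U. ?h q - 1 = 0}" unfolding Hbar_eq by auto
    moreover have "p \<in> ?U" using \<open>p \<in> ?H\<close> unfolding Hbar_eq by simp
    ultimately show "\<exists>U f. open U \<and> p \<in> U \<and> smooth_on U f \<and>
        (\<forall>q\<in>U. frechet_derivative f (at q) \<noteq> (\<lambda>_. 0 :: real)) \<and> ?H \<inter> U = {q \<in> U. f q = 0}"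
      by (intro exI[of _ ?U] exI[of _ "\<lambda>z. ?h z - 1"]) blast
  qed
  moreover have pts: "hbar p = 1 \<and> hyperbolic_point hbar p" if "p \<in> ?H" for p
    using that by (simp add: hyperbolic_point_hbar Hbar_eq)
  ultimately have ccpsr: "ccpsr_manifold ?h ?H"
    using cubic base unfolding ccpsr_manifold_def psr_manifold_def hyperbolic_cubic_def by blast
  have "standard_form ?h"
    unfolding standard_form_def
  proof (intro exI conjI allI)
    let ?P = "\<lambda>y. ?h (0, y)"
    have "linear (\<lambda>y :: (real^'m) \<times> real. (0 :: real, y))" by (rule linearI) auto
    from sym_trilinear.cubic_form_cube[OF sym_trilinear.compose_linear[OF hbar_polar this]]
    show "cubic_form ?P" by (simp add: hbar_cube)
    show "?h (x, y) = x ^ 3 - x * (y \<bullet> y) + ?P y" for x y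
      by (cases y) (simp add: hbar_def power2_eq_square algebra_simps)
  qed
  then show ?thesis using ccpsr by (simp add: ccpsr_in_standard_form_def Hbar_def)
qed

section \<open>The simply transitive group action\<close>

lemma carrier_semidirect [simp]: "carrier semidirect_group = {0<..} \<times> UNIV"
  and mult_semidirect [simp]: 
    "mult semidirect_group (a, v) (b, w) = (a * b, v + (a powr (3/2)) *\<^sub>R w)"
  and one_semidirect [simp]: "one semidirect_group = (1, 0)"
  by (simp_all add: semidirect_group_def)

lemma group_semidirect: "group (semidirect_group :: (real \<times> (real^'m)) monoid)"
proof (rule groupI)
  fix g :: "real \<times> (real^'m)" assume "g \<in> carrier semidirect_group"
  then obtain l v where g: "g = (l, v)" "l > 0" by (cases g) auto
  have "mult semidirect_group (1 / l, - ((1 / l) powr (3/2)) *\<^sub>R v) g = one semidirect_group"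
    using g by simp
  then show "\<exists>y\<in>carrier semidirect_group. mult semidirect_group y g = one semidirect_group"
    using g(2) by (intro bexI[of _ "(1 / l, - ((1 / l) powr (3/2)) *\<^sub>R v)"]) auto
qed (auto simp: powr_mult algebra_simps)

lemma inv_semidirect:
  assumes "l > 0"
  shows "m_inv semidirect_group (l, v :: real^'m) = (l powr (-1), - (l powr (-3/2)) *\<^sub>R v)"
proof (rule group.inv_equality[OF group_semidirect])
  have "l powr (-1) * l = 1" "(l powr (-1)) powr (3/2) = l powr (-3/2)"
    using assms by (simp_all add: powr_minus powr_powr inverse_powr)
  then show "mult semidirect_group (l powr (-1), - (l powr (-3/2)) *\<^sub>R v) (l, v) = one semidirect_group"
    using assms by simp
qed (use assms in auto)

lemma open_lie_group_semidirect: "open_lie_group (semidirect_group :: (real \<times> (real^'m)) monoid)"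
proof -
  let ?C = "{0<..} \<times> UNIV :: (real \<times> (real^'m)) set"
  have op: "open ?C" by (intro open_Times) auto
  have op2: "open (?C \<times> ?C)" by (rule open_Times[OF op op])
  have fst_pos: "fst (fst z) > 0" if "z \<in> ?C \<times> ?C" for z using that by auto
  have coord: "smooth_on (?C \<times> ?C) (\<lambda>z. fst (fst z))" "smooth_on (?C \<times> ?C) (\<lambda>z. snd (fst z))"
    "smooth_on (?C \<times> ?C) (\<lambda>z. fst (snd z))" "smooth_on (?C \<times> ?C) (\<lambda>z. snd (snd z))"
    by (rule smooth_on_linear[OF op2], intro bounded_linear_intros)+
  have "smooth_on (?C \<times> ?C) (\<lambda>z. (fst (fst z) * fst (snd z),
      snd (fst z) + (fst (fst z) powr (3/2)) *\<^sub>R snd (snd z)))"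
    by (intro smooth_on_Pair[OF op2] smooth_on_mult[OF op2] smooth_on_add[OF op2]
        smooth_on_scaleR[OF op2] smooth_on_powr[OF op2] coord fst_pos)
  moreover have "(\<lambda>z. (fst (fst z) * fst (snd z), snd (fst z) + (fst (fst z) powr (3/2)) *\<^sub>R snd (snd z)))
      = (\<lambda>(a, b). mult semidirect_group a b :: real \<times> (real^'m))"
    by (auto simp: fun_eq_iff)
  ultimately have mult: "smooth_on (?C \<times> ?C) (\<lambda>(a, b). mult semidirect_group a b)" by (simp only:)
  have coord1: "smooth_on ?C fst" "smooth_on ?C snd"
    by (rule smooth_on_linear[OF op], intro bounded_linear_fst bounded_linear_snd)+
  have "smooth_on ?C (\<lambda>z. (fst z powr (-1), - (fst z powr (-3/2)) *\<^sub>R snd z))"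
    by (intro smooth_on_Pair[OF op] smooth_on_uminus[OF op] smooth_on_scaleR[OF op]
        smooth_on_powr[OF op] coord1) auto
  then have "smooth_on ?C (m_inv semidirect_group)"
    by (rule smooth_on_cong[THEN iffD1, rotated]) (auto simp: inv_semidirect)
  then show ?thesis using mult group_semidirect op by (simp add: open_lie_group_def)
qed

text \<open>In the coordinates \<open>ell\<close>, \<open>svec\<close>, \<open>emm\<close> the displayed maps
  are triangular; all their algebra is done there.\<close>

lemma displayed_map_lsm:
  assumes "l > 0"
  shows "ell (displayed_map (l, v) z) = l * ell z"
    and "svec (displayed_map (l, v) z) = (l powr (-1/2)) *\<^sub>R (svec z - (2 powr (1/4) * ell z) *\<^sub>R v)"
    and "emm (displayed_map (l, v) z) = l powr (-2) *
      (emm z + 2 powr (1/2) * (v \<bullet> v) * ell z - 2 powr (5/4) * (svec z \<bullet> v))"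
proof -
  obtain x s w where z: "z = (x, s, w)" by (cases z)
  define r where "r = 1 / sqrt (3::real)"
  have r2: "r * r = 1 / 3" by (simp add: r_def)
  have "(3::real) powr (- (1/2)) = r"
    unfolding powr_minus_divide r_def by (simp add: powr_half_sqrt)
  then have "(3::real) powr (-1/2) = r" by (simp only: minus_divide_left)
  moreover have "(3::real) powr (-3/2) = 3 powr (-1) * 3 powr (-1/2)" by (subst powr_add[symmetric]) simp
  ultimately have p: "(3::real) powr (-1) = 1/3" "(3::real) powr (-1/2) = r" "(3::real) powr (-3/2) = r / 3"
    by (simp_all add: powr_minus)
  have rdiv: "a / sqrt 3 = r * a" for a by (simp add: r_def)
  have rr: "r * (r * a) = a / 3" for a using r2 by (simp add: mult.assoc[symmetric])
  show "ell (displayed_map (l, v) z) = l * ell z"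
    unfolding z displayed_map_def ell_def case_prod_conv p rdiv by (simp add: algebra_simps rr)
  show "svec (displayed_map (l, v) z) = (l powr (-1/2)) *\<^sub>R (svec z - (2 powr (1/4) * ell z) *\<^sub>R v)"
    unfolding z displayed_map_def ell_def svec_def case_prod_conv p rdiv
    by (simp add: algebra_simps)
  show "emm (displayed_map (l, v) z) = l powr (-2) *
      (emm z + 2 powr (1/2) * (v \<bullet> v) * ell z - 2 powr (5/4) * (svec z \<bullet> v))"
    unfolding z displayed_map_def ell_def emm_def svec_def case_prod_conv p rdiv by (simp add: algebra_simps rr)
qed

lemma smooth_displayed_map:
  "smooth_on (carrier (semidirect_group :: (real \<times> (real^'m)) monoid) \<times> UNIV) (\<lambda>(g, z). displayed_map g z)"
proof -
  let ?C = "({0<..} \<times> UNIV) \<times> UNIV :: ((real \<times> (real^'m)) \<times> (real \<times> (real^'m) \<times> real)) set"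
  have op: "open ?C" by (intro open_Times) auto
  have fst_pos: "fst (fst z) > 0" if "z \<in> ?C" for z using that by auto
  have coord: "smooth_on ?C (\<lambda>z. fst (fst z))" "smooth_on ?C (\<lambda>z. snd (fst z))"
    "smooth_on ?C (\<lambda>z. fst (snd z))" "smooth_on ?C (\<lambda>z. fst (snd (snd z)))"
    "smooth_on ?C (\<lambda>z. snd (snd (snd z)))"
    by (rule smooth_on_linear[OF op], intro bounded_linear_intros)+
  have powr: "smooth_on ?C (\<lambda>z. fst (fst z) powr a)" for a
    by (rule smooth_on_powr[OF op coord(1) fst_pos])
  show ?thesis
    unfolding displayed_map_def case_prod_unfold carrier_semidirect
    by (intro smooth_on_Pair[OF op] smooth_on_mult[OF op] smooth_on_add[OF op] smooth_on_diff[OF op]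
        smooth_on_uminus[OF op] smooth_on_scaleR[OF op] smooth_on_inner[OF op]
        smooth_on_const[OF op] coord powr)
qed

lemma linear_displayed_map: "linear (displayed_map g)"
proof (cases g)
  case (Pair l v)
  show ?thesis
    unfolding Pair displayed_map_def
    by (rule linearI) (auto simp: algebra_simps add_divide_distrib inner_add_left)
qed

lemma hbar_displayed_map:
  assumes "fst g > 0"
  shows "hbar (displayed_map g z) = hbar z"
proof (cases g)
  case (Pair l v)
  then have l: "l > 0" using assms by simp
  define k where "k = (2::real) powr (1/4)"
  have k: "(2::real) powr (1/2) = k\<^sup>2" "(2::real) powr (5/4) = 2 * k"
  proof -
    show "(2::real) powr (1/2) = k\<^sup>2" by (simp add: k_def powr_numeral[symmetric] powr_powr)
    have "(2::real) powr (5/4) = 2 powr 1 * 2 powr (1/4)" by (subst powr_add[symmetric]) simp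
    then show "(2::real) powr (5/4) = 2 * k" by (simp add: k_def)
  qed
  define a where "a = l powr (-1/2)"
  have a: "l * a\<^sup>2 = 1" "l\<^sup>2 * l powr (-2) = 1"
  proof -
    have "l * a\<^sup>2 = l powr 1 * l powr (-1)"
      using l by (simp add: a_def power2_eq_square powr_add[symmetric])
    then show "l * a\<^sup>2 = 1" using l by (simp add: powr_add[symmetric])
    have "l\<^sup>2 * l powr (-2) = l powr 2 * l powr (-2)" using l by simp
    then show "l\<^sup>2 * l powr (-2) = 1" using l by (simp only: powr_add[symmetric]) simp
  qed
  define L S M where "L = ell z" "S = svec z" "M = emm z"
  have inner: "(S - (k * L) *\<^sub>R v) \<bullet> (S - (k * L) *\<^sub>R v) = S \<bullet> S - 2 * k * L * (S \<bullet> v) + k\<^sup>2 * L\<^sup>2 * (v \<bullet> v)"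
    by (simp add: inner_diff_left inner_diff_right inner_commute power2_eq_square algebra_simps)
  have "hbar (displayed_map g z) = (l * L) * ((l * L) * (l powr (-2) *
      (M + k\<^sup>2 * (v \<bullet> v) * L - 2 * k * (S \<bullet> v))) - a * (a * ((S - (k * L) *\<^sub>R v) \<bullet> (S - (k * L) *\<^sub>R v))))"
    unfolding Pair hbar_lsm displayed_map_lsm[OF l] k by (simp add: L_S_M_def a_def k_def)
  also have "\<dots> = L * (L * M - S \<bullet> S)" unfolding inner using a by algebra
  finally show ?thesis by (simp add: hbar_lsm L_S_M_def)
qed

text \<open>A point of \<open>Hbar\<close> is determined by \<open>ell > 0\<close> and \<open>svec\<close>, and on this pair
  the maps act by \<open>(ell, svec) \<mapsto> (l ell, l powr (-1/2) (svec - 2 powr (1/4) ell v))\<close>.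
  The action law and simple transitivity are read off from this formula.\<close>
lemma displayed_map_action:
  "simply_transitive_right_action semidirect_group displayed_map (Hbar :: (real \<times> (real^'m) \<times> real) set)"
proof -
  let ?G = "semidirect_group :: (real \<times> (real^'m)) monoid"
  have H_eqI: "z = z'" if "z \<in> Hbar" "z' \<in> Hbar" "ell z = ell z'" "svec z = svec z'"
    for z z' :: "real \<times> (real^'m) \<times> real"
    using that by (intro lsm_eqI) (auto simp: Hbar_eq hbar_eq_1_iff)
  have closed: "displayed_map g p \<in> Hbar" if "g \<in> carrier ?G" "p \<in> Hbar" for g p
    using that by (cases g) (auto simp: Hbar_eq hbar_displayed_map displayed_map_lsm)
  moreover have "displayed_map (one ?G) p = p" if "p \<in> Hbar" for p
    using that closed[of "one ?G"] by (intro H_eqI) (auto simp: displayed_map_lsm)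
  moreover have "displayed_map (mult ?G a b) p = displayed_map b (displayed_map a p)"
    if ab: "a \<in> carrier ?G" "b \<in> carrier ?G" and p: "p \<in> Hbar" for a b p
  proof -
    obtain k u l v where a: "a = (k, u)" "k > 0" and b: "b = (l, v)" "l > 0"
      using ab by (cases a; cases b) auto
    have k: "k powr (-1/2) * k powr (3/2) = k" using a(2) by (simp add: powr_add[symmetric])
    show ?thesis
    proof (rule H_eqI)
      show "displayed_map (mult ?G a b) p \<in> Hbar"
        using p a b by (intro closed) auto
      show "displayed_map b (displayed_map a p) \<in> Hbar" using closed ab p by blast
      show "ell (displayed_map (mult ?G a b) p) = ell (displayed_map b (displayed_map a p))"
        using a b by (simp add: displayed_map_lsm)
      have "svec (displayed_map b (displayed_map a p)) = (l powr (-1/2)) *\<^sub>R ((k powr (-1/2)) *\<^sub>R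
          (svec p - (2 powr (1/4) * ell p) *\<^sub>R u) - (2 powr (1/4) * (k * ell p)) *\<^sub>R v)"
        using a b by (simp add: displayed_map_lsm)
      also have "\<dots> = (l powr (-1/2)) *\<^sub>R ((k powr (-1/2)) *\<^sub>R
          (svec p - (2 powr (1/4) * ell p) *\<^sub>R (u + (k powr (3/2)) *\<^sub>R v)))"
        by (subst (2) k[symmetric]) (simp add: algebra_simps)
      also have "\<dots> = svec (displayed_map (mult ?G a b) p)"
        using a b by (simp add: displayed_map_lsm powr_mult algebra_simps)
      finally show "svec (displayed_map (mult ?G a b) p) = svec (displayed_map b (displayed_map a p))" ..
    qed
  qed
  moreover have "\<exists>!g. g \<in> carrier ?G \<and> displayed_map g p = q" if pq: "p \<in> Hbar" "q \<in> Hbar" for p q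
  proof -
    have pos: "ell p > 0" "ell q > 0" using pq by (simp_all add: Hbar_eq)
    define l where "l = ell q / ell p"
    define v where "v = (1 / (2 powr (1/4) * ell p)) *\<^sub>R (svec p - (l powr (1/2)) *\<^sub>R svec q)"
    have l: "l > 0" using pos by (simp add: l_def)
    have ll: "l powr (-1/2) * l powr (1/2) = 1" using l by (simp add: powr_add[symmetric])
    have c: "2 powr (1/4) * ell p \<noteq> 0" using pos by simp
    have "displayed_map (l, v) p = q"
    proof (rule H_eqI)
      show "displayed_map (l, v) p \<in> Hbar" using l pq by (intro closed) auto
      show "q \<in> Hbar" by (rule pq)
      show "ell (displayed_map (l, v) p) = ell q" using l pos by (simp add: displayed_map_lsm l_def)
      have "(2 powr (1/4) * ell p) *\<^sub>R v = svec p - (l powr (1/2)) *\<^sub>R svec q"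
        using c by (simp add: v_def)
      then show "svec (displayed_map (l, v) p) = svec q"
        using l ll by (simp add: displayed_map_lsm)
    qed
    moreover have "g = (l, v)" if gG: "g \<in> carrier ?G" and gp: "displayed_map g p = q" for g
    proof -
      obtain k u where g: "g = (k, u)" "k > 0" using gG by (cases g) auto
      have "k * ell p = ell q" using gp g displayed_map_lsm(1)[OF g(2), of u p] by simp
      then have k: "k = l" using pos by (simp add: l_def field_simps)
      have "(l powr (-1/2)) *\<^sub>R (svec p - (2 powr (1/4) * ell p) *\<^sub>R u) = svec q"
        using gp g k displayed_map_lsm(2)[OF g(2), of u p] by simp
      then have "(l powr (1/2)) *\<^sub>R svec q =
          (l powr (-1/2) * l powr (1/2)) *\<^sub>R (svec p - (2 powr (1/4) * ell p) *\<^sub>R u)"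
        by (metis scaleR_scaleR mult.commute)
      then have "(l powr (1/2)) *\<^sub>R svec q = svec p - (2 powr (1/4) * ell p) *\<^sub>R u"
        unfolding ll by simp
      then have "v = u" using c by (simp add: v_def)
      then show ?thesis using g k by simp
    qed
    ultimately show ?thesis using l by (intro ex1I[of _ "(l, v)"]) auto
  qed
  ultimately show ?thesis
    unfolding simply_transitive_right_action_def by (intro conjI ballI) simp_all
qed

section \<open>The surface case and the hyperbolic plane\<close>

text \<open>On \<open>Hbar\<close> the metric is a multiple of
  \<open>3 (d ell)\<^sup>2 / ell\<^sup>2 + ell\<^sup>3 |d (svec / ell)|\<^sup>2\<close>; for one-dimensional \<open>svec\<close>
  the substitution \<open>ell = b powr (-2/3)\<close>, \<open>svec / ell = 2 / sqrt 3 * a\<close> turns it into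
  \<open>(da\<^sup>2 + db\<^sup>2) / b\<^sup>2\<close> up to a constant.\<close>

lemma Hbar_hyperbolic_plane:
  assumes "CARD('m) = 1"
  shows "isometric_onto half_plane half_plane_metric (Hbar :: (real \<times> (real^'m) \<times> real) set)
    (\<lambda>p u v. 9/8 * psr_metric hbar p u v)"
proof -
  define e :: "real^'m" where "e = (\<chi> i. 1)"
  obtain i :: 'm where i: "UNIV = {i}" using assms by (metis card_1_singletonE)
  have e: "e \<bullet> e = 1" and se: "(s \<bullet> e) *\<^sub>R e = s" for s :: "real^'m"
    unfolding inner_vec_def vec_eq_iff i e_def by simp_all (metis UNIV_I i singletonD)
  define c where "c = 2 / sqrt (3::real)"
  have c: "c > 0" "c\<^sup>2 = 4/3" by (simp_all add: c_def power_divide)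
  define F where "F z = from_lsm (snd z powr (-2/3)) ((c * snd z powr (-2/3) * fst z) *\<^sub>R e)
      (snd z powr (4/3) + c\<^sup>2 * snd z powr (-2/3) * (fst z * fst z))" for z :: "real \<times> real"
  define K where "K p = (1 / c * (svec p \<bullet> e * ell p powr (-1)), ell p powr (-3/2))"
    for p :: "real \<times> (real^'m) \<times> real"
  let ?W = "{z :: real \<times> (real^'m) \<times> real. ell z > 0}"
  have opU: "open half_plane" unfolding half_plane_def by (intro open_Collect_less continuous_intros)
  have opW: "open ?W" by (intro open_Collect_less continuous_intros)
  have F_Hbar: "F z \<in> Hbar" if "z \<in> half_plane" for z
  proof -
    define b where "b = snd z"
    have b: "b > 0" using that by (simp add: half_plane_def b_def)
    define l where "l = b powr (-2/3)"
    have l: "l > 0" using b by (simp add: l_def)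
    have "b powr (4/3) * (l * l) = 1" using b by (simp add: l_def powr_add[symmetric])
    then have "b powr (4/3) = 1 / (l * l)" using l by (simp add: field_simps)
    then have "F z = from_lsm l ((c * l * fst z) *\<^sub>R e) (1 / (l * l) + c\<^sup>2 * l * (fst z * fst z))"
      by (simp only: F_def b_def[symmetric] l_def[symmetric])
    then show ?thesis
      using l e by (simp add: Hbar_eq hbar_eq_1_iff field_simps power2_eq_square)
  qed
  have F_K: "F (K p) = p" if "p \<in> Hbar" for p
  proof (rule lsm_eqI)
    define l s where "l = ell p" "s = svec p \<bullet> e"
    have l: "l > 0" using that by (simp add: Hbar_eq l_s_def)
    have "(l powr (-3/2)) powr (-2/3) = l powr 1" "(l powr (-3/2)) powr (4/3) = l powr (-2)"
      by (simp_all only: powr_powr) simp_all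
    then have p: "(l powr (-3/2)) powr (-2/3) = l" "(l powr (-3/2)) powr (4/3) = 1 / (l * l)" "l powr (-1) = 1 / l"
      using l powr_minus_divide[of l 2] powr_minus_divide[of l 1] by (simp_all add: power2_eq_square)
    show "ell (F (K p)) = ell p" using p by (simp add: F_def K_def l_s_def)
    show "svec (F (K p)) = svec p"
      using p l c se[of "svec p"] by (simp add: F_def K_def l_s_def)
    have "svec p \<bullet> svec p = s * s" 
      by (subst (1 2) se[symmetric]) (simp add: e l_s_def)
    then have "emm p = (1 / l + s * s) / l"
      using that hbar_eq_1_iff[of p] by (simp add: Hbar_eq l_s_def)
    also have "\<dots> = 1 / (l * l) + c\<^sup>2 * l * (1 / c * (s * (1 / l)) * (1 / c * (s * (1 / l))))"
      using l c(1) by (simp add: field_simps power2_eq_square)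
    also have "\<dots> = emm (F (K p))"
      by (simp only: F_def K_def lsm_from_lsm l_s_def[symmetric] fst_conv snd_conv p)
    finally show "emm (F (K p)) = emm p" ..
  qed
  have K_F: "K (F z) = z" if "z \<in> half_plane" for z
  proof -
    have b: "snd z > 0" using that by (simp add: half_plane_def)
    have "(snd z powr (-2/3)) powr (-3/2) = snd z" 
      "snd z powr (-2/3) * (snd z powr (-2/3)) powr (-1) = 1"
      using b by (simp_all add: powr_powr powr_add[symmetric])
    then show ?thesis
      using c(1) e by (simp add: K_def F_def mult_ac prod_eq_iff)
  qed
  have KW: "K p \<in> half_plane" if "p \<in> Hbar" for p
    using that by (simp add: half_plane_def K_def Hbar_eq)
  have coord: "smooth_on half_plane (\<lambda>z. fst z)" "smooth_on half_plane (\<lambda>z. snd z)"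
    by (rule smooth_on_linear[OF opU], intro bounded_linear_intros)+
  have snd_powr: "smooth_on half_plane (\<lambda>z. snd z powr a)" for a
    by (rule smooth_on_powr[OF opU coord(2)]) (simp add: half_plane_def)
  have smF: "smooth_on half_plane F"
    unfolding F_def from_lsm_def divide_inverse
    by (intro smooth_on_Pair[OF opU] smooth_on_mult[OF opU] smooth_on_add[OF opU] smooth_on_diff[OF opU]
        smooth_on_scaleR[OF opU] smooth_on_const[OF opU] coord snd_powr)
  have coordW: "smooth_on ?W (\<lambda>z. ell z)" "smooth_on ?W (\<lambda>z. svec z)"
    by (rule smooth_on_linear[OF opW], rule bounded_linear_lsm)+
  have ell_powr: "smooth_on ?W (\<lambda>z. ell z powr a)" for a
    by (rule smooth_on_powr[OF opW coordW(1)]) simp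
  have smK: "smooth_on ?W K"
    unfolding K_def
    by (intro smooth_on_Pair[OF opW] smooth_on_mult[OF opW] smooth_on_inner[OF opW]
        smooth_on_const[OF opW] coordW ell_powr)
  have metric: "9/8 * psr_metric hbar (F z) (frechet_derivative F (at z) u) (frechet_derivative F (at z) v)
      = half_plane_metric z u v" if z: "z \<in> half_plane" for z u v
  proof -
    define D where "D = frechet_derivative F (at z)"
    have D: "(F has_derivative D) (at z)"
      unfolding D_def by (rule smooth_on_has_derivative[OF opU smF z])
    have linD: "linear D" using D by (rule has_derivative_linear)
    obtain a b where ab: "z = (a, b)" by (cases z)
    have b: "b > 0" using z by (simp add: ab half_plane_def)
    define l where "l = b powr (-2/3)"
    have l: "l > 0" using b by (simp add: l_def)
    have coordF: "ell (F z) = l" "svec (F z) = (c * l * a) *\<^sub>R e"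
      by (simp_all only: F_def ab l_def lsm_from_lsm fst_conv snd_conv)
    \<comment> \<open>\<open>hbar\<close> is constant along \<open>F\<close>; this replaces the derivative of the third coordinate\<close>
    have eq: "hbar_polar (F z) (F z) (D u) = 0" for u
    proof -
      have "((\<lambda>x. hbar (F x)) has_derivative (\<lambda>u. 3 * hbar_polar (F z) (F z) (D u))) (at z)"
        using has_derivative_compose[OF D sym_trilinear.has_derivative_cube[OF hbar_polar]]
        by (simp add: hbar_cube)
      moreover have "((\<lambda>x. hbar (F x)) has_derivative (\<lambda>u. 0)) (at z)"
        by (rule has_derivative_transform_within_open[OF has_derivative_const[of "1::real"] opU z])
          (use F_Hbar in \<open>simp add: Hbar_eq\<close>)
      ultimately have "(\<lambda>u. 3 * hbar_polar (F z) (F z) (D u)) = (\<lambda>u. 0)"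
        by (rule has_derivative_unique)
      then show ?thesis by (metis mult_eq_0_iff zero_neq_numeral)
    qed
    have der_l: "((\<lambda>x. snd x powr (-2/3)) has_derivative (\<lambda>u. - 2/3 * l / b * snd u)) (at z)"
    proof -
      have "((\<lambda>y. y powr (-2/3)) has_derivative (\<lambda>v. (-2/3) * b powr (-2/3 - 1) * v)) (at (snd z))"
        using has_real_derivative_powr[OF b, of "-2/3"]
        unfolding has_field_derivative_def ab snd_conv .
      from has_derivative_compose[OF has_derivative_snd[OF has_derivative_ident] this]
      have "((\<lambda>x. snd x powr (-2/3)) has_derivative (\<lambda>u. (-2/3) * b powr (-2/3 - 1) * snd u)) (at z)" .
      moreover have "b powr (-2/3 - 1) = l / b" unfolding l_def powr_diff using b by simp
      ultimately show ?thesis by (simp only: times_divide_eq_right)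
    qed
    have dl: "ell (D u) = - 2/3 * l / b * snd u" for u
    proof -
      have "((\<lambda>x. snd x powr (-2/3)) has_derivative (\<lambda>u. ell (D u))) (at z)"
        using bounded_linear.has_derivative[OF bounded_linear_lsm(1) D] by (simp add: F_def)
      from fun_cong[OF has_derivative_unique[OF this der_l], of u] show ?thesis .
    qed
    have ds: "svec (D u) = (c * (l * fst u + a * ell (D u))) *\<^sub>R e" for u
    proof -
      have "((\<lambda>x. (c * (snd x powr (-2/3) * fst x)) *\<^sub>R e) has_derivative (\<lambda>u. svec (D u))) (at z)"
        using bounded_linear.has_derivative[OF bounded_linear_lsm(2) D] by (simp add: F_def mult_ac)
      moreover have "((\<lambda>x. (c * (snd x powr (-2/3) * fst x)) *\<^sub>R e) has_derivative
          (\<lambda>u. (c * (snd z powr (-2/3) * fst u + - 2/3 * l / b * snd u * fst z)) *\<^sub>R e)) (at z)"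
        by (intro has_derivative_scaleR_left has_derivative_mult_right has_derivative_mult[OF der_l]
            has_derivative_fst has_derivative_ident)
      ultimately have "(\<lambda>u. svec (D u)) = (\<lambda>u. (c * (snd z powr (-2/3) * fst u + - 2/3 * l / b * snd u * fst z)) *\<^sub>R e)"
        by (rule has_derivative_unique)
      from fun_cong[OF this, of u] show ?thesis unfolding dl by (simp add: ab l_def mult_ac)
    qed
    have quad: "- 2 * hbar_polar (F z) (D u) (D u) = 8/9 * ((u \<bullet> u) / b\<^sup>2)" for u
    proof -
      have "svec (D u) - (ell (D u) / l) *\<^sub>R svec (F z) = (c * l * fst u) *\<^sub>R e"
        unfolding ds coordF using l by (simp add: scaleR_diff_left[symmetric] field_simps)
      moreover have "(norm ((c * l * fst u) *\<^sub>R e))\<^sup>2 = 4/3 * l\<^sup>2 * (fst u)\<^sup>2"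
        using e by (simp add: norm_eq_sqrt_inner power_mult_distrib c(2))
      moreover note coordF(1)
      ultimately have "- 3 * hbar_polar (F z) (D u) (D u) = 3 * (2/3 * l / b * snd u)\<^sup>2 / l\<^sup>2 + l * (4/3 * l\<^sup>2 * (fst u)\<^sup>2)"
        using hbar_polar_hyperplane[OF _ _ eq[of u]] F_Hbar[OF z] by (simp add: Hbar_eq dl)
      moreover have "l * l\<^sup>2 = 1 / b\<^sup>2"
      proof -
        have "l * l\<^sup>2 = b powr (-2)" by (simp add: l_def power2_eq_square powr_add[symmetric])
        then show ?thesis using b by (simp add: powr_minus_divide)
      qed
      moreover have "l * (4/3 * l\<^sup>2 * (fst u)\<^sup>2) = 4/3 * (fst u)\<^sup>2 * (l * l\<^sup>2)" by simp
      moreover have "3 * (2/3 * l / b * snd u)\<^sup>2 / l\<^sup>2 = 4/3 * (snd u)\<^sup>2 * (1 / b\<^sup>2)"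
        using l by (simp add: power2_eq_square)
      ultimately have "- 3 * hbar_polar (F z) (D u) (D u) = 4/3 * ((snd u)\<^sup>2 + (fst u)\<^sup>2) * (1 / b\<^sup>2)"
        by (simp add: algebra_simps)
      moreover have "u \<bullet> u = (snd u)\<^sup>2 + (fst u)\<^sup>2" by (cases u) (simp add: power2_eq_square)
      ultimately have "- 3 * hbar_polar (F z) (D u) (D u) = 4/3 * ((u \<bullet> u) / b\<^sup>2)" by simp
      then show ?thesis by linarith
    qed
    have "- 2 * hbar_polar (F z) (D u) (D v) = 8/9 * ((u \<bullet> v) / b\<^sup>2)"
    proof -
      have "hbar_polar (F z) (D (u + v)) (D (u + v)) = hbar_polar (F z) (D u) (D u)
          + 2 * hbar_polar (F z) (D u) (D v) + hbar_polar (F z) (D v) (D v)"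
        using sym_trilinear.swap_23[OF hbar_polar, of "F z" "D u" "D v"]
        by (simp add: linear_add[OF linD] sym_trilinear.add[OF hbar_polar])
      moreover have "(u + v) \<bullet> (u + v) / b\<^sup>2 = u \<bullet> u / b\<^sup>2 + 2 * (u \<bullet> v / b\<^sup>2) + v \<bullet> v / b\<^sup>2"
        by (simp add: inner_add_left inner_add_right inner_commute add_divide_distrib)
      ultimately show ?thesis using quad[of u] quad[of v] quad[of "u + v"] by simp
    qed
    then show ?thesis
      unfolding D_def[symmetric] psr_metric_def half_plane_metric_def hbar_cube
        sym_trilinear.hessian_cube[OF hbar_polar] by (simp add: ab)
  qed
  show ?thesis
    unfolding isometric_onto_def
  proof (intro exI conjI ballI allI)
    show "F ` half_plane = Hbar" using F_Hbar F_K KW by (metis (no_types, lifting) image_iff subsetI subset_antisym image_subsetI)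
    show "Hbar \<subseteq> ?W" by (auto simp: Hbar_eq)
  qed (use smF smK opW K_F metric in auto)
qed

section \<open>The boundary of the cone over a closed hypersurface\<close>

lemma directional_sign:
  fixes f :: "'a::real_normed_vector \<Rightarrow> real"
  assumes "(f has_derivative f') (at p)" "f p = 0" "f' u > 0"
  shows "\<exists>d>0. \<forall>t. 0 < t \<and> t < d \<longrightarrow> f (p + t *\<^sub>R u) > 0 \<and> f (p - t *\<^sub>R u) < 0"
proof -
  have "((\<lambda>t. p + t *\<^sub>R u) has_derivative (\<lambda>t. t *\<^sub>R u)) (at 0)"
    by (auto intro!: derivative_eq_intros)
  from has_derivative_compose[OF this, of f f'] assms(1)
  have "((\<lambda>t. f (p + t *\<^sub>R u)) has_derivative (\<lambda>t. f' (t *\<^sub>R u))) (at 0)" by simp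
  moreover have "(\<lambda>t. f' (t *\<^sub>R u)) = (*) (f' u)"
    by (rule ext) (simp add: linear_cmul[OF has_derivative_linear[OF assms(1)]])
  ultimately have der: "DERIV (\<lambda>t. f (p + t *\<^sub>R u)) 0 :> f' u"
    unfolding has_field_derivative_def by simp
  obtain d1 where d1: "d1 > 0" "\<And>t. 0 < t \<Longrightarrow> t < d1 \<Longrightarrow> f (p + 0 *\<^sub>R u) < f (p + (0 + t) *\<^sub>R u)"
    using DERIV_pos_inc_right[OF der assms(3)] by blast
  obtain d2 where d2: "d2 > 0" "\<And>t. 0 < t \<Longrightarrow> t < d2 \<Longrightarrow> f (p + (0 - t) *\<^sub>R u) < f (p + 0 *\<^sub>R u)"
    using DERIV_pos_inc_left[OF der assms(3)] by blast
  show ?thesis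
    using d1 d2 assms(2) by (intro exI[of _ "min d1 d2"]) simp
qed

context sym_trilinear
begin

lemma increment: "T z' z' z' - T z z z = T z' z' (z' - z) + T z' z (z' - z) + T z z (z' - z)"
  using swap_12[of z z' z] swap_23[of z z z'] swap_23[of z z' z'] swap_12[of z z' z'] 
    swap_23[of z' z z'] by (simp add: diff)

lemma continuous_on_square:
  assumes "continuous_on S f" "continuous_on S g"
  shows "continuous_on S (\<lambda>x. T (f x) (g x) u)"
  using bounded_bilinear.continuous_on[OF bounded_bilinear_12 assms] .

text \<open>For a hypersurface contained in the level set of the cubic, the defining function \<open>f\<close>
  cannot be constant to first order along the ray through \<open>p\<close>: otherwise the zero set of
  \<open>f\<close> would contain points \<open>p + a p + b w\<close> with \<open>b\<close> much smaller than
  \<open>a\<close>, where the cubic exceeds one.\<close>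

lemma hypersurface_transversal:
  assumes h1: "T p p p = 1" and f: "(f has_derivative f') (at p)" "f p = 0" "f' \<noteq> (\<lambda>_. 0)"
    and U: "open U" "p \<in> U" "continuous_on U f"
    and level: "\<And>q. q \<in> U \<Longrightarrow> f q = 0 \<Longrightarrow> T q q q = 1"
  shows "f' p \<noteq> (0 :: real)"
proof
  assume fp: "f' p = 0"
  have lin: "linear f'" using f(1) by (rule has_derivative_linear)
  obtain w where w: "f' w > 0"
  proof -
    obtain w where "f' w \<noteq> 0" using f(3) by blast
    then show ?thesis using that[of w] that[of "-w"] linear_neg[OF lin, of w]
      by (cases "f' w > 0") auto
  qed
  define K where "K = \<bar>T p p w\<bar> + \<bar>T p w w\<bar> + \<bar>T w w w\<bar> + 1"
  \<comment> \<open>with \<open>|b| \<le> a \<eta>\<close> the terms containing \<open>w\<close> are at most \<open>3 a / 2\<close>, half of the gain \<open>3 a\<close> along the ray\<close>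
  define \<eta> where "\<eta> = 1 / (8 * K)"
  have K: "K \<ge> 1" unfolding K_def by simp
  have \<eta>: "\<eta> > 0" "\<eta> \<le> 1" "8 * \<eta> * K = 1" using K by (auto simp: \<eta>_def field_simps)
  obtain r where r: "r > 0" "ball p r \<subseteq> U" using U(1,2) open_contains_ball by blast
  have "f' (p + \<eta> *\<^sub>R w) > 0" "f' (- p + \<eta> *\<^sub>R w) > 0"
    using w \<eta> fp by (simp_all add: linear_add[OF lin] linear_neg[OF lin] linear_diff[OF lin] linear_cmul[OF lin])
  from directional_sign[OF f(1,2) this(1)] directional_sign[OF f(1,2) this(2)]
  obtain d1 d2 where d: "d1 > 0" "d2 > 0"
    "\<And>t. 0 < t \<Longrightarrow> t < d1 \<Longrightarrow> f (p + t *\<^sub>R (p + \<eta> *\<^sub>R w)) > 0"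
    "\<And>t. 0 < t \<Longrightarrow> t < d2 \<Longrightarrow> f (p - t *\<^sub>R (- p + \<eta> *\<^sub>R w)) < 0" by blast
  define c where "c = norm p + norm w + 1"
  have c: "c > 0" unfolding c_def by (intro add_nonneg_pos) auto
  define a where "a = min (min (d1 / 2) (d2 / 2)) (min 1 (r / (2 * c)))"
  have a: "0 < a" "a < d1" "a < d2" "a \<le> 1" "a * c < r"
  proof -
    show "0 < a" "a < d1" "a < d2" "a \<le> 1" using d r c by (auto simp: a_def)
    have "a \<le> r / (2 * c)" by (simp add: a_def)
    then have "a * c \<le> r / 2" using c by (simp add: field_simps)
    then show "a * c < r" using r(1) by simp
  qed
  let ?g = "\<lambda>b. p + a *\<^sub>R p + b *\<^sub>R w"
  have inU: "?g b \<in> U" if "\<bar>b\<bar> \<le> a" for b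
  proof -
    have "norm (a *\<^sub>R p + b *\<^sub>R w) \<le> a * norm p + \<bar>b\<bar> * norm w"
      using a(1) norm_triangle_ineq[of "a *\<^sub>R p" "b *\<^sub>R w"] by simp
    also have "\<dots> \<le> a * norm p + a * norm w" using that by (intro add_mono mult_right_mono) auto
    also have "\<dots> \<le> a * c" using a(1) by (simp add: c_def algebra_simps)
    also note a(5)
    finally have "norm (a *\<^sub>R p + b *\<^sub>R w) < r" .
    moreover have "p - ?g b = - (a *\<^sub>R p + b *\<^sub>R w)" by simp
    ultimately have "dist p (?g b) < r" unfolding dist_norm by (simp only: norm_minus_cancel)
    then show ?thesis using r(2) by auto
  qed
  have a\<eta>: "a * \<eta> \<le> a" using a(1) \<eta> by (simp add: mult_left_le)
  have "continuous_on {- (a * \<eta>)..a * \<eta>} (\<lambda>b. f (?g b))"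
    by (rule continuous_on_compose2[OF U(3)]) (auto intro!: continuous_intros inU a\<eta>[THEN order_trans[rotated]])
  moreover have "f (?g (- (a * \<eta>))) \<le> 0" "0 \<le> f (?g (a * \<eta>))"
    using d(3)[of a] d(4)[of a] a by (simp_all add: algebra_simps)
  ultimately obtain b where b: "- (a * \<eta>) \<le> b" "b \<le> a * \<eta>" "f (?g b) = 0"
    using IVT'[of "\<lambda>b. f (?g b)" "- (a * \<eta>)" 0 "a * \<eta>"] a(1) \<eta>(1) by auto
  have absb: "\<bar>b\<bar> \<le> a * \<eta>" "\<bar>b\<bar> \<le> 1" using b a(4) a\<eta> by linarith+
  have "T (?g b) (?g b) (?g b) = 1" using absb a\<eta> b(3) by (intro level inU) auto
  moreover have "?g b = (1 + a) *\<^sub>R p + b *\<^sub>R w" by (simp add: algebra_simps)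
  ultimately have "1 = T ((1 + a) *\<^sub>R p + b *\<^sub>R w) ((1 + a) *\<^sub>R p + b *\<^sub>R w) ((1 + a) *\<^sub>R p + b *\<^sub>R w)"
    by simp
  also have "\<dots> = (1 + a) ^ 3 + b * (3 * (1 + a)\<^sup>2 * T p p w + 3 * (1 + a) * b * T p w w + b\<^sup>2 * T w w w)"
    unfolding cube_add scale h1 real_scaleR_def
    by (simp add: power2_eq_square power3_eq_cube algebra_simps)
  finally have eq: "1 = (1 + a) ^ 3 + b * (3 * (1 + a)\<^sup>2 * T p p w + 3 * (1 + a) * b * T p w w + b\<^sup>2 * T w w w)" .
  have "\<bar>3 * (1 + a)\<^sup>2 * T p p w + 3 * (1 + a) * b * T p w w + b\<^sup>2 * T w w w\<bar>
      \<le> 12 * \<bar>T p p w\<bar> + 12 * \<bar>T p w w\<bar> + 12 * \<bar>T w w w\<bar>"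
  proof -
    have "(1 + a)\<^sup>2 \<le> 2\<^sup>2" using a by (intro power_mono) auto
    then have "\<bar>3 * (1 + a)\<^sup>2 * T p p w\<bar> \<le> 12 * \<bar>T p p w\<bar>"
      by (simp add: abs_mult mult_right_mono)
    moreover have "\<bar>3 * (1 + a) * b * T p w w\<bar> \<le> 12 * \<bar>T p w w\<bar>"
    proof -
      have "(1 + a) * \<bar>b\<bar> \<le> 2 * 1" using a absb by (intro mult_mono) auto
      then have "(1 + a) * \<bar>b\<bar> * \<bar>T p w w\<bar> \<le> 2 * \<bar>T p w w\<bar>"
        by (intro mult_right_mono) auto
      moreover have "\<bar>3 * (1 + a) * b * T p w w\<bar> = 3 * ((1 + a) * \<bar>b\<bar> * \<bar>T p w w\<bar>)"
        using a(1) by (simp add: abs_mult)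
      ultimately show ?thesis by linarith
    qed
    moreover have "\<bar>b\<^sup>2 * T w w w\<bar> \<le> 12 * \<bar>T w w w\<bar>"
    proof -
      have "b\<^sup>2 \<le> 1" using absb(2) abs_square_le_1 by blast
      then have "b\<^sup>2 * \<bar>T w w w\<bar> \<le> 12 * \<bar>T w w w\<bar>" by (intro mult_right_mono) auto
      then show ?thesis by (simp add: abs_mult)
    qed
    ultimately show ?thesis by linarith
  qed
  also have "\<dots> \<le> 12 * K" by (simp add: K_def)
  finally have "\<bar>b * (3 * (1 + a)\<^sup>2 * T p p w + 3 * (1 + a) * b * T p w w + b\<^sup>2 * T w w w)\<bar> \<le> a * \<eta> * (12 * K)"
    unfolding abs_mult using absb(1) a(1) \<eta>(1) by (intro mult_mono) auto
  also have "\<dots> = a * (3/2)" using \<eta>(3) by (simp add: mult_ac)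
  finally have "1 \<ge> (1 + a) ^ 3 - a * (3/2)" using eq by linarith
  moreover have "(1 + a) ^ 3 \<ge> 1 + 3 * a"
    using a(1) by (simp add: power3_eq_cube algebra_simps)
  ultimately show False using a(1) by simp
qed

text \<open>By transversality the defining function changes sign along the ray through \<open>p\<close>, hence along
  every nearby ray. So each of these rays meets the hypersurface; as it meets the level set in a
  single point, that point lies on the hypersurface.\<close>
lemma hypersurface_open_in_level:
  assumes "smooth_hypersurface H" and level: "\<And>q. q \<in> H \<Longrightarrow> T q q q = 1" and "p \<in> H"
  shows "\<exists>\<delta>>0. \<forall>z. dist p z < \<delta> \<and> T z z z = 1 \<longrightarrow> z \<in> H"
proof -
  obtain U and f :: "'a \<Rightarrow> real" where Uf: "open U \<and> p \<in> U \<and> smooth_on U f \<and>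
      (\<forall>q\<in>U. frechet_derivative f (at q) \<noteq> (\<lambda>_. 0)) \<and> H \<inter> U = {q \<in> U. f q = 0}"
    using assms(1,3) unfolding smooth_hypersurface_def by fast
  then have U: "open U" "p \<in> U" and sm: "smooth_on U f" and HU: "H \<inter> U = {q \<in> U. f q = 0}"
    and fne: "frechet_derivative f (at p) \<noteq> (\<lambda>_. 0)" by blast+
  have fp: "f p = 0" using HU U(2) assms(3) by blast
  have "Ck_on 0 U f" using sm unfolding smooth_on_def by blast
  then have cont: "continuous_on U f" by simp
  define f' where "f' = frechet_derivative f (at p)"
  have der: "(f has_derivative f') (at p)"
    unfolding f'_def by (rule smooth_on_has_derivative[OF U(1) sm U(2)])
  have f'p: "f' p \<noteq> 0"
    using HU level fne
    by (intro hypersurface_transversal[OF level[OF assms(3)] der fp _ U cont]) (auto simp: f'_def)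
  have p0: "p \<noteq> 0" using level[OF assms(3)] by (auto simp: zero)
  obtain r where r: "r > 0" "ball p r \<subseteq> U" using U open_contains_ball by blast
  obtain s where s: "s > 0" "s < 1" "s * norm p < r / 2" "f ((1 - s) *\<^sub>R p) * f ((1 + s) *\<^sub>R p) < 0"
  proof -
    obtain g :: real and d where g: "g \<noteq> 0" and d: "d > 0" "\<And>t. 0 < t \<Longrightarrow> t < d \<Longrightarrow>
      g * f (p + t *\<^sub>R p) > 0 \<and> g * f (p - t *\<^sub>R p) < 0"
    proof (cases "f' p > 0")
      case True
      then show ?thesis using directional_sign[OF der fp True] that[of 1] by auto
    next
      case False
      then have "- f' p > 0" using f'p by simp
      from directional_sign[OF has_derivative_minus[OF der] _ this] show ?thesis
        using fp that[of "-1"] by auto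
    qed
    define s where "s = min (d / 2) (min (1/2) (r / (4 * norm p)))"
    have s: "s > 0" "s < 1" "s < d" using d(1) r(1) p0 by (auto simp: s_def)
    have "s \<le> r / (4 * norm p)" by (simp add: s_def)
    then have "s * norm p \<le> r / 4" using p0 by (simp add: field_simps)
    then have "s * norm p < r / 2" using r(1) by simp
    moreover have "(1 + s) *\<^sub>R p = p + s *\<^sub>R p" "(1 - s) *\<^sub>R p = p - s *\<^sub>R p"
      by (simp_all add: algebra_simps)
    moreover have "f (p - s *\<^sub>R p) * f (p + s *\<^sub>R p) < 0"
      using d(2)[OF s(1,3)] by (auto simp: zero_less_mult_iff mult_less_0_iff)
    ultimately show ?thesis using s that by simp
  qed
  have in_ball: "t *\<^sub>R z \<in> ball p r" if "dist p z < r / 4" "\<bar>t - 1\<bar> \<le> s" for t z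
  proof -
    have "p - t *\<^sub>R z = (1 - t) *\<^sub>R p + t *\<^sub>R (p - z)" by (simp add: algebra_simps)
    then have "dist p (t *\<^sub>R z) \<le> \<bar>1 - t\<bar> * norm p + \<bar>t\<bar> * dist p z"
      using norm_triangle_ineq[of "(1 - t) *\<^sub>R p" "t *\<^sub>R (p - z)"] by (simp add: dist_norm)
    also have "\<dots> \<le> s * norm p + 2 * (r / 4)"
      using that s r(1) by (intro add_mono mult_mono) auto
    also have "\<dots> < r" using s(3) by simp
    finally show ?thesis by simp
  qed
  have lim: "((\<lambda>z. f ((1 - s) *\<^sub>R z) * f ((1 + s) *\<^sub>R z)) \<longlongrightarrow> f ((1 - s) *\<^sub>R p) * f ((1 + s) *\<^sub>R p)) (nhds p)"
  proof (intro tendsto_mult)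
    have "((\<lambda>z. f (t *\<^sub>R z)) \<longlongrightarrow> f (t *\<^sub>R p)) (nhds p)" if "\<bar>t - 1\<bar> \<le> s" for t
    proof -
      have "t *\<^sub>R p \<in> U" using in_ball[OF _ that, of p] r by auto
      then have "isCont f (t *\<^sub>R p)" using cont U(1) continuous_on_eq_continuous_at by blast
      then show ?thesis
        by (rule isCont_tendsto_compose) (intro tendsto_intros filterlim_ident)
    qed
    from this[of "1 - s"] this[of "1 + s"] s(1)
    show "((\<lambda>z. f ((1 - s) *\<^sub>R z)) \<longlongrightarrow> f ((1 - s) *\<^sub>R p)) (nhds p)"
      "((\<lambda>z. f ((1 + s) *\<^sub>R z)) \<longlongrightarrow> f ((1 + s) *\<^sub>R p)) (nhds p)" by simp_all
  qed
  from order_tendstoD(2)[OF lim s(4)] obtain \<delta>0 where \<delta>0: "\<delta>0 > 0"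
    "\<And>z. dist z p < \<delta>0 \<Longrightarrow> f ((1 - s) *\<^sub>R z) * f ((1 + s) *\<^sub>R z) < 0"
    unfolding eventually_nhds_metric by blast
  define \<delta> where "\<delta> = min \<delta>0 (r / 4)"
  have "z \<in> H" if z: "dist p z < \<delta>" "T z z z = 1" for z
  proof -
    have zr: "dist p z < r / 4" and sgn: "f ((1 - s) *\<^sub>R z) * f ((1 + s) *\<^sub>R z) < 0"
      using z(1) \<delta>0(2)[of z] by (auto simp: \<delta>_def dist_commute)
    have in_U: "t *\<^sub>R z \<in> U" if "1 - s \<le> t" "t \<le> 1 + s" for t
      using in_ball[OF zr, of t] that r(2) by auto
    then have "continuous_on {1 - s..1 + s} (\<lambda>t. f (t *\<^sub>R z))"
      by (intro continuous_on_compose2[OF cont] continuous_intros) auto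
    then obtain t where t: "1 - s \<le> t" "t \<le> 1 + s" "f (t *\<^sub>R z) = 0"
      using IVT'[of "\<lambda>t. f (t *\<^sub>R z)" "1 - s" 0 "1 + s"] IVT2'[of "\<lambda>t. f (t *\<^sub>R z)" "1 + s" 0 "1 - s"] sgn s(1)
      by (auto simp: mult_less_0_iff)
    then have tz: "t *\<^sub>R z \<in> H" using in_U HU by blast
    from level[OF this] have "t ^ 3 = 1" unfolding cube_scale z(2) by simp
    moreover have "t > 0" using t(1) s(2) by simp
    ultimately have "t = 1" using power_eq_iff_eq_base[of 3 t 1] by simp
    then show ?thesis using tz by simp
  qed
  then show ?thesis using \<delta>0(1) r(1) by (intro exI[of _ \<delta>]) (auto simp: \<delta>_def)
qed

text \<open>Every direction tangent to the zero set at a regular point is the velocity of a smooth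
  curve in the zero set. The curve is \<open>q + t u + f t e\<close>, where \<open>f t\<close> is found by the
  intermediate value theorem along \<open>e\<close>. The difference quotients of \<open>f\<close> are
  expressed exactly by the polarization, so \<open>f\<close> is differentiable. Its derivative is a
  rational expression in the point of the curve, so each order of regularity yields the next.\<close>

lemma implicit_curve:
  assumes hq: "T q q q = 0" and e: "T q q e > 0" and u: "T q q u = 0" and "\<delta> > 0"
  obtains \<epsilon> c where "\<epsilon> > 0" "smooth_on {-\<epsilon><..<\<epsilon>} c" "c 0 = q" "(c has_vector_derivative u) (at 0)"
    "\<And>t. t \<in> {-\<epsilon><..<\<epsilon>} \<Longrightarrow> T (c t) (c t) (c t) = 0 \<and> dist q (c t) < \<delta>"
proof -
  define \<Phi> where "\<Phi> v z = T (snd z) (snd z) v + T (snd z) (fst z) v + T (fst z) (fst z) v" for v z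
  have inc: "T x' x' x' - T x x x = \<Phi> (x' - x) (x, x')" for x x'
    by (simp add: \<Phi>_def increment)
  have cont\<Phi>: "continuous_on S (\<Phi> v)" for S v
    unfolding \<Phi>_def by (intro continuous_intros continuous_on_square)
  have lin\<Phi>: "\<Phi> (a *\<^sub>R v + b *\<^sub>R w) z = a * \<Phi> v z + b * \<Phi> w z" for a b v w z
    by (simp add: \<Phi>_def add scale algebra_simps)
  have \<Phi>q: "\<Phi> v (q, q) = 3 * T q q v" for v by (simp add: \<Phi>_def)
  \<comment> \<open>a closed ball on which the cubic increases along \<open>e\<close>\<close>
  have "open {z. \<Phi> e z > 0}" by (intro open_Collect_less continuous_on_const cont\<Phi>)
  moreover have "(q, q) \<in> {z. \<Phi> e z > 0}" using e \<Phi>q[of e] by simp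
  ultimately obtain r0 where r0: "r0 > 0" "ball (q, q) r0 \<subseteq> {z. \<Phi> e z > 0}"
    unfolding open_contains_ball by blast
  define \<rho> where "\<rho> = min (r0 / 3) (\<delta> / 2)"
  have \<rho>: "\<rho> > 0" "\<rho> < \<delta>" "3 * \<rho> \<le> r0" using r0(1) assms(4) by (auto simp: \<rho>_def)
  let ?B = "cball q \<rho>"
  have pos: "\<Phi> e (x, y) > 0" if "x \<in> ?B" "y \<in> ?B" for x y
  proof -
    have "dist (q, q) (x, y) \<le> dist q x + dist q y"
      using real_sqrt_sum_squares_triangle_ineq[of "dist q x" 0 0 "dist q y"] by (simp add: dist_Pair_Pair)
    then have "(x, y) \<in> ball (q, q) r0" using that \<rho> by simp
    then show ?thesis using r0(2) by blast
  qed
  define \<eta> where "\<eta> = \<rho> / (2 * (norm e + 1))"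
  have "norm e + 1 > 0" by (intro add_nonneg_pos) auto
  then have \<eta>: "\<eta> > 0" "\<eta> * norm e \<le> \<rho> / 2"
    using \<rho>(1) by (auto simp: \<eta>_def field_simps)
  define P where "P t s = q + t *\<^sub>R u + s *\<^sub>R e" for t s :: real
  define \<epsilon>1 where "\<epsilon>1 = \<rho> / (2 * (norm u + 1))"
  have "norm u + 1 > 0" by (intro add_nonneg_pos) auto
  then have \<epsilon>1: "\<epsilon>1 > 0" "\<epsilon>1 * norm u \<le> \<rho> / 2"
    using \<rho>(1) by (auto simp: \<epsilon>1_def field_simps)
  have PB: "P t s \<in> ?B" if "\<bar>t\<bar> \<le> \<epsilon>1" "\<bar>s\<bar> \<le> \<eta>" for t s
  proof -
    have "q - P t s = - (t *\<^sub>R u + s *\<^sub>R e)" by (simp add: P_def)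
    then have "dist q (P t s) = norm (t *\<^sub>R u + s *\<^sub>R e)"
      unfolding dist_norm by (simp only: norm_minus_cancel)
    also have "\<dots> \<le> \<bar>t\<bar> * norm u + \<bar>s\<bar> * norm e"
      using norm_triangle_ineq[of "t *\<^sub>R u" "s *\<^sub>R e"] by simp
    also have "\<dots> \<le> \<epsilon>1 * norm u + \<eta> * norm e" using that by (intro add_mono mult_right_mono) auto
    finally show ?thesis using \<epsilon>1 \<eta> by simp
  qed
  define g where "g t s = T (P t s) (P t s) (P t s)" for t s
  have contg: "continuous_on S (\<lambda>t. g t s)" "continuous_on S (g t)" for S s t
    unfolding g_def P_def by (rule continuous_on_compose2[OF continuous_on_cube[of UNIV]], intro continuous_intros, simp)+
  have g_inc: "g t' s' - g t s = (t' - t) * \<Phi> u (P t s, P t' s') + (s' - s) * \<Phi> e (P t s, P t' s')" for t t' s s'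
  proof -
    have "P t' s' - P t s = (t' - t) *\<^sub>R u + (s' - s) *\<^sub>R e" by (simp add: P_def algebra_simps)
    then show ?thesis unfolding g_def inc by (simp only: lin\<Phi>)
  qed
  have g0: "g 0 0 = 0" by (simp add: g_def P_def hq)
  have "g 0 \<eta> > 0" "g 0 (- \<eta>) < 0"
    using g_inc[of 0 \<eta> 0 0] g_inc[of 0 "- \<eta>" 0 0] g0 \<eta>(1) \<epsilon>1(1) pos[OF PB PB] by simp_all
  then have "\<exists>\<epsilon>>0. \<forall>t. dist t 0 < \<epsilon> \<longrightarrow> g t \<eta> > 0 \<and> g t (- \<eta>) < 0"
  proof -
    assume "g 0 \<eta> > 0" "g 0 (- \<eta>) < 0"
    moreover have "((\<lambda>t. g t s) \<longlongrightarrow> g 0 s) (nhds 0)" for s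
    proof -
      have "isCont (\<lambda>t. g t s) 0" using contg(1)[of UNIV s] by (simp add: continuous_on_eq_continuous_at)
      then show ?thesis unfolding isCont_def by (rule tendsto_at_iff_tendsto_nhds[THEN iffD1])
    qed
    ultimately have "eventually (\<lambda>t. g t \<eta> > 0 \<and> g t (- \<eta>) < 0) (nhds 0)"
      by (intro eventually_conj order_tendstoD)
    then show ?thesis unfolding eventually_nhds_metric .
  qed
  then obtain \<epsilon>2 where \<epsilon>2: "\<epsilon>2 > 0" "\<And>t. \<bar>t\<bar> < \<epsilon>2 \<Longrightarrow> g t \<eta> > 0 \<and> g t (- \<eta>) < 0" by auto
  define \<epsilon> where "\<epsilon> = min \<epsilon>1 \<epsilon>2"
  let ?I = "{-\<epsilon><..<\<epsilon>}"
  have "\<exists>s. \<bar>s\<bar> \<le> \<eta> \<and> g t s = 0" if "t \<in> ?I" for t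
  proof -
    have "\<bar>t\<bar> < \<epsilon>2" using that by (auto simp: \<epsilon>_def min_def split: if_splits)
    then have "g t (- \<eta>) \<le> 0" "0 \<le> g t \<eta>" using \<epsilon>2(2)[of t] by auto
    then obtain s where "- \<eta> \<le> s" "s \<le> \<eta>" "g t s = 0"
      using IVT'[of "g t" "- \<eta>" 0 \<eta>] contg(2)[of _ t] \<eta>(1) by auto
    then show ?thesis by (intro exI[of _ s]) auto
  qed
  then obtain f where f: "\<And>t. t \<in> ?I \<Longrightarrow> \<bar>f t\<bar> \<le> \<eta>" "\<And>t. t \<in> ?I \<Longrightarrow> g t (f t) = 0" by metis
  define c where "c t = P t (f t)" for t
  have cB: "c t \<in> ?B" if "t \<in> ?I" for t
    unfolding c_def using that f(1) by (intro PB) (auto simp: \<epsilon>_def)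
  have step: "(t' - t) * \<Phi> u (c t, c t') + (f t' - f t) * \<Phi> e (c t, c t') = 0" if "t \<in> ?I" "t' \<in> ?I" for t t'
    using g_inc[of t' "f t'" t "f t"] f(2)[OF that(1)] f(2)[OF that(2)] by (simp add: c_def)
  have quot: "f t' - f t = - (\<Phi> u (c t, c t') / \<Phi> e (c t, c t')) * (t' - t)" if "t \<in> ?I" "t' \<in> ?I" for t t'
    using step[OF that] pos[OF cB[OF that(1)] cB[OF that(2)]] by (simp add: field_simps)
  have contR: "continuous_on (?B \<times> ?B) (\<lambda>z. \<Phi> u z / \<Phi> e z)"
    using pos by (intro continuous_on_divide cont\<Phi>) force
  have "compact (?B \<times> ?B)" by (intro compact_Times compact_cball)
  from compact_imp_bounded[OF compact_continuous_image[OF contR this]]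
  obtain M where M: "\<And>z. z \<in> ?B \<times> ?B \<Longrightarrow> \<bar>\<Phi> u z / \<Phi> e z\<bar> \<le> M"
    unfolding bounded_iff by auto
  have lip: "\<bar>f t' - f t\<bar> \<le> M * \<bar>t' - t\<bar>" if "t \<in> ?I" "t' \<in> ?I" for t t'
    unfolding quot[OF that] abs_mult using M[of "(c t, c t')"] cB that
    by (intro mult_right_mono) auto
  have contf: "(f \<longlongrightarrow> f t) (at t)" if t: "t \<in> ?I" for t
  proof -
    have "((\<lambda>t'. M * \<bar>t' - t\<bar>) \<longlongrightarrow> M * \<bar>t - t\<bar>) (at t)" by (intro tendsto_intros)
    then have lim: "((\<lambda>t'. M * \<bar>t' - t\<bar>) \<longlongrightarrow> 0) (at t)" by simp
    have "eventually (\<lambda>t'. t' \<in> ?I) (at t)"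
      using t by (intro eventually_at_in_open') auto
    then have "eventually (\<lambda>t'. norm (f t' - f t) \<le> M * \<bar>t' - t\<bar>) (at t)"
      by eventually_elim (use lip[OF t] in auto)
    then have "((\<lambda>t'. f t' - f t) \<longlongrightarrow> 0) (at t)" using lim by (rule Lim_null_comparison)
    then show ?thesis by (simp add: LIM_zero_iff)
  qed
  have contc: "(c \<longlongrightarrow> c t) (at t)" if "t \<in> ?I" for t
    unfolding c_def P_def by (intro tendsto_intros contf that)
  have derf: "(f has_real_derivative - (T (c t) (c t) u / T (c t) (c t) e)) (at t)" if t: "t \<in> ?I" for t
  proof -
    have cc: "((\<lambda>t'. \<Phi> v (c t, c t')) \<longlongrightarrow> \<Phi> v (c t, c t)) (at t)" for v
    proof -
      have "isCont (\<Phi> v) (c t, c t)" using cont\<Phi>[of UNIV] by (simp add: continuous_on_eq_continuous_at)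
      then show ?thesis
        by (rule isCont_tendsto_compose) (intro tendsto_Pair tendsto_const contc t)
    qed
    have "((\<lambda>t'. - (\<Phi> u (c t, c t') / \<Phi> e (c t, c t'))) \<longlongrightarrow> - (\<Phi> u (c t, c t) / \<Phi> e (c t, c t))) (at t)"
      using pos[OF cB[OF t] cB[OF t]] by (intro tendsto_intros cc) auto
    moreover have "eventually (\<lambda>t'. t' \<in> ?I - {t}) (at t)"
      using t by (intro eventually_at_in_open) auto
    then have "eventually (\<lambda>t'. - (\<Phi> u (c t, c t') / \<Phi> e (c t, c t')) = (f t' - f t) / (t' - t)) (at t)"
      by eventually_elim (use quot[OF t] in \<open>simp add: field_simps\<close>)
    ultimately have "((\<lambda>t'. (f t' - f t) / (t' - t)) \<longlongrightarrow> - (\<Phi> u (c t, c t) / \<Phi> e (c t, c t))) (at t)"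
      by (rule Lim_transform_eventually)
    then show ?thesis by (simp add: has_field_derivative_iff \<Phi>_def)
  qed
  have e_pos: "T (c t) (c t) e > 0" if "t \<in> ?I" for t
    using pos[OF cB[OF that] cB[OF that]] by (simp add: \<Phi>_def)
  have op: "open ?I" by simp
  have Ckc: "Ck_on k ?I c" if "Ck_on k ?I f" for k
    unfolding c_def P_def
    by (intro Ck_on_add[OF op] Ck_on_const[OF op] Ck_on_bounded_bilinear[OF op bounded_bilinear_scaleR]
        Ck_on_ident[OF op] that)
  have Ckf: "Ck_on k ?I f" for k
  proof (induction k)
    case 0
    show ?case using contf by (simp add: continuous_on_def) (metis Lim_at_imp_Lim_at_within greaterThanLessThan_iff)
  next
    case (Suc k)
    show ?case
    proof (rule Ck_on_SucI[OF op])
      show "(f has_derivative (\<lambda>v. - (T (c t) (c t) u * T (c t) (c t) e powr (-1)) * v)) (at t)" if "t \<in> ?I" for t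
      proof -
        have "- (T (c t) (c t) u * T (c t) (c t) e powr (-1)) = - (T (c t) (c t) u / T (c t) (c t) e)"
          using e_pos[OF that] by (simp add: powr_minus_divide)
        then show ?thesis using derf[OF that] unfolding has_field_derivative_def by (simp only:)
      qed
      have "Ck_on k ?I (\<lambda>t. - 1 * (T (c t) (c t) u * T (c t) (c t) e powr (-1)) * v)" for v
        by (intro Ck_on_bounded_bilinear[OF op bounded_bilinear_mult] Ck_on_const[OF op]
            Ck_on_powr[OF op _ e_pos] Ck_on_bounded_bilinear[OF op bounded_bilinear_12] Ckc Suc.IH)
      then show "Ck_on k ?I (\<lambda>t. - (T (c t) (c t) u * T (c t) (c t) e powr (-1)) * v)" for v by simp
    qed
  qed
  have \<epsilon>: "\<epsilon> > 0" using \<epsilon>1 \<epsilon>2 by (simp add: \<epsilon>_def)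
  then have I0: "0 \<in> ?I" by simp
  have f0: "f 0 = 0"
  proof -
    have "f 0 * \<Phi> e (P 0 0, P 0 (f 0)) = 0" using g_inc[of 0 "f 0" 0 0] g0 f(2)[OF I0] by simp
    moreover have "\<Phi> e (P 0 0, P 0 (f 0)) > 0" using f(1)[OF I0] \<eta> \<epsilon>1 by (intro pos PB) auto
    ultimately show ?thesis by simp
  qed
  have c0: "c 0 = q" by (simp add: c_def P_def f0)
  have "((\<lambda>t. q + t *\<^sub>R u + f t *\<^sub>R e) has_vector_derivative (0 + 1 *\<^sub>R u + 0 *\<^sub>R e)) (at 0)"
    using derf[OF I0] u
    by (auto simp: c0 has_real_derivative_iff_has_vector_derivative intro!: derivative_eq_intros)
  then have "(c has_vector_derivative u) (at 0)" by (simp add: c_def[abs_def] P_def)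
  then show ?thesis
    using that[of \<epsilon> c] \<epsilon> c0 Ckf Ckc cB f(2) \<rho> unfolding smooth_on_def g_def c_def[symmetric]
    by (force simp: g_def c_def)
qed

lemma cube_normalize:
  assumes "T z z z > 0"
  shows "T (T z z z powr (-1/3) *\<^sub>R z) (T z z z powr (-1/3) *\<^sub>R z) (T z z z powr (-1/3) *\<^sub>R z) = 1"
proof -
  have "(T z z z powr (-1/3)) ^ 3 = T z z z powr (-1)"
    using assms by (simp add: power3_eq_cube powr_add[symmetric])
  then show ?thesis unfolding cube_scale using assms by (simp add: powr_minus)
qed

lemma pos_cone_iff:
  assumes level: "\<And>q. q \<in> H \<Longrightarrow> T q q q = 1"
  shows "z \<in> pos_cone H \<longleftrightarrow> T z z z > 0 \<and> T z z z powr (-1/3) *\<^sub>R z \<in> H"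
proof
  assume "z \<in> pos_cone H"
  then obtain r p where z: "z = r *\<^sub>R p" "r > 0" "p \<in> H" unfolding pos_cone_def by blast
  have Tz: "T z z z = r ^ 3" unfolding z(1) cube_scale level[OF z(3)] by simp
  have "(r ^ 3) powr (-1/3) = (r powr 3) powr (-1/3)" using z(2) by simp
  also have "\<dots> = 1 / r" unfolding powr_powr using z(2) powr_minus_divide[of r 1] by simp
  finally show "T z z z > 0 \<and> T z z z powr (-1/3) *\<^sub>R z \<in> H" using z unfolding Tz by simp
next
  assume z: "T z z z > 0 \<and> T z z z powr (-1/3) *\<^sub>R z \<in> H"
  define r where "r = T z z z powr (-1/3)"
  have "r > 0" using z by (simp add: r_def)
  then have "z = (1 / r) *\<^sub>R (r *\<^sub>R z)" "1 / r > 0" by simp_all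
  then show "z \<in> pos_cone H" using z unfolding pos_cone_def r_def[symmetric] by blast
qed

context
  fixes H :: "'a set"
  assumes hyper: "smooth_hypersurface H" and closedH: "closed H"
    and level: "\<And>q. q \<in> H \<Longrightarrow> T q q q = 1"
begin

text \<open>The radial projection onto the level set identifies the cone with the preimage of
  \<open>H\<close>, which is open and closed in the level set.\<close>

lemma pos_cone_clopen:
  shows "openin (top_of_set {z. T z z z > 0}) (pos_cone H)"
    and "closedin (top_of_set {z. T z z z > 0}) (pos_cone H)"
proof -
  let ?P = "{z. T z z z > 0}"
  let ?N = "\<lambda>z. T z z z powr (-1/3) *\<^sub>R z"
  have contN: "continuous_on ?P ?N"
    by (intro continuous_on_scaleR continuous_on_powr continuous_on_cube continuous_on_const continuous_on_id) auto
  have U: "pos_cone H = ?P \<inter> ?N -` H" using pos_cone_iff[OF level] by blast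
  show "closedin (top_of_set ?P) (pos_cone H)"
    unfolding U by (rule continuous_closedin_preimage[OF contN closedH])
  have "\<forall>p\<in>H. \<exists>\<delta>>0. \<forall>z. dist p z < \<delta> \<and> T z z z = 1 \<longrightarrow> z \<in> H"
    using hypersurface_open_in_level[OF hyper level] by blast
  then obtain \<delta> where \<delta>: "\<And>p. p \<in> H \<Longrightarrow> \<delta> p > 0" "\<And>p z. p \<in> H \<Longrightarrow> dist p z < \<delta> p \<Longrightarrow> T z z z = 1 \<Longrightarrow> z \<in> H"
    by metis
  define V where "V = (\<Union>p\<in>H. ball p (\<delta> p))"
  have openV: "open V" unfolding V_def by blast
  have "pos_cone H = ?P \<inter> ?N -` V"
  proof (rule Set.set_eqI)
    fix z
    have "?N z \<in> H \<longleftrightarrow> ?N z \<in> V" if "T z z z > 0"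
      using \<delta> cube_normalize[OF that] unfolding V_def by force
    then show "z \<in> pos_cone H \<longleftrightarrow> z \<in> ?P \<inter> ?N -` V" unfolding U by blast
  qed
  then show "openin (top_of_set ?P) (pos_cone H)"
    using continuous_openin_preimage_gen[OF contN openV] by (simp only:)
qed

lemma connected_subset_pos_cone:
  assumes "connected S" "S \<subseteq> {z. T z z z > 0}" "S \<inter> pos_cone H \<noteq> {}"
  shows "S \<subseteq> pos_cone H"
proof -
  obtain V where V: "open V" "pos_cone H = {z. T z z z > 0} \<inter> V"
    using pos_cone_clopen(1) unfolding openin_open by blast
  obtain C where C: "closed C" "pos_cone H = {z. T z z z > 0} \<inter> C"
    using pos_cone_clopen(2) unfolding closedin_closed by blast
  have SV: "S \<inter> pos_cone H = S \<inter> V" and SC: "S \<inter> pos_cone H = S \<inter> C"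
    using assms(2) V(2) C(2) by blast+
  have "openin (top_of_set S) (S \<inter> pos_cone H)"
    unfolding SV using V(1) by (rule openin_open_Int)
  moreover have "closedin (top_of_set S) (S \<inter> pos_cone H)"
    unfolding SC using C(1) by (rule closedin_closed_Int)
  ultimately have "S \<inter> pos_cone H = S" using assms(1,3) unfolding connected_clopen by blast
  then show ?thesis by blast
qed

lemma frontier_pos_cone_subset: "frontier (pos_cone H) \<subseteq> {z. T z z z = 0}"
proof
  fix z assume z: "z \<in> frontier (pos_cone H)"
  have openP: "open {z. T z z z > 0}" by (intro open_Collect_less continuous_on_const continuous_on_cube)
  have "open (pos_cone H)"
    using pos_cone_clopen(1) openP openin_open_eq by blast
  then have z': "z \<in> closure (pos_cone H)" "z \<notin> pos_cone H"
    using z unfolding frontier_def by (simp_all add: interior_open)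
  have "closed {z. T z z z \<ge> 0}" by (intro closed_Collect_le continuous_on_const continuous_on_cube)
  moreover have "pos_cone H \<subseteq> {z. T z z z \<ge> 0}" using pos_cone_iff[OF level] by fastforce
  ultimately have "T z z z \<ge> 0" using z'(1) closure_minimal by blast
  moreover have "\<not> T z z z > 0"
  proof
    assume "T z z z > 0"
    moreover obtain C where C: "closed C" "pos_cone H = {z. T z z z > 0} \<inter> C"
      using pos_cone_clopen(2) unfolding closedin_closed by blast
    then have "closure (pos_cone H) \<subseteq> C" by (intro closure_minimal) auto
    ultimately show False using z' C(2) by blast
  qed
  ultimately show "z \<in> {z. T z z z = 0}" by simp
qed

text \<open>Near a zero \<open>q\<close> of the cubic at which \<open>e\<close> is a direction of increase, all
  points where the cubic is positive can be pushed along \<open>e\<close> into a common ball without leaving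
  the positive region. So they can be joined to each other there, and all of them belong to the
  cone once \<open>q\<close> lies in its closure.\<close>

lemma zero_set_subset_frontier:
  assumes q: "q \<in> closure (pos_cone H)" "T q q q = 0" and e: "T q q e > 0"
  shows "\<exists>\<delta>>0. \<forall>z. dist q z < \<delta> \<and> T z z z = 0 \<longrightarrow> z \<in> frontier (pos_cone H)"
proof -
  have "open {z. T z z e > 0}"
    by (intro open_Collect_less continuous_on_const continuous_on_square continuous_on_id)
  then obtain r where r: "r > 0" "ball q r \<subseteq> {z. T z z e > 0}"
    using e unfolding open_contains_ball by blast
  define c where "c = r / (4 * (norm e + 1))"
  have "norm e + 1 > 0" by (intro add_nonneg_pos) auto
  then have c: "c > 0" "c * norm e \<le> r / 4" using r(1) by (auto simp: c_def field_simps)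
  define d where "d = c *\<^sub>R e"
  have in_ball: "z + t *\<^sub>R d \<in> ball q r" if "dist q z < r / 2" "0 \<le> t" "t \<le> 1" for z t
  proof -
    have "dist q (z + t *\<^sub>R d) \<le> dist q z + norm (t *\<^sub>R d)"
      using dist_triangle[of q "z + t *\<^sub>R d" z] by (simp add: dist_norm)
    also have "norm (t *\<^sub>R d) = t * (c * norm e)" using that c(1) by (simp add: d_def)
    also have "\<dots> \<le> 1 * (r / 4)" using that c by (intro mult_mono) auto
    finally show ?thesis using that r(1) by simp
  qed
  have incr: "T z z z < T (z + t *\<^sub>R d) (z + t *\<^sub>R d) (z + t *\<^sub>R d)"
    if z: "dist q z < r / 2" and t: "0 < t" "t \<le> 1" for z t
  proof -
    have "T (z + 0 *\<^sub>R d) (z + 0 *\<^sub>R d) (z + 0 *\<^sub>R d) < T (z + t *\<^sub>R d) (z + t *\<^sub>R d) (z + t *\<^sub>R d)"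
    proof (rule DERIV_pos_imp_increasing[OF t(1)])
      fix x assume x: "0 \<le> x" "x \<le> t"
      have "((\<lambda>t. z + t *\<^sub>R d) has_derivative (\<lambda>t. t *\<^sub>R d)) (at x)"
        by (auto intro!: derivative_eq_intros)
      from has_derivative_compose[OF this has_derivative_cube]
      have "((\<lambda>t. T (z + t *\<^sub>R d) (z + t *\<^sub>R d) (z + t *\<^sub>R d)) has_real_derivative
          3 * T (z + x *\<^sub>R d) (z + x *\<^sub>R d) d) (at x)"
        by (auto simp: scale has_field_derivative_def mult_ac elim!: has_derivative_eq_rhs)
      moreover have "T (z + x *\<^sub>R d) (z + x *\<^sub>R d) d > 0"
      proof -
        have "T (z + x *\<^sub>R d) (z + x *\<^sub>R d) e > 0" using in_ball[OF z x(1)] x t r(2) by force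
        then show ?thesis using c(1) by (subst (3) d_def) (simp add: scale)
      qed
      ultimately show "\<exists>y. ((\<lambda>t. T (z + t *\<^sub>R d) (z + t *\<^sub>R d) (z + t *\<^sub>R d)) has_real_derivative y) (at x) \<and> 0 < y"
        by (intro exI[of _ "3 * T (z + x *\<^sub>R d) (z + x *\<^sub>R d) d"]) simp
    qed
    then show ?thesis by simp
  qed
  have qd: "T (q + d) (q + d) (q + d) > 0" using incr[of q 1] r(1) q(2) by simp
  have "open {z. T z z z > 0}" by (intro open_Collect_less continuous_on_const continuous_on_cube)
  then obtain r2 where r2: "r2 > 0" "ball (q + d) r2 \<subseteq> {z. T z z z > 0}"
    using qd unfolding open_contains_ball by blast
  define \<delta> where "\<delta> = min r2 (r / 2)"
  have \<delta>: "\<delta> > 0" "\<delta> \<le> r2" "\<delta> \<le> r / 2" using r r2 by (auto simp: \<delta>_def)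
  have reach: "closed_segment z (z + d) \<union> ball (q + d) r2 \<subseteq> pos_cone H"
    if z: "dist q z < \<delta>" "T z z z > 0" and U: "z \<in> pos_cone H \<or> q + d \<in> pos_cone H" for z
  proof (rule connected_subset_pos_cone)
    have "z + d \<in> ball (q + d) r2" using z(1) \<delta>(2) by (simp add: dist_norm)
    then have "closed_segment z (z + d) \<inter> ball (q + d) r2 \<noteq> {}" by auto
    then show "connected (closed_segment z (z + d) \<union> ball (q + d) r2)"
      by (intro connected_Un connected_segment) auto
    have "T x x x > 0" if x: "x \<in> closed_segment z (z + d)" for x
    proof -
      obtain t where t: "0 \<le> t" "t \<le> 1" "x = (1 - t) *\<^sub>R z + t *\<^sub>R (z + d)"
        using x unfolding closed_segment_def by blast
      then have xt: "x = z + t *\<^sub>R d" by (simp add: algebra_simps)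
      show ?thesis
        using incr[of z t] z \<delta>(3) t by (cases "t = 0") (auto simp: xt)
    qed
    then show "closed_segment z (z + d) \<union> ball (q + d) r2 \<subseteq> {z. T z z z > 0}" using r2(2) by blast
    have "q + d \<in> ball (q + d) r2" using r2(1) by simp
    then show "(closed_segment z (z + d) \<union> ball (q + d) r2) \<inter> pos_cone H \<noteq> {}"
      using U ends_in_segment(1)[of z "z + d"] by blast
  qed
  have qdU: "q + d \<in> pos_cone H"
  proof -
    obtain z where z: "z \<in> pos_cone H" "dist z q < \<delta>"
      using q(1) \<delta>(1) unfolding closure_approachable by blast
    then have "T z z z > 0" using pos_cone_iff[OF level] by blast
    then have "ball (q + d) r2 \<subseteq> pos_cone H" using reach[of z] z by (simp add: dist_commute)
    then show ?thesis using r2(1) by auto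
  qed
  have near: "z \<in> pos_cone H" if "dist q z < \<delta>" "T z z z > 0" for z
    using reach[OF that] qdU by auto
  have "z \<in> frontier (pos_cone H)" if z: "dist q z < \<delta>" "T z z z = 0" for z
  proof -
    have "z \<notin> pos_cone H" using pos_cone_iff[OF level] z(2) by fastforce
    then have "z \<notin> interior (pos_cone H)" using interior_subset by blast
    moreover have "z \<in> closure (pos_cone H)"
      unfolding closure_approachable
    proof (intro allI impI)
      fix \<epsilon> :: real assume "\<epsilon> > 0"
      define \<kappa> where "\<kappa> = min \<epsilon> (\<delta> - dist q z)"
      have \<kappa>: "\<kappa> > 0" using \<open>\<epsilon> > 0\<close> z(1) by (simp add: \<kappa>_def)
      define t where "t = min 1 (\<kappa> / (2 * (norm d + 1)))"
      have n: "norm d + 1 > 0" by (intro add_nonneg_pos) auto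
      have t: "0 < t" "t \<le> 1" using \<kappa> n by (simp_all add: t_def)
      have "t \<le> \<kappa> / (2 * (norm d + 1))" by (simp add: t_def)
      then have "t * (norm d + 1) \<le> \<kappa> / 2" using n by (simp add: field_simps)
      then have "norm (t *\<^sub>R d) < \<kappa>" using t \<kappa> by (simp add: distrib_left)
      then have "dist (z + t *\<^sub>R d) z < \<epsilon>" "dist q (z + t *\<^sub>R d) < \<delta>"
        using dist_triangle[of q "z + t *\<^sub>R d" z] by (auto simp: \<kappa>_def dist_norm)
      moreover have "T (z + t *\<^sub>R d) (z + t *\<^sub>R d) (z + t *\<^sub>R d) > 0"
        using incr[of z t] z \<delta>(3) t by simp
      ultimately show "\<exists>y\<in>pos_cone H. dist y z < \<epsilon>" using near by blast
    qed
    ultimately show ?thesis by (simp add: frontier_def)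
  qed
  then show ?thesis using \<delta>(1) by blast
qed

lemma tangent_space_level:
  assumes "v \<in> tangent_space M p" and "\<And>z. z \<in> M \<Longrightarrow> T z z z = a"
  shows "T p p v = 0"
proof -
  obtain \<epsilon> c where "\<epsilon> > 0" and c: "c ` {-\<epsilon><..<\<epsilon>} \<subseteq> M" "c 0 = p" "(c has_vector_derivative v) (at (0::real))"
    using assms(1) unfolding tangent_space_def by blast
  have "((\<lambda>t. T (c t) (c t) (c t)) has_derivative (\<lambda>t. 3 * T p p (t *\<^sub>R v))) (at 0)"
    using has_derivative_compose[OF c(3)[unfolded has_vector_derivative_def] has_derivative_cube] c(2) by simp
  moreover have "((\<lambda>t. T (c t) (c t) (c t)) has_derivative (\<lambda>t. 0)) (at 0)"
  proof (rule has_derivative_transform_within_open[OF has_derivative_const[of a]])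
    show "open {-\<epsilon><..<\<epsilon>}" "0 \<in> {-\<epsilon><..<\<epsilon>}" using \<open>\<epsilon> > 0\<close> by auto
    show "a = T (c t) (c t) (c t)" if "t \<in> {-\<epsilon><..<\<epsilon>}" for t using c(1) assms(2) that by blast
  qed
  ultimately have "(\<lambda>t. 3 * T p p (t *\<^sub>R v)) = (\<lambda>t. 0)" by (rule has_derivative_unique)
  from fun_cong[OF this, of 1] show ?thesis by simp
qed

lemma tangent_space_frontier:
  assumes q: "q \<in> frontier (pos_cone H)" and "T q q e \<noteq> 0"
  shows "tangent_space (frontier (pos_cone H) - {0}) q = {u. T q q u = 0}"
proof (rule subset_antisym)
  have Tq: "T q q q = 0" using q frontier_pos_cone_subset by blast
  show "tangent_space (frontier (pos_cone H) - {0}) q \<subseteq> {u. T q q u = 0}"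
    using tangent_space_level[of _ "frontier (pos_cone H) - {0}" q 0] frontier_pos_cone_subset by blast
  obtain e' where e': "T q q e' > 0"
    using assms(2) that[of e] that[of "-e"] by (cases "T q q e > 0") (auto simp: neg)
  have q0: "norm q > 0" using assms(2) by (auto simp: zero)
  have "q \<in> closure (pos_cone H)" using q by (simp add: frontier_def)
  from zero_set_subset_frontier[OF this Tq e'] obtain \<delta> where \<delta>: "\<delta> > 0"
    "\<And>z. dist q z < \<delta> \<Longrightarrow> T z z z = 0 \<Longrightarrow> z \<in> frontier (pos_cone H)" by blast
  show "{u. T q q u = 0} \<subseteq> tangent_space (frontier (pos_cone H) - {0}) q"
  proof
    fix u assume "u \<in> {u. T q q u = 0}"
    then have u: "T q q u = 0" by simp
    obtain \<epsilon> c where c: "\<epsilon> > 0" "smooth_on {-\<epsilon><..<\<epsilon>} c" "c 0 = q" "(c has_vector_derivative u) (at 0)"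
      "\<And>t. t \<in> {-\<epsilon><..<\<epsilon>} \<Longrightarrow> T (c t) (c t) (c t) = 0 \<and> dist q (c t) < min \<delta> (norm q)"
      using implicit_curve[OF Tq e' u, of "min \<delta> (norm q)"] \<delta>(1) q0 by auto
    have "c t \<in> frontier (pos_cone H) - {0}" if "t \<in> {-\<epsilon><..<\<epsilon>}" for t
    proof -
      have "T (c t) (c t) (c t) = 0" "dist q (c t) < \<delta>" "dist q (c t) < norm q"
        using c(5)[OF that] by simp_all
      moreover from this(3) have "c t \<noteq> 0" by (metis dist_0_norm dist_commute less_irrefl)
      ultimately show ?thesis using \<delta>(2) by blast
    qed
    then have "c ` {-\<epsilon><..<\<epsilon>} \<subseteq> frontier (pos_cone H) - {0}" by (rule image_subsetI)
    then show "u \<in> tangent_space (frontier (pos_cone H) - {0}) q"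
      unfolding tangent_space_def mem_Collect_eq using c(1-4)
      by (intro exI[of _ \<epsilon>] exI[of _ c] conjI)
  qed
qed

text \<open>Regular boundary behaviour makes \<open>T q\<close> negative semidefinite on the tangent
  hyperplane of the cone at the end point \<open>q\<close> of the segment, with a kernel of dimension one.
  By homogeneity \<open>q\<close> lies in the kernel, so \<open>T q\<close> is negative off the line through
  \<open>q\<close>. The segment meets the boundary transversally: otherwise the leading term of the
  expansion at \<open>q - t v\<close> would be negative, whereas the cubic is positive before \<open>q\<close>.\<close>

lemma regular_end_point:
  assumes reg: "regular_boundary_behaviour (\<lambda>x. T x x x) H"
    and p: "p \<in> H" and v: "v \<in> tangent_space H p" "v \<noteq> 0"
    and R: "0 < R" "T (p + R *\<^sub>R v) (p + R *\<^sub>R v) (p + R *\<^sub>R v) = 0"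
    and pos: "\<And>t. 0 \<le> t \<Longrightarrow> t < R \<Longrightarrow> T (p + t *\<^sub>R v) (p + t *\<^sub>R v) (p + t *\<^sub>R v) > 0"
    and q: "q = p + R *\<^sub>R v"
  shows "q \<noteq> 0" and "T q q v < 0"
    and "\<And>w. T q q w = 0 \<Longrightarrow> w \<notin> span {q} \<Longrightarrow> T q w w < 0"
proof -
  have hp: "T p p p = 1" by (rule level[OF p])
  have pv: "T p p v = 0" using tangent_space_level[OF v(1), of 1] level by blast
  have Tq: "T q q q = 0" using R(2) q by simp
  show q0: "q \<noteq> 0"
  proof
    assume "q = 0"
    then have "p = - (R *\<^sub>R v)" using q by (simp add: eq_neg_iff_add_eq_0)
    then have "T p p p = T p p (- (R *\<^sub>R v))" by (rule arg_cong)
    then show False using hp pv by (simp add: neg scale)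
  qed
  have v_span: "v \<notin> span {q}"
  proof
    assume "v \<in> span {q}"
    then obtain c where c: "v = c *\<^sub>R q" unfolding span_singleton by blast
    then have "T p p v = c * T p p q" by (simp add: scale)
    also have "T p p q = 1" by (simp add: q add scale hp pv)
    finally show False using pv c v(2) by simp
  qed
  have qv: "q - t *\<^sub>R v = p + (R - t) *\<^sub>R v" for t by (simp add: q algebra_simps)
  have "(\<lambda>t. p + t *\<^sub>R v) ` {0..<R} \<subseteq> pos_cone H"
  proof (rule connected_subset_pos_cone)
    show "connected ((\<lambda>t. p + t *\<^sub>R v) ` {0..<R})"
      by (intro connected_continuous_image continuous_intros) (simp add: is_interval_connected)
    show "(\<lambda>t. p + t *\<^sub>R v) ` {0..<R} \<subseteq> {z. T z z z > 0}" using pos by auto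
    have "p \<in> pos_cone H" using p unfolding pos_cone_def by (auto intro!: exI[of _ 1])
    then show "(\<lambda>t. p + t *\<^sub>R v) ` {0..<R} \<inter> pos_cone H \<noteq> {}"
      using R(1) by (auto intro!: exI[of _ p] image_eqI[of _ _ 0])
  qed
  then have ray: "p + t *\<^sub>R v \<in> pos_cone H" if "0 \<le> t" "t < R" for t
    using that by (simp add: image_subset_iff)
  have "q \<in> closure (pos_cone H)"
    unfolding closure_approachable
  proof (intro allI impI)
    fix \<epsilon> :: real assume "\<epsilon> > 0"
    define t where "t = min R (\<epsilon> / (2 * norm v))"
    have t: "0 < t" "t \<le> R" using R(1) \<open>\<epsilon> > 0\<close> v(2) by (auto simp: t_def)
    have "t \<le> \<epsilon> / (2 * norm v)" by (simp add: t_def)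
    then have "t * norm v \<le> \<epsilon> / 2" using v(2) by (simp add: field_simps)
    then have "dist (q - t *\<^sub>R v) q < \<epsilon>" using t \<open>\<epsilon> > 0\<close> by (simp add: dist_norm)
    moreover have "q - t *\<^sub>R v \<in> pos_cone H" unfolding qv using t by (intro ray) auto
    ultimately show "\<exists>y\<in>pos_cone H. dist y q < \<epsilon>" by blast
  qed
  moreover have "q \<notin> pos_cone H" using pos_cone_iff[OF level, of H q] Tq by simp
  then have "q \<notin> interior (pos_cone H)" using interior_subset by blast
  ultimately have qF: "q \<in> frontier (pos_cone H)" by (simp add: frontier_def)
  have "frechet_derivative (\<lambda>x. T x x x) (at q) \<noteq> (\<lambda>_. 0)"
    using reg qF q0 unfolding regular_boundary_behaviour_def singular_at_infinity_def by blast
  then obtain e where "T q q e \<noteq> 0" unfolding frechet_derivative_cube by force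
  note tan = tangent_space_frontier[OF qF this]
  \<comment> \<open>the kernel that regular boundary behaviour requires to be a line; by homogeneity it contains \<open>q\<close>\<close>
  define N where "N = {w. T q q w = 0 \<and> (\<forall>u. T q q u = 0 \<longrightarrow> T q w u = 0)}"
  have "q \<in> frontier (pos_cone H) - {0}" using qF q0 by simp
  with reg have "(\<forall>v\<in>{u. T q q u = 0}. - (6 * T q v v) \<ge> 0) \<and>
      dim {v \<in> {u. T q q u = 0}. \<forall>u\<in>{u. T q q u = 0}. - (6 * T q v u) = 0} = 1"
    unfolding regular_boundary_behaviour_def Let_def hessian_cube tan[symmetric] by (elim conjE bspec)
  then have semi: "\<forall>v\<in>{u. T q q u = 0}. - (6 * T q v v) \<ge> 0"
    and "dim {v \<in> {u. T q q u = 0}. \<forall>u\<in>{u. T q q u = 0}. - (6 * T q v u) = 0} = 1" by simp_all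
  moreover have "N = {v \<in> {u. T q q u = 0}. \<forall>u\<in>{u. T q q u = 0}. - (6 * T q v u) = 0}"
    by (auto simp: N_def)
  ultimately have dimN: "dim N = 1" by simp
  have semi: "T q w w \<le> 0" if "T q q w = 0" for w using semi that by auto
  have "q \<in> N" using Tq by (simp add: N_def)
  have subN: "subspace N" unfolding N_def subspace_def by (auto simp: add scale zero)
  have N: "N = span {q}"
  proof -
    have "span {q} \<subseteq> N" using \<open>q \<in> N\<close> subN by (intro span_minimal) auto
    moreover have "dim (span {q}) = 1" using q0 by (simp add: dim_insert)
    ultimately show ?thesis
      using subspace_dim_equal[of "span {q}" N] subN dimN by (simp add: subspace_span)
  qed
  show neg_def: "T q w w < 0" if w: "T q q w = 0" "w \<notin> span {q}" for w
  proof (rule ccontr)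
    assume "\<not> T q w w < 0"
    then have ww: "T q w w = 0" using semi[OF w(1)] by simp
    \<comment> \<open>a null vector of a semidefinite form lies in its kernel\<close>
    have "T q w u = 0" if u: "T q q u = 0" for u
    proof -
      have *: "2 * t * T q w u + T q u u \<le> 0" for t
      proof -
        have "T q q (u + t *\<^sub>R w) = 0" using u w(1) by (simp add: add scale)
        from semi[OF this] show ?thesis
          using ww swap_23[of q u w] by (simp add: add scale)
      qed
      show ?thesis
      proof (rule ccontr)
        assume "T q w u \<noteq> 0"
        then have "2 * ((1 - T q u u) / (2 * T q w u)) * T q w u = 1 - T q u u" by simp
        then show False using *[of "(1 - T q u u) / (2 * T q w u)"] by linarith
      qed
    qed
    then have "w \<in> N" using w(1) by (simp add: N_def)
    then show False using w(2) N by simp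
  qed
  have exp: "T (q - t *\<^sub>R v) (q - t *\<^sub>R v) (q - t *\<^sub>R v) = t * (- 3 * T q q v + 3 * t * T q v v - t\<^sup>2 * T v v v)" for t
    using cube_add[of q "- (t *\<^sub>R v)"] Tq
    by (simp add: neg scale power2_eq_square algebra_simps)
  have quad: "- 3 * T q q v + 3 * t * T q v v - t\<^sup>2 * T v v v > 0" if "0 < t" "t \<le> R" for t
    using pos[of "R - t"] that exp[of t] unfolding qv by (simp add: zero_less_mult_iff)
  have ev: "eventually (\<lambda>t. 0 < t \<and> t \<le> R) (at_right 0)"
    using R(1) eventually_at_right[of 0 R] by (metis (mono_tags, lifting) less_eq_real_def)
  have lim1: "((\<lambda>t. - 3 * T q q v + 3 * t * T q v v - t\<^sup>2 * T v v v) \<longlongrightarrow>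
      - 3 * T q q v + 3 * 0 * T q v v - 0\<^sup>2 * T v v v) (at_right 0)" by (intro tendsto_intros)
  have "0 \<le> - 3 * T q q v + 3 * 0 * T q v v - 0\<^sup>2 * T v v v"
    by (rule tendsto_lowerbound[OF lim1]) (use ev in \<open>eventually_elim, use quad in force\<close>, simp)
  then have "T q q v \<le> 0" by simp
  moreover have "T q q v \<noteq> 0"
  proof
    assume z: "T q q v = 0"
    have pos3: "3 * T q v v - t * T v v v > 0" if "0 < t" "t \<le> R" for t
    proof -
      have "t * (3 * T q v v - t * T v v v) > 0"
        using quad[OF that] z by (simp add: power2_eq_square algebra_simps)
      then show ?thesis using that(1) by (simp add: zero_less_mult_iff)
    qed
    have ev2: "eventually (\<lambda>t. 0 \<le> 3 * T q v v - t * T v v v) (at_right 0)"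
      using ev by eventually_elim (use pos3 in force)
    have "((\<lambda>t. 3 * T q v v - t * T v v v) \<longlongrightarrow> 3 * T q v v - 0 * T v v v) (at_right 0)"
      by (intro tendsto_intros)
    from tendsto_lowerbound[OF this ev2] have "0 \<le> T q v v" by simp
    then show False using neg_def[OF z v_span] by simp
  qed
  ultimately show "T q q v < 0" by simp
qed

end

end

section \<open>Limits of cubics in standard form\<close>

text \<open>Comparing powers of \<open>x\<close> in \<open>x\<^sup>3 - x |y|\<^sup>2 + P y\<close>: the standard form prescribes
  exactly the values of the polarization that have \<open>(1, 0)\<close> as an argument.\<close>
lemma standard_form_polar:
  fixes S :: "real \<times> 'b::euclidean_space \<Rightarrow> real \<times> 'b \<Rightarrow> real \<times> 'b \<Rightarrow> real"
  assumes S: "sym_trilinear S" and std: "standard_form (\<lambda>x. S x x x)"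
  shows "S (1, 0) (1, 0) (1, 0) = 1" "S (1, 0) (1, 0) (0, y) = 0"
    "S (1, 0) (0, y) (0, y) = - (y \<bullet> y) / 3"
    "S (1, 0) (1, 0) z = fst z" "S (1, 0) z z = (fst z)\<^sup>2 - (snd z \<bullet> snd z) / 3"
proof -
  interpret sym_trilinear S by (rule S)
  obtain P where P: "\<And>x y. S (x, y) (x, y) (x, y) = x ^ 3 - x * (y \<bullet> y) + P y"
    using std unfolding standard_form_def by blast
  let ?e = "(1, 0) :: real \<times> 'b"
  have exp: "c ^ 3 * S ?e ?e ?e + 3 * c\<^sup>2 * S ?e ?e (0, y) + 3 * c * S ?e (0, y) (0, y) = c ^ 3 - c * (y \<bullet> y)" for c y
  proof -
    have "S (c *\<^sub>R ?e + (0, y)) (c *\<^sub>R ?e + (0, y)) (c *\<^sub>R ?e + (0, y)) = c ^ 3 - c * (y \<bullet> y) + P y"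
      using P[of c y] by simp
    moreover have "S (0, y) (0, y) (0, y) = P y" using P[of 0 y] by simp
    ultimately show ?thesis
      unfolding cube_add scale real_scaleR_def by (simp add: power2_eq_square power3_eq_cube)
  qed
  have *: "S ?e ?e ?e = 1" "S ?e ?e (0, y) = 0" "S ?e (0, y) (0, y) = - (y \<bullet> y) / 3" for y
  proof -
    have "S ?e ?e ?e + 3 * S ?e ?e (0, y) + 3 * S ?e (0, y) (0, y) = 1 - y \<bullet> y"
      "- S ?e ?e ?e + 3 * S ?e ?e (0, y) - 3 * S ?e (0, y) (0, y) = - 1 + y \<bullet> y"
      "8 * S ?e ?e ?e + 12 * S ?e ?e (0, y) + 6 * S ?e (0, y) (0, y) = 8 - 2 * (y \<bullet> y)"
      using exp[of 1 y] exp[of "-1" y] exp[of 2 y] by simp_all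
    then show "S ?e ?e ?e = 1" "S ?e ?e (0, y) = 0" "S ?e (0, y) (0, y) = - (y \<bullet> y) / 3"
      by linarith+
  qed
  then show "S ?e ?e ?e = 1" "S ?e ?e (0, y) = 0" "S ?e (0, y) (0, y) = - (y \<bullet> y) / 3" by blast+
  have z: "z = fst z *\<^sub>R ?e + (0, snd z)" by (simp add: prod_eq_iff)
  show "S ?e ?e z = fst z" by (subst z) (simp only: add scale * real_scaleR_def; simp)
  have "S ?e (0, snd z) ?e = 0" using swap_23[of ?e "(0, snd z)" ?e] * by simp
  then have "S ?e (fst z *\<^sub>R ?e + (0, snd z)) (fst z *\<^sub>R ?e + (0, snd z)) = (fst z)\<^sup>2 - (snd z \<bullet> snd z) / 3"
    by (simp only: add scale * real_scaleR_def) (simp add: power2_eq_square)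
  then show "S ?e z z = (fst z)\<^sup>2 - (snd z \<bullet> snd z) / 3" unfolding z[symmetric] .
qed

lemma trilinear_difference_bound:
  assumes "sym_trilinear T" "sym_trilinear S"
  shows "\<bar>T x y z - S x y z\<bar>
    \<le> (\<Sum>i\<in>Basis. \<Sum>j\<in>Basis. \<Sum>k\<in>Basis. \<bar>T i j k - S i j k\<bar>) * (norm x * norm y * norm z)"
proof -
  let ?d = "\<lambda>i j k. T i j k - S i j k"
  have eq: "T x y z - S x y z
      = (\<Sum>i\<in>Basis. \<Sum>j\<in>Basis. \<Sum>k\<in>Basis. ?d i j k * ((x \<bullet> i) * (y \<bullet> j) * (z \<bullet> k)))"
    unfolding sym_trilinear.expand[OF assms(1), of x y z] sym_trilinear.expand[OF assms(2), of x y z]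
    by (simp add: sum_subtractf left_diff_distrib mult.assoc)
  have "\<bar>T x y z - S x y z\<bar> \<le> (\<Sum>i\<in>Basis. \<Sum>j\<in>Basis. \<Sum>k\<in>Basis. \<bar>?d i j k\<bar> * (norm x * norm y * norm z))"
    unfolding eq
  proof (intro order_trans[OF sum_abs] sum_mono)
    fix i j k :: 'a assume b: "i \<in> Basis" "j \<in> Basis" "k \<in> Basis"
    show "\<bar>?d i j k * ((x \<bullet> i) * (y \<bullet> j) * (z \<bullet> k))\<bar> \<le> \<bar>?d i j k\<bar> * (norm x * norm y * norm z)"
      unfolding abs_mult using b by (intro mult_left_mono mult_mono Basis_le_norm) auto
  qed
  then show ?thesis by (simp add: sum_distrib_right)
qed

text \<open>Once the base point \<open>(1, 0)\<close> is fixed, the standard form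
  \<open>x\<^sup>3 - x |y|\<^sup>2 + P y\<close> determines the coordinate change up to the orthogonal group. If the forms \<open>T k\<close> converge to a form of this kind and
  \<open>T k \<circ> C k\<close> is of this kind as well, the maps \<open>C k\<close> are bounded: the
  Lorentzian form \<open>T k (1, 0)\<close> controls the length of \<open>C k (0, y)\<close>. Every limit
  of a subsequence preserves \<open>(1, 0)\<close> and the norm.\<close>

lemma standard_form_limit:
  fixes S :: "real \<times> 'b::euclidean_space \<Rightarrow> real \<times> 'b \<Rightarrow> real \<times> 'b \<Rightarrow> real"
    and C :: "nat \<Rightarrow> real \<times> 'b \<Rightarrow> real \<times> 'b"
  assumes T: "\<And>k :: nat. sym_trilinear (T k)" and S: "sym_trilinear S"
    and lim: "\<And>x y z. (\<lambda>k. T k x y z) \<longlonglongrightarrow> S x y z" and stdS: "standard_form (\<lambda>x. S x x x)"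
    and C: "\<And>k. linear (C k)" "\<And>k. C k (1, 0) = \<kappa> k *\<^sub>R (1, 0)" and \<kappa>: "\<kappa> \<longlonglongrightarrow> 1"
    and stdC: "\<And>k. standard_form (\<lambda>x. T k (C k x) (C k x) (C k x))"
    and h': "\<And>z. (\<lambda>k. T k (C k z) (C k z) (C k z)) \<longlonglongrightarrow> h' z"
  shows "\<exists>D. orthogonal_transformation D \<and> D (1, 0) = (1, 0) \<and> h' = (\<lambda>x. S (D x) (D x) (D x))"
proof -
  let ?e = "(1, 0) :: real \<times> 'b"
  define \<delta> where "\<delta> k = (\<Sum>i\<in>Basis. \<Sum>j\<in>Basis. \<Sum>l\<in>Basis. \<bar>T k i j l - S i j l\<bar>)" for k
  have diff: "\<bar>T k x y z - S x y z\<bar> \<le> \<delta> k * (norm x * norm y * norm z)" for k x y z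
    unfolding \<delta>_def by (rule trilinear_difference_bound[OF T S])
  have "\<delta> \<longlonglongrightarrow> (\<Sum>i\<in>Basis. \<Sum>j\<in>Basis. \<Sum>l\<in>Basis. \<bar>S i j l - S i j l\<bar>)"
    unfolding \<delta>_def by (intro tendsto_intros lim)
  then have \<delta>0: "\<delta> \<longlonglongrightarrow> 0" by simp
  \<comment> \<open>for \<open>\<delta> k \<le> 1/8\<close> the estimate of \<open>n = norm (C k (0, y))\<close> below reads
    \<open>n\<^sup>2 \<le> (1/16 + 3/8) n\<^sup>2 + 2 |y|\<^sup>2\<close>, which bounds \<open>n\<close>\<close>
  have "eventually (\<lambda>k. \<delta> k < 1/8 \<and> 1/2 < \<kappa> k \<and> \<kappa> k < 2) sequentially"
    by (intro eventually_conj order_tendstoD(2)[OF \<delta>0] order_tendstoD[OF \<kappa>]) auto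
  then obtain N where N: "\<And>k. k \<ge> N \<Longrightarrow> \<delta> k < 1/8 \<and> 1/2 < \<kappa> k \<and> \<kappa> k < 2"
    unfolding eventually_sequentially by blast
  have polar: "T k ?e ?e (C k (0, y)) = 0" "T k ?e (C k (0, y)) (C k (0, y)) = - (y \<bullet> y) / (3 * \<kappa> k)"
    if "k \<ge> N" for k y
  proof -
    have "\<kappa> k \<noteq> 0" using N[OF that] by auto
    moreover have "T k (C k ?e) (C k ?e) (C k (0, y)) = 0"
      "T k (C k ?e) (C k (0, y)) (C k (0, y)) = - (y \<bullet> y) / 3"
      using standard_form_polar(2,3)[OF sym_trilinear.compose_linear[OF T C(1)] stdC] by blast+
    ultimately show "T k ?e ?e (C k (0, y)) = 0" "T k ?e (C k (0, y)) (C k (0, y)) = - (y \<bullet> y) / (3 * \<kappa> k)"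
      unfolding C(2) by (simp_all only: sym_trilinear.scale[OF T]) (simp_all add: field_simps)
  qed
  have bound0: "norm (C k (0, y)) \<le> 2 * norm y" if k: "k \<ge> N" for k y
  proof -
    define z where "z = C k (0, y)"
    define n where "n = norm z"
    have dk: "0 \<le> \<delta> k" "\<delta> k \<le> 1/8" "\<kappa> k > 1/2"
      using N[OF k] by (auto simp: \<delta>_def intro!: sum_nonneg)
    have n1: "norm ?e = 1" by (simp add: norm_Pair)
    have nn: "n\<^sup>2 = (fst z)\<^sup>2 + snd z \<bullet> snd z"
      unfolding n_def power2_norm_eq_inner by (simp add: inner_prod_def power2_eq_square)
    have "\<bar>fst z\<bar> \<le> \<delta> k * n"
      using diff[of k ?e ?e z] polar(1)[OF k, of y] standard_form_polar(4)[OF S stdS, of z]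
      by (simp add: z_def[symmetric] n1 n_def)
    also have "\<dots> \<le> 1/8 * n" using dk by (intro mult_right_mono) (auto simp: n_def)
    finally have "\<bar>fst z\<bar>\<^sup>2 \<le> (1/8 * n)\<^sup>2" by (intro power_mono) auto
    then have f: "(fst z)\<^sup>2 \<le> 1/64 * n\<^sup>2" by (simp add: power_mult_distrib power_divide)
    have "- (y \<bullet> y) / (3 * \<kappa> k) - ((fst z)\<^sup>2 - (snd z \<bullet> snd z) / 3) \<le> \<delta> k * n\<^sup>2"
      using diff[of k ?e z z] polar(2)[OF k, of y] standard_form_polar(5)[OF S stdS, of z]
      by (simp add: z_def[symmetric] n1 n_def power2_eq_square)
    also have "\<dots> \<le> 1/8 * n\<^sup>2" using dk by (intro mult_right_mono) auto
    finally have "snd z \<bullet> snd z \<le> 3 * (fst z)\<^sup>2 + 3/8 * n\<^sup>2 + (y \<bullet> y) / \<kappa> k" by (simp add: field_simps)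
    moreover have "(y \<bullet> y) / \<kappa> k \<le> 2 * (y \<bullet> y)"
    proof -
      have "y \<bullet> y * 1 \<le> y \<bullet> y * (2 * \<kappa> k)" using dk(3) by (intro mult_left_mono) auto
      then show ?thesis using dk(3) by (simp add: field_simps)
    qed
    ultimately have "n\<^sup>2 \<le> 4 * (y \<bullet> y)" using f nn inner_ge_zero[of y] by linarith
    then have "n\<^sup>2 \<le> (2 * norm y)\<^sup>2" by (simp add: power_mult_distrib power2_norm_eq_inner)
    then show ?thesis unfolding n_def z_def by (rule power2_le_imp_le) simp
  qed
  have bound: "norm (C k x) \<le> 4 * norm x" if k: "k \<ge> N" for k x
  proof -
    have "x = fst x *\<^sub>R ?e + (0, snd x)" by (simp add: prod_eq_iff)
    then have "C k x = C k (fst x *\<^sub>R ?e + (0, snd x))" by (rule arg_cong)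
    also have "\<dots> = fst x *\<^sub>R (\<kappa> k *\<^sub>R ?e) + C k (0, snd x)"
      by (simp only: linear_add[OF C(1)] linear_cmul[OF C(1)] C(2))
    finally have "norm (C k x) \<le> norm (fst x *\<^sub>R (\<kappa> k *\<^sub>R ?e)) + norm (C k (0, snd x))"
      by (metis norm_triangle_ineq)
    also have "norm (fst x *\<^sub>R (\<kappa> k *\<^sub>R ?e)) = \<bar>fst x\<bar> * \<bar>\<kappa> k\<bar>" by (simp add: norm_Pair abs_mult)
    also have "\<dots> \<le> \<bar>fst x\<bar> * 2" using N[OF k] by (intro mult_left_mono) auto
    also have "\<dots> \<le> norm x * 2" using norm_fst_le[of "fst x" "snd x"] by simp
    also have "norm (C k (0, snd x)) \<le> 2 * norm x"
      using bound0[OF k, of "snd x"] norm_snd_le[of "snd x" "fst x"] by simp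
    finally show ?thesis by simp
  qed
  define B where "B k = Blinfun (C (k + N))" for k
  have B: "blinfun_apply (B k) = C (k + N)" for k
    unfolding B_def using C(1) by (intro bounded_linear_Blinfun_apply) (simp add: linear_conv_bounded_linear)
  have "norm (B k) \<le> 4" for k
    by (rule norm_blinfun_bound) (use bound in \<open>simp_all add: B\<close>)
  then have "bounded (range B)" unfolding bounded_iff by blast
  from bounded_imp_convergent_subsequence[OF this]
  obtain L r where r: "strict_mono r" "(B \<circ> r) \<longlonglongrightarrow> L" by blast
  define \<sigma> where "\<sigma> k = r k + N" for k
  define D where "D = blinfun_apply L"
  have \<sigma>: "strict_mono \<sigma>" using r(1) unfolding \<sigma>_def strict_mono_def by auto
  have CD: "(\<lambda>k. C (\<sigma> k) x) \<longlonglongrightarrow> D x" for x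
    using blinfun.tendsto[OF r(2) tendsto_const[of x]] by (simp add: o_def B \<sigma>_def D_def)
  have linD: "linear D" unfolding D_def by (simp add: blinfun.bounded_linear_right bounded_linear.linear)
  have sub: "(\<lambda>k. f (\<sigma> k)) \<longlonglongrightarrow> l" if "f \<longlonglongrightarrow> l" for f :: "nat \<Rightarrow> real" and l
    using LIMSEQ_subseq_LIMSEQ[OF that \<sigma>] by (simp add: o_def)
  have limT: "(\<lambda>k. T (\<sigma> k) (X k) (Y k) (Z k)) \<longlonglongrightarrow> S x y z"
    if "X \<longlonglongrightarrow> x" "Y \<longlonglongrightarrow> y" "Z \<longlonglongrightarrow> z" for X Y Z x y z
    using tendsto_sym_trilinear[OF T S sub[OF lim] that] .
  have "h' z = S (D z) (D z) (D z)" for z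
    using LIMSEQ_unique[OF sub[OF h'] limT[OF CD CD CD]] .
  moreover have De: "D ?e = ?e"
  proof -
    have "(\<lambda>k. \<kappa> (\<sigma> k) *\<^sub>R ?e) \<longlonglongrightarrow> 1 *\<^sub>R ?e" by (intro tendsto_intros sub \<kappa>)
    then show ?thesis using LIMSEQ_unique[OF CD[of ?e]] unfolding C(2) by simp
  qed
  moreover have "orthogonal_transformation D"
    unfolding orthogonal_transformation
  proof (intro conjI allI linD)
    have \<sigma>N: "\<sigma> k \<ge> N" for k by (simp add: \<sigma>_def)
    have D0: "fst (D (0, y)) = 0" "snd (D (0, y)) \<bullet> snd (D (0, y)) = y \<bullet> y" for y
    proof -
      have "S ?e ?e (D (0, y)) = 0"
        using LIMSEQ_unique[OF limT[OF tendsto_const tendsto_const CD, of ?e ?e "(0, y)"]]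
        by (simp add: polar(1)[OF \<sigma>N])
      then show f: "fst (D (0, y)) = 0" using standard_form_polar(4)[OF S stdS] by simp
      have "(\<lambda>k. - (y \<bullet> y) / (3 * \<kappa> (\<sigma> k))) \<longlonglongrightarrow> - (y \<bullet> y) / (3 * 1)"
        by (intro tendsto_intros sub \<kappa>) simp
      then have "S ?e (D (0, y)) (D (0, y)) = - (y \<bullet> y) / (3 * 1)"
        using LIMSEQ_unique[OF limT[OF tendsto_const CD CD, of ?e "(0, y)" "(0, y)"]]
        by (simp add: polar(2)[OF \<sigma>N])
      then show "snd (D (0, y)) \<bullet> snd (D (0, y)) = y \<bullet> y"
        using standard_form_polar(5)[OF S stdS] f by simp
    qed
    fix x :: "real \<times> 'b"
    have "x = fst x *\<^sub>R ?e + (0, snd x)" by (simp add: prod_eq_iff)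
    then have "D x = D (fst x *\<^sub>R ?e + (0, snd x))" by (rule arg_cong)
    also have "\<dots> = fst x *\<^sub>R ?e + D (0, snd x)"
      by (simp only: linear_add[OF linD] linear_cmul[OF linD] De)
    finally have "D x \<bullet> D x = x \<bullet> x" using D0[of "snd x"] by (simp add: inner_prod_def)
    then show "norm (D x) = norm x" by (simp add: norm_eq_sqrt_inner)
  qed
  ultimately show ?thesis by blast
qed

section \<open>Blowing up a boundary point\<close>

lemma dim_kernel_inter:
  fixes \<phi> :: "'a::euclidean_space \<Rightarrow> real"
  assumes "linear \<phi>" "\<phi> e \<noteq> 0" "\<phi> q = 0" "q \<noteq> 0"
  shows "dim {w. \<phi> w = 0 \<and> q \<bullet> w = 0} + 2 = DIM('a)"
proof -
  define a where "a = (\<Sum>i\<in>Basis. \<phi> i *\<^sub>R i)"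
  have \<phi>: "\<phi> w = a \<bullet> w" for w
  proof -
    have "\<phi> w = \<phi> (\<Sum>i\<in>Basis. (w \<bullet> i) *\<^sub>R i)" by (simp add: euclidean_representation)
    also have "\<dots> = (\<Sum>i\<in>Basis. (w \<bullet> i) * \<phi> i)"
      by (simp add: linear_sum[OF assms(1)] linear_cmul[OF assms(1)])
    also have "\<dots> = a \<bullet> w"
      unfolding a_def inner_sum_left by (simp add: inner_commute mult.commute)
    finally show ?thesis .
  qed
  have "a \<noteq> 0" using assms(2) unfolding \<phi> by auto
  then have W: "dim {w. \<phi> w = 0} = DIM('a) - 1" unfolding \<phi> by (rule dim_hyperplane)
  have sub: "subspace {w. \<phi> w = 0}" unfolding \<phi> by (rule subspace_hyperplane)
  have "dim {y \<in> {w. \<phi> w = 0}. \<forall>x\<in>span {q}. orthogonal x y} + dim (span {q}) = dim {w. \<phi> w = 0}"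
    using assms(3) sub by (intro dim_subspace_orthogonal_to_vectors span_minimal) (auto simp: subspace_span)
  moreover have "{y \<in> {w. \<phi> w = 0}. \<forall>x\<in>span {q}. orthogonal x y} = {w. \<phi> w = 0 \<and> q \<bullet> w = 0}"
    by (auto simp: span_singleton orthogonal_def intro: exI[of _ 1])
  moreover have "dim (span {q}) = 1" using assms(4) by (simp add: dim_insert)
  moreover have "DIM('a) \<ge> 2"
  proof -
    have "\<not> DIM('a) \<le> 1"
    proof
      assume "DIM('a) \<le> 1"
      then have "dim {w. \<phi> w = 0} = 0" using W by simp
      then show False using assms(3,4) by auto
    qed
    then show ?thesis by simp
  qed
  ultimately show ?thesis using W by simp
qed

text \<open>A complement of \<open>q\<close> in the kernel of \<open>T q q\<close> carries the positive definite form
  \<open>- 3 T q\<close>; its orthonormal frames provide the \<open>s\<close>-directions of the model.\<close>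
lemma boundary_frame:
  fixes T :: "real \<times> (real^'m) \<times> real \<Rightarrow> real \<times> (real^'m) \<times> real \<Rightarrow> real \<times> (real^'m) \<times> real \<Rightarrow> real"
  assumes T: "sym_trilinear T" and q: "T q q q = 0" "q \<noteq> 0" "T q q e \<noteq> 0"
    and definite: "\<And>w. T q q w = 0 \<Longrightarrow> w \<notin> span {q} \<Longrightarrow> T q w w < 0"
  obtains L :: "real^'m \<Rightarrow> real \<times> (real^'m) \<times> real"
  where "linear L" "\<And>s. T q q (L s) = 0" "\<And>s. T q (L s) (L s) = - (s \<bullet> s) / 3"
proof -
  interpret sym_trilinear T by (rule T)
  let ?S = "{w. T q q w = 0 \<and> q \<bullet> w = 0}"
  have dim: "dim ?S = CARD('m)"
    using dim_kernel_inter[OF linear_3[of q q] q(3,1,2)] by simp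
  have sub: "subspace ?S" by (auto simp: subspace_def add scale zero inner_add_right)
  have bil: "bilinear (\<lambda>u w. - 3 * T q u w)"
    unfolding bilinear_def
    by (intro conjI allI linearI) (simp_all only: add scale real_scaleR_def algebra_simps)
  have "w \<notin> span {q}" if "q \<bullet> w = 0" "w \<noteq> 0" for w
    using that q(2) by (auto simp: span_singleton)
  then have pos: "- 3 * T q w w > 0" if "w \<in> ?S" "w \<noteq> 0" for w
    using that definite[of w] by simp
  obtain L :: "real^'m \<Rightarrow> real \<times> (real^'m) \<times> real" where L: "linear L" "range L \<subseteq> ?S"
    "\<And>a b. - 3 * T q (L a) (L b) = a \<bullet> b"
    by (rule orthonormal_frame[OF bil _ sub dim pos]) (auto simp: swap_23[of q])
  show ?thesis
  proof (rule that[OF L(1)])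
    show "T q q (L s) = 0" for s using L(2) by blast
    show "T q (L s) (L s) = - (s \<bullet> s) / 3" for s using L(3)[of s s] by simp
  qed
qed

text \<open>Coordinates adapted to a boundary point \<open>q\<close> and to a transversal direction \<open>e\<close>, with
  weights \<open>-2\<close>, \<open>1\<close> and \<open>4\<close> in \<open>\<mu>\<close> for the three coordinates of the model.
  As \<open>\<mu>\<close> tends to zero they magnify a neighborhood of the ray through \<open>q\<close>.\<close>
definition blow_up ::
  "real \<times> (real^'m) \<times> real \<Rightarrow> (real^'m \<Rightarrow> real \<times> (real^'m) \<times> real) \<Rightarrow> real \<times> (real^'m) \<times> real \<Rightarrow>
    real \<Rightarrow> real \<Rightarrow> real \<times> (real^'m) \<times> real \<Rightarrow> real \<times> (real^'m) \<times> real" where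
  "blow_up q L e c \<mu> z = (ell z / \<mu>\<^sup>2) *\<^sub>R q + \<mu> *\<^sub>R L (svec z) + (\<mu> ^ 4 * emm z / c) *\<^sub>R e"

context
  fixes T :: "real \<times> (real^'m) \<times> real \<Rightarrow> real \<times> (real^'m) \<times> real \<Rightarrow> real \<times> (real^'m) \<times> real \<Rightarrow> real"
    and q e :: "real \<times> (real^'m) \<times> real" and L :: "real^'m \<Rightarrow> real \<times> (real^'m) \<times> real" and c :: real
  assumes T: "sym_trilinear T" and q: "T q q q = 0" "q \<noteq> 0"
    and c: "c = 3 * T q q e" "c > 0"
    and L: "linear L" "\<And>s. T q q (L s) = 0" "\<And>s. T q (L s) (L s) = - (s \<bullet> s) / 3"
begin

interpretation sym_trilinear T by (rule T)

lemma linear_blow_up: "linear (blow_up q L e c \<mu>)"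
  unfolding blow_up_def
  by (rule linearI) (simp_all only: lsm_linear_simps linear_add[OF L(1)] linear_cmul[OF L(1)]
      real_scaleR_def scaleR_add_left scaleR_add_right add_divide_distrib algebra_simps scaleR_scaleR times_divide_eq_right)

lemma blow_up_polar:
  "T q q (blow_up q L e c \<mu> z) = \<mu> ^ 4 * emm z / 3"
  using c by (simp add: blow_up_def add scale q(1) L(2))

lemma bij_blow_up:
  assumes "\<mu> > 0"
  shows "bij (blow_up q L e c \<mu>)"
proof -
  let ?B = "blow_up q L e c \<mu>"
  have "z = 0" if z: "?B z = 0" for z
  proof -
    have m: "emm z = 0" using blow_up_polar[of \<mu> z] assms unfolding z by (simp add: zero)
    then have Bz: "?B z = (ell z / \<mu>\<^sup>2) *\<^sub>R q + \<mu> *\<^sub>R L (svec z)" by (simp add: blow_up_def)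
    have "T q (?B z) (L (svec z)) = \<mu> * (- (svec z \<bullet> svec z) / 3)"
      unfolding Bz using L(2,3) by (simp add: add scale)
    then have s: "svec z = 0" using assms unfolding z by (simp add: zero)
    then have "ell z = 0" using z q(2) assms unfolding Bz by (simp add: linear_0[OF L(1)])
    then show ?thesis using m s by (intro lsm_eqI) (simp_all add: lsm_linear_simps)
  qed
  then have "inj ?B" using linear_injective_0[OF linear_blow_up] by blast
  then show ?thesis
    using linear_injective_imp_surjective[OF linear_blow_up] by (simp add: bij_def)
qed

text \<open>In the expansion at \<open>q\<close> the two terms that make up \<open>hbar\<close> have weight zero
  under the rescaling by powers of \<open>\<mu>\<close>; all others carry a positive power of \<open>\<mu>\<close>.\<close>

lemma blow_up_tendsto:
  assumes "\<And>k. \<mu> k > 0" "\<mu> \<longlonglongrightarrow> 0"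
  shows "(\<lambda>k. T (blow_up q L e c (\<mu> k) z) (blow_up q L e c (\<mu> k) z) (blow_up q L e c (\<mu> k) z)) \<longlonglongrightarrow> hbar z"
proof -
  define l s m where "l = ell z" "s = L (svec z)" "m = emm z / c"
  define Q where "Q x = 6 * l * m * T q s e + 3 * l * m\<^sup>2 * x ^ 3 * T q e e
    + T s s s + 3 * x ^ 3 * m * T s s e + 3 * x ^ 6 * m\<^sup>2 * T s e e + x ^ 9 * m ^ 3 * T e e e" for x
  have "T (blow_up q L e c x z) (blow_up q L e c x z) (blow_up q L e c x z) = hbar z + x ^ 3 * Q x"
    if x: "x > 0" for x
  proof -
    define y where "y = x *\<^sub>R s + (x ^ 4 * m) *\<^sub>R e"
    define a where "a = l / x\<^sup>2"
    have B: "blow_up q L e c x z = a *\<^sub>R q + y" by (simp add: blow_up_def y_def a_def l_s_m_def)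
    have "T s q e = T q s e" "T s q s = T q s s" "T q e s = T q s e" "T e q q = T q q e"
      using swap_12 swap_23 by metis+
    note sw = this
    have qqy: "T q q y = x ^ 4 * m * (c / 3)"
      using L(2) c(1) by (simp add: y_def add scale l_s_m_def)
    have qyy: "T q y y = x\<^sup>2 * (- (svec z \<bullet> svec z) / 3) + 2 * x ^ 5 * m * T q s e + x ^ 8 * m\<^sup>2 * T q e e"
    proof -
      have "T q s s = - (svec z \<bullet> svec z) / 3" using L(3) by (simp add: l_s_m_def)
      then show ?thesis
        unfolding y_def add scale real_scaleR_def sw by (simp add: power2_eq_square eval_nat_numeral algebra_simps)
    qed
    have yyy: "T y y y = x ^ 3 * (T s s s + 3 * x ^ 3 * m * T s s e + 3 * x ^ 6 * m\<^sup>2 * T s e e + x ^ 9 * m ^ 3 * T e e e)"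
      unfolding y_def cube_add scale real_scaleR_def by (simp add: eval_nat_numeral algebra_simps)
    have ax: "a * x\<^sup>2 = l" using x by (simp add: a_def)
    have "T (a *\<^sub>R q + y) (a *\<^sub>R q + y) (a *\<^sub>R q + y) = 3 * a\<^sup>2 * T q q y + 3 * a * T q y y + T y y y"
      unfolding cube_add scale real_scaleR_def using q(1) by (simp add: power2_eq_square)
    also have "3 * a\<^sup>2 * T q q y = (a * x\<^sup>2)\<^sup>2 * (m * c)"
      unfolding qqy by (simp add: eval_nat_numeral)
    also have "\<dots> = l\<^sup>2 * emm z" unfolding ax using c(2) by (simp add: l_s_m_def)
    also have "3 * a * T q y y = (a * x\<^sup>2) * (- (svec z \<bullet> svec z) + 6 * x ^ 3 * m * T q s e + 3 * x ^ 6 * m\<^sup>2 * T q e e)"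
      unfolding qyy by (simp add: eval_nat_numeral algebra_simps)
    also have "\<dots> = l * (- (svec z \<bullet> svec z) + 6 * x ^ 3 * m * T q s e + 3 * x ^ 6 * m\<^sup>2 * T q e e)"
      unfolding ax ..
    finally show ?thesis
      unfolding B yyy Q_def hbar_lsm l_s_m_def(1)[symmetric] by (simp add: eval_nat_numeral algebra_simps)
  qed
  then have eq: "(\<lambda>k. T (blow_up q L e c (\<mu> k) z) (blow_up q L e c (\<mu> k) z) (blow_up q L e c (\<mu> k) z))
      = (\<lambda>k. hbar z + \<mu> k ^ 3 * Q (\<mu> k))" using assms(1) by blast
  have "(\<lambda>k. hbar z + \<mu> k ^ 3 * Q (\<mu> k)) \<longlonglongrightarrow> hbar z + 0 ^ 3 * Q 0"
    unfolding Q_def by (intro tendsto_intros assms(2))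
  then show ?thesis unfolding eq by simp
qed

end

lemma base_component_orthogonal:
  fixes D :: "real \<times> 'b::euclidean_space \<Rightarrow> real \<times> 'b"
  assumes D: "orthogonal_transformation D" "D (1, 0) = (1, 0)" and g: "g (1, 0) = 1"
  shows "D ` base_component (g \<circ> D) = base_component g"
proof (rule subset_antisym)
  have mono: "E ` base_component (f \<circ> E) \<subseteq> base_component f"
    if E: "orthogonal_transformation E" "E (1, 0) = (1, 0)" and f: "f (1, 0) = 1" for E :: "real \<times> 'b \<Rightarrow> real \<times> 'b" and f
    unfolding base_component_def
  proof (rule connected_component_maximal)
    have "(1, 0) \<in> connected_component_set {z. (f \<circ> E) z = 1} (1, 0)"
      using E(2) f by (simp add: connected_component_refl_eq)
    then show "(1, 0) \<in> E ` connected_component_set {z. (f \<circ> E) z = 1} (1, 0)"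
      using E(2) by (metis image_eqI)
    have "linear E" using E(1) by (simp add: orthogonal_transformation_def)
    then have "continuous_on S E" for S by (simp add: linear_continuous_on linear_conv_bounded_linear)
    then show "connected (E ` connected_component_set {z. (f \<circ> E) z = 1} (1, 0))"
      by (intro connected_continuous_image connected_connected_component)
    show "E ` connected_component_set {z. (f \<circ> E) z = 1} (1, 0) \<subseteq> {z. f z = 1}"
      using connected_component_subset[of "{z. (f \<circ> E) z = 1}" "(1, 0)"] by auto
  qed
  show "D ` base_component (g \<circ> D) \<subseteq> base_component g" by (rule mono[of D g, OF D g])
  have bij: "bij D" using D(1) by (rule orthogonal_transformation_bij)
  have "inv_into UNIV D (1, 0) = (1, 0)" using D(2) bij by (metis bij_inv_eq_iff)
  moreover have "(g \<circ> D) \<circ> inv_into UNIV D = g" 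
    using surj_iff[THEN iffD1, OF bij_is_surj[OF bij]] by (simp add: o_assoc[symmetric])
  ultimately have sub: "inv_into UNIV D ` base_component g \<subseteq> base_component (g \<circ> D)"
    using mono[of "inv_into UNIV D" "g \<circ> D"] orthogonal_transformation_inv[OF D(1)] g D(2) by simp
  show "base_component g \<subseteq> D ` base_component (g \<circ> D)"
  proof
    fix z assume "z \<in> base_component g"
    then have "inv_into UNIV D z \<in> base_component (g \<circ> D)" using sub by blast
    moreover have "z = D (inv_into UNIV D z)" using bij by (simp add: bij_is_surj surj_f_inv_f)
    ultimately show "z \<in> D ` base_component (g \<circ> D)" by blast
  qed
qed

text \<open>With \<open>\<mu>\<^sup>6 = c (R - t)\<close> the map \<open>blow_up\<close> carries \<open>(1, 0)\<close> to
  \<open>A t (1, 0)\<close> up to a factor that tends to one. So the given frames \<open>A t\<close> and the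
  frames \<open>blow_up\<close> differ by maps to which the compactness statement
  \<open>standard_form_limit\<close> applies, and the limit polynomial is \<open>hbar\<close> composed with an
  orthogonal map that fixes \<open>(1, 0)\<close>.\<close>
lemma limit_geometry_equivalent:
  fixes h :: "real \<times> (real^'m) \<times> real \<Rightarrow> real"
  assumes ccpsr: "ccpsr_manifold h H" and reg: "regular_boundary_behaviour h H"
    and limit: "limit_geometry h H h' H'"
  shows "psr_equivalent h' H' hbar (Hbar :: (real \<times> (real^'m) \<times> real) set)"
proof -
  have hyper: "smooth_hypersurface H" and closed: "closed H" and cubic: "cubic_form h"
    and h1: "\<And>z. z \<in> H \<Longrightarrow> h z = 1"
    using ccpsr by (simp_all add: ccpsr_manifold_def psr_manifold_def hyperbolic_cubic_def)
  obtain T where T: "sym_trilinear T" and h: "h = (\<lambda>x. T x x x)"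
    using cubic by (rule cubic_form_polarize)
  interpret sym_trilinear T by (rule T)
  have level: "\<And>z. z \<in> H \<Longrightarrow> T z z z = 1" using h1 by (simp add: h)
  obtain p v R A where pH: "p \<in> H" and v: "v \<in> tangent_space H p" "v \<noteq> 0"
    and R: "0 < R" "h (p + R *\<^sub>R v) = 0" and nz: "\<forall>t\<in>{0<..<R}. h (p + t *\<^sub>R v) \<noteq> 0"
    and A: "\<forall>t\<in>{0..<R}. linear (A t) \<and> bij (A t) \<and>
           A t (1, 0) = (h (p + t *\<^sub>R v) powr (-1/3)) *\<^sub>R (p + t *\<^sub>R v) \<and> standard_form (h \<circ> A t)"
    and lim: "\<forall>z. ((\<lambda>t. (h \<circ> A t) z) \<longlongrightarrow> h' z) (at_left R)" and H': "H' = base_component h'"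
    using limit unfolding limit_geometry_def by blast
  have pos: "h (p + t *\<^sub>R v) > 0" if t: "0 \<le> t" "t < R" for t
  proof (rule ccontr)
    assume "\<not> h (p + t *\<^sub>R v) > 0"
    moreover have "continuous_on {0..t} (\<lambda>t. h (p + t *\<^sub>R v))"
      unfolding h by (rule continuous_on_compose2[OF continuous_on_cube[of UNIV]]) (auto intro!: continuous_intros)
    ultimately obtain x where x: "0 \<le> x" "x \<le> t" "h (p + x *\<^sub>R v) = 0"
      using IVT2'[of "\<lambda>t. h (p + t *\<^sub>R v)" t 0 0] t(1) h1[OF pH] by auto
    then show False using nz t(2) h1[OF pH] by (cases "x = 0") auto
  qed
  define q where "q = p + R *\<^sub>R v"
  have reg': "regular_boundary_behaviour (\<lambda>x. T x x x) H" using reg by (simp only: h)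
  have R2: "T (p + R *\<^sub>R v) (p + R *\<^sub>R v) (p + R *\<^sub>R v) = 0" using R(2) by (simp only: h)
  have pos': "T (p + t *\<^sub>R v) (p + t *\<^sub>R v) (p + t *\<^sub>R v) > 0" if "0 \<le> t" "t < R" for t
    using pos[OF that] by (simp only: h)
  have q0: "q \<noteq> 0"
    by (rule regular_end_point(1)[OF hyper closed level reg' pH v R(1) R2 pos' q_def])
  have qv: "T q q v < 0"
    by (rule regular_end_point(2)[OF hyper closed level reg' pH v R(1) R2 pos' q_def])
  have definite: "T q w w < 0" if "T q q w = 0" "w \<notin> span {q}" for w
    by (rule regular_end_point(3)[OF hyper closed level reg' pH v R(1) R2 pos' q_def that])
  have Tq: "T q q q = 0" using R(2) by (simp add: h q_def)
  define e where "e = - v"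
  define c where "c = 3 * T q q e"
  have c: "c > 0" using qv by (simp add: c_def e_def neg)
  obtain L :: "real^'m \<Rightarrow> real \<times> (real^'m) \<times> real"
    where L: "linear L" "\<And>s. T q q (L s) = 0" "\<And>s. T q (L s) (L s) = - (s \<bullet> s) / 3"
    using boundary_frame[OF T Tq q0 less_imp_neq[OF qv] definite] by blast
  \<comment> \<open>as the limit \<open>h'\<close> is given, it may be computed along one sequence of parameters\<close>
  define \<epsilon> where "\<epsilon> k = R / real (k + 1)" for k :: nat
  define t where "t k = R - \<epsilon> k" for k
  define \<mu> where "\<mu> k = (c * \<epsilon> k) powr (1/6)" for k
  have \<epsilon>: "\<epsilon> k > 0" "\<epsilon> k \<le> R" for k
    using R(1) by (simp_all add: \<epsilon>_def field_simps)
  have \<epsilon>0: "\<epsilon> \<longlonglongrightarrow> 0" unfolding \<epsilon>_def using LIMSEQ_Suc[OF lim_const_over_n[of R]] by simp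
  have t: "t k \<in> {0..<R}" for k using \<epsilon>[of k] by (simp add: t_def)
  have \<mu>: "\<mu> k > 0" "\<mu> k ^ 6 = c * \<epsilon> k" "(\<mu> k)\<^sup>2 = (c * \<epsilon> k) powr (1/3)" for k
  proof -
    have ce: "c * \<epsilon> k > 0" using c \<epsilon>(1)[of k] by simp
    then show "\<mu> k > 0" unfolding \<mu>_def powr_gt_zero by linarith
    have "\<mu> k ^ n = (c * \<epsilon> k) powr (real n / 6)" for n
      using c \<epsilon>(1)[of k] by (simp add: \<mu>_def powr_power)
    from this[of 6] this[of 2] show "\<mu> k ^ 6 = c * \<epsilon> k" "(\<mu> k)\<^sup>2 = (c * \<epsilon> k) powr (1/3)"
      using ce by simp_all
  qed
  have "(\<lambda>k. (c * \<epsilon> k) powr (1/6)) \<longlonglongrightarrow> (c * 0) powr (1/6)"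
    using c \<epsilon>(1) by (intro tendsto_powr' tendsto_intros \<epsilon>0) (auto intro!: always_eventually less_imp_le)
  then have \<mu>0: "\<mu> \<longlonglongrightarrow> 0" by (simp add: \<mu>_def[abs_def])
  define B where "B k = blow_up q L e c (\<mu> k)" for k
  note blow = T Tq q0 c_def c L
  have B: "linear (B k)" "bij (B k)" for k
    unfolding B_def using linear_blow_up[OF blow] bij_blow_up[OF blow \<mu>(1)] by blast+
  have AL: "linear (A (t k))" "standard_form (h \<circ> A (t k))"
    "A (t k) (1, 0) = (h (p + t k *\<^sub>R v) powr (-1/3)) *\<^sub>R (p + t k *\<^sub>R v)" for k
    using A t[of k] by blast+
  define C where "C k = inv_into UNIV (B k) \<circ> A (t k)" for k
  have BC: "B k (C k z) = A (t k) z" for k z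
    using B(2) by (simp add: C_def bij_is_surj surj_f_inv_f)
  have linC: "linear (C k)" for k
    unfolding C_def using AL(1) inj_linear_imp_inv_linear[OF B(1) bij_is_inj[OF B(2)]] by (rule linear_compose)
  define \<kappa> where "\<kappa> k = (h (p + t k *\<^sub>R v) / (c * \<epsilon> k)) powr (-1/3)" for k
  have pt: "p + t k *\<^sub>R v = q + \<epsilon> k *\<^sub>R e" for k
    by (simp add: t_def q_def e_def algebra_simps)
  have Ce: "C k (1, 0) = \<kappa> k *\<^sub>R (1, 0)" for k
  proof -
    have "B k (1, 0) = (1 / (\<mu> k)\<^sup>2) *\<^sub>R (q + \<epsilon> k *\<^sub>R e)"
    proof -
      have "\<mu> k ^ 4 / c = \<epsilon> k / (\<mu> k)\<^sup>2"
        using \<mu>(1)[of k] \<mu>(2)[of k] c by (simp add: field_simps power_add[symmetric])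
      then show ?thesis by (simp add: B_def blow_up_def linear_0[OF L(1)] scaleR_add_right)
    qed
    moreover have "\<kappa> k = h (p + t k *\<^sub>R v) powr (-1/3) * (\<mu> k)\<^sup>2"
      unfolding \<kappa>_def \<mu>(3) using pos[of "t k"] t[of k] c \<epsilon>(1)[of k]
      by (subst powr_divide) (simp_all add: powr_minus_divide)
    ultimately have "B k (\<kappa> k *\<^sub>R (1, 0)) = A (t k) (1, 0)"
      using \<mu>(1)[of k] unfolding AL(3) pt linear_cmul[OF B(1)] by simp
    then show ?thesis unfolding BC[symmetric] using bij_is_inj[OF B(2)] by (metis injD)
  qed
  have "\<kappa> \<longlonglongrightarrow> 1 powr (-1/3)"
    unfolding \<kappa>_def
  proof (intro tendsto_powr tendsto_const)
    have "h (p + t k *\<^sub>R v) / (c * \<epsilon> k) = 1 + \<epsilon> k * (3 * T q e e / c) + (\<epsilon> k)\<^sup>2 * (T e e e / c)" for k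
    proof -
      have "h (p + t k *\<^sub>R v) = c * \<epsilon> k + 3 * (\<epsilon> k)\<^sup>2 * T q e e + \<epsilon> k ^ 3 * T e e e"
        unfolding pt h cube_add scale real_scaleR_def Tq c_def by (simp add: power2_eq_square power3_eq_cube)
      then show ?thesis using c \<epsilon>(1)[of k] by (simp add: field_simps power2_eq_square power3_eq_cube)
    qed
    moreover have "(\<lambda>k. 1 + \<epsilon> k * (3 * T q e e / c) + (\<epsilon> k)\<^sup>2 * (T e e e / c))
        \<longlonglongrightarrow> 1 + 0 * (3 * T q e e / c) + 0\<^sup>2 * (T e e e / c)"
      by (intro tendsto_intros \<epsilon>0)
    ultimately show "(\<lambda>k. h (p + t k *\<^sub>R v) / (c * \<epsilon> k)) \<longlonglongrightarrow> 1" by simp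
  qed simp
  then have \<kappa>: "\<kappa> \<longlonglongrightarrow> 1" by simp
  define TB where "TB k x y z = T (B k x) (B k y) (B k z)" for k x y z
  have TB: "sym_trilinear (TB k)" for k
    unfolding TB_def[abs_def] by (rule compose_linear[OF B(1)])
  have cube: "(\<lambda>k. TB k z z z) \<longlonglongrightarrow> hbar_polar z z z" for z
    using blow_up_tendsto[OF blow \<mu>(1) \<mu>0, of z] by (simp add: TB_def B_def hbar_cube)
  have TBlim: "(\<lambda>k. TB k x y z) \<longlonglongrightarrow> hbar_polar x y z" for x y z
  proof -
    have "(\<lambda>k. 6 * TB k x y z) \<longlonglongrightarrow> 6 * hbar_polar x y z"
      unfolding sym_trilinear.polarization[OF TB] sym_trilinear.polarization[OF hbar_polar]
      by (intro tendsto_intros cube)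
    from tendsto_divide[OF this tendsto_const[of 6]] show ?thesis
      unfolding nonzero_mult_div_cancel_left[OF zero_neq_numeral[symmetric]] by simp
  qed
  have TBC: "TB k (C k x) (C k x) (C k x) = (h \<circ> A (t k)) x" for k x
    by (simp add: TB_def BC h)
  have "standard_form (hbar :: real \<times> (real^'m) \<times> real \<Rightarrow> real)"
    using ccpsr_hbar[where 'm = 'm] by (simp add: ccpsr_in_standard_form_def)
  then have std: "standard_form (\<lambda>x :: real \<times> (real^'m) \<times> real. hbar_polar x x x)" by (simp add: hbar_cube)
  have stdC: "standard_form (\<lambda>x. TB k (C k x) (C k x) (C k x))" for k
    unfolding TBC using AL(2)[of k] by (simp add: comp_def)
  have "t \<longlonglongrightarrow> R - 0" unfolding t_def by (intro tendsto_intros \<epsilon>0)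
  then have tR: "filterlim t (at_left R) sequentially"
    using t by (intro filterlim_at_withinI) (auto intro!: always_eventually)
  have h'lim: "(\<lambda>k. TB k (C k z) (C k z) (C k z)) \<longlonglongrightarrow> h' z" for z
    unfolding TBC using filterlim_compose[OF lim[rule_format] tR] .
  obtain D :: "real \<times> (real^'m) \<times> real \<Rightarrow> real \<times> (real^'m) \<times> real"
    where D: "orthogonal_transformation D" "D (1, 0) = (1, 0)"
      and "h' = (\<lambda>x. hbar_polar (D x) (D x) (D x))"
    using standard_form_limit[OF TB hbar_polar TBlim std linC Ce \<kappa> stdC h'lim] by blast
  then have h'D: "h' = hbar \<circ> D" by (simp add: hbar_cube comp_def)
  have DH: "D ` H' = Hbar"
    unfolding H' h'D Hbar_def
    by (rule base_component_orthogonal[OF D]) (simp add: hbar_lsm)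
  have bij: "bij D" using D(1) by (rule orthogonal_transformation_bij)
  have H'v: "H' = D -` Hbar"
    unfolding DH[symmetric] using bij by (simp add: bij_is_inj inj_vimage_image_eq)
  have psr: "psr_manifold hbar (Hbar :: (real \<times> (real^'m) \<times> real) set)"
    using ccpsr_hbar[where 'm = 'm] by (simp add: ccpsr_in_standard_form_def ccpsr_manifold_def)
  then have "psr_manifold h' H'"
    unfolding h'D H'v by (rule psr_manifold_orthogonal_vimage[OF D(1)])
  moreover have "linear D" using D(1) by (simp add: orthogonal_transformation_def)
  ultimately show ?thesis
    unfolding psr_equivalent_def using psr bij DH h'D by (intro conjI exI[of _ D]) simp_all
qed

theorem theorem1p15:
  fixes h :: "real \<times> (real^'m) \<times> real \<Rightarrow> real"
    and H :: "(real \<times> (real^'m) \<times> real) set"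
  assumes "ccpsr_manifold h H"
    and "regular_boundary_behaviour h H"
  shows "(\<forall>h' H'. limit_geometry h H h' H' \<longrightarrow>
            psr_equivalent h' H' hbar (Hbar :: (real \<times> (real^'m) \<times> real) set))
       \<and> ccpsr_in_standard_form hbar (Hbar :: (real \<times> (real^'m) \<times> real) set)
       \<and> open_lie_group (semidirect_group :: (real \<times> (real^'m)) monoid)
       \<and> smooth_on (carrier (semidirect_group :: (real \<times> (real^'m)) monoid) \<times> UNIV)
           (\<lambda>(g, z). displayed_map g z)
       \<and> (\<forall>g \<in> carrier (semidirect_group :: (real \<times> (real^'m)) monoid).
            linear (displayed_map g) \<and> hbar \<circ> displayed_map g = hbar)
       \<and> simply_transitive_right_action semidirect_group displayed_map
           (Hbar :: (real \<times> (real^'m) \<times> real) set)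
       \<and> (CARD('m) = 1 \<longrightarrow>
            (\<exists>c>0. isometric_onto half_plane half_plane_metric
               (Hbar :: (real \<times> (real^'m) \<times> real) set)
               (\<lambda>p u v. c * psr_metric hbar p u v)))"
proof (intro conjI allI impI ballI)
  show "psr_equivalent h' H' hbar Hbar" if "limit_geometry h H h' H'" for h' H'
    by (rule limit_geometry_equivalent[OF assms that])
  show "hbar \<circ> displayed_map g = hbar"
    if "g \<in> carrier (semidirect_group :: (real \<times> (real^'m)) monoid)" for g
    using that by (intro ext) (auto simp: hbar_displayed_map)
  show "\<exists>c>0. isometric_onto half_plane half_plane_metric
      (Hbar :: (real \<times> (real^'m) \<times> real) set) (\<lambda>p u v. c * psr_metric hbar p u v)" if "CARD('m) = 1"
    using Hbar_hyperbolic_plane[OF that] by (intro exI[of _ "9/8"]) simp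
qed (rule ccpsr_hbar open_lie_group_semidirect smooth_displayed_map linear_displayed_map displayed_map_action)+

end
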